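(* Let $\epsilon\in(0,1)$ and $\Delta>0$, and set $\gamma=\frac{\epsilon}{2\Delta}$, $\zeta_1=\frac{2}{\epsilon}$, $\zeta_2=\frac{6\zeta_1\Delta}{\epsilon(1-\epsilon)}$ and $k=(1+\gamma^{-1})\zeta_2$. Let $(T,L,c,r)$ be a rooted shadow-complete WDTAP instance with cost ratio at most $\Delta$, and let $x$ be a feasible solution to the LP $\min\{\sum_\ell c(\ell)x_\ell: Mx\ge\mathbf 1, x\ge 0\}$ such that no arc is $\zeta_1$-covered with respect to $x$. Then one can, in polynomial time, compute a splitting $\sigma^*$ of $L$ and a vertex set $W^*\subseteq V$ such that: (i) $x^*:=\mathrm{split}(x,\sigma^* )$ satisfies $c(x^* )\le(1+\epsilon)c(x)$; (ii) every vertex of $W^*$ is up-independent or down-independent with respect to $\mathrm{supp}(x^* )$; (iii) for every splitting $\sigma$ of $L$ such that for every $W^*$-cross-link $\ell$ every link in $\sigma(\ell)$ is an up-link or a down-link, the link set $L'=\mathrm{supp}(\mathrm{split}(x^*,\sigma))$ satisfies, with visibility taken with respect to $L'$: (a) $\overrightarrow{\mathrm{viwidth}}(v)\le k$ for every $v\in V\setminus\{r\}$; (b) $\mathrm{viwidth}_{up}(r)\le k$ and $\mathrm{viwidth}_{down}(r)\le k$, and $\overleftarrow{\mathrm{viwidth}}(v)\le k$ for every $v\in V\setminus\{r\}$ such that $a_v$ is not $\zeta_2$-heavy with respect to $x^*$.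
   Context: WDTAP instance $(T,L,c)$: oriented tree $T=(V,A)$, links $L\subseteq V\times V$, costs $c\colon L\to\mathbb{R}_{>0}$; cost ratio $=\max c/\min c$. For $\ell=(u,v)$, $P_\ell$ is the $u$-$v$ path in the underlying undirected tree traversed from $u$ to $v$; $\mathrm{cov}(\ell)$ is its arc set, $\overrightarrow{\mathrm{cov}}(\ell)$ the arcs traversed against their orientation (the arcs $\ell$ covers), $\overleftarrow{\mathrm{cov}}(\ell)=\mathrm{cov}(\ell)\setminus\overrightarrow{\mathrm{cov}}(\ell)$. $M\in\{0,1\}^{A\times L}$ with $M_{a,\ell}=1$ iff $a\in\overrightarrow{\mathrm{cov}}(\ell)$; $c(x)=\sum_\ell c(\ell)x_\ell$; $\mathrm{supp}(x)=\{\ell: x_\ell>0\}$; for $L''\subseteq L$, $x(L'')=\sum_{\ell\in L''}x_\ell$. An arc $a$ is $\alpha$-covered w.r.t. $x$ if $x(\{\ell: a\in\overrightarrow{\mathrm{cov}}(\ell)\})\ge\alpha$ and $\alpha$-heavy if $x(\{\ell: a\in\overleftarrow{\mathrm{cov}}(\ell)\})\ge\alpha$. A shadow of $\ell=(u,v)$ is a link $(u',v')$ with $u',v'$ on $P_\ell$ and $u'$ appearing before $v'$ when going from $u$ to $v$. The instance is shadow-complete if for every $\ell\in L$ every shadow $\ell'$ of $\ell$ lies in $L$ with $c(\ell')\le c(\ell)$. A splitting of $L$ is a map $\sigma\colon L\to 2^L$ sending each $\ell$ to a set of shadows of $\ell$ whose paths partition the arc set of $P_\ell$; $\mathrm{split}(x,\sigma)_{\ell'}=\sum_{\ell:\ell'\in\sigma(\ell)}x_\ell$.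 Rooted instance: root $r$; up-arcs point towards $r$, down-arcs away; $A_{up},A_{down}$. For $v$, $T_v=(U_v,A_v)$ is the subtree of descendants of $v$; for $v\ne r$, $a_v$ is the arc joining $v$ to its parent. $\mathrm{apex}(\ell)$ is the least common ancestor of the endpoints; $\ell=(u,v)$ is an up-link if $v=\mathrm{apex}(\ell)$, a down-link if $u=\mathrm{apex}(\ell)$, and a $W$-cross-link if $\mathrm{apex}(\ell)\in W$ and it is neither. Vertex $v$ is up-independent (down-independent) w.r.t. $L''$ if for every $\ell\in L''$, $\overrightarrow{\mathrm{cov}}(\ell)\cap A_v\cap A_{up}=\emptyset$ (resp. $\cap A_{down}=\emptyset$) or $\overrightarrow{\mathrm{cov}}(\ell)\subseteq A_v$. $\overline{P}_\ell$ is the shortest subpath of $P_\ell$ containing all arcs of $\overrightarrow{\mathrm{cov}}(\ell)$; $\mathrm{in}(P)$ denotes inner vertices of a path $P$. An arc $a\in A_v$ is visible to $v$ w.r.t. $L''$ if some $\ell\in L''$ has $a\in\overrightarrow{\mathrm{cov}}(\ell)$ and $v\in\mathrm{in}(\overline{P}_\ell)$. For an arc $a$, $\mathrm{apex}(a)$ is its endpoint closer to $r$; $F\subseteq A$ is ancestor-free if there are no $a,a'\in F$ with $a'$ on the $\mathrm{apex}(a)$-$r$ path. $\mathrm{viwidth}_{up}(v)$ ($\mathrm{viwidth}_{down}(v)$) is the maximum size of an ancestor-free set of up-arcs (down-arcs) visible to $v$. For $v\ne r$: if $a_v$ is an up-arc, $\overrightarrow{\mathrm{viwidth}}(v)=\mathrm{viwidth}_{up}(v)$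 and $\overleftarrow{\mathrm{viwidth}}(v)=\mathrm{viwidth}_{down}(v)$; if $a_v$ is a down-arc, these are swapped. *)

theory Defs
  imports
    Complex_Main
    "HOL-Library.Sublist"
    "HOL-Library.Disjoint_Sets"
    "HOL-Library.Log_Nat"
    "HOL-Computational_Algebra.Polynomial"
begin

section \<open>Rooted WDTAP instances\<close>

type_synonym 'v arc = "'v \<times> 'v"
type_synonym 'v link = "'v \<times> 'v"

record 'v wdtap =
  verts :: "'v set"
  arcs :: "'v arc set"
  root :: 'v
  links :: "'v link set"
  cost :: "'v link \<Rightarrow> real"

definition adj :: "'v arc set \<Rightarrow> 'v \<Rightarrow> 'v \<Rightarrow> bool" where
  "adj A u v \<longleftrightarrow> (u, v) \<in> A \<or> (v, u) \<in> A"

text \<open>An orientation of a finite undirected tree: antiparallel arcs and loops are excluded, and the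
  underlying simple graph is connected and has no cycle.\<close>

definition oriented_tree :: "'v set \<Rightarrow> 'v arc set \<Rightarrow> bool" where
  "oriented_tree V A \<longleftrightarrow>
     finite V \<and> V \<noteq> {} \<and> A \<subseteq> V \<times> V \<and>
     (\<forall>u v. (u, v) \<in> A \<longrightarrow> (v, u) \<notin> A) \<and>
     (\<forall>u\<in>V. \<forall>v\<in>V. (adj A)\<^sup>*\<^sup>* u v) \<and>
     \<not> (\<exists>p. length p \<ge> 3 \<and> distinct p \<and> successively (adj A) p \<and> adj A (last p) (hd p))"

definition rooted_wdtap :: "'v wdtap \<Rightarrow> bool" where
  "rooted_wdtap I \<longleftrightarrow>
     oriented_tree (verts I) (arcs I) \<and> root I \<in> verts I \<and>
     links I \<subseteq> verts I \<times> verts I \<and> (\<forall>l\<in>links I. cost I l > 0)"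

definition cost_ratio :: "'v wdtap \<Rightarrow> real" where
  "cost_ratio I = Max (cost I ` links I) / Min (cost I ` links I)"

section \<open>Paths, coverage, shadows\<close>

text \<open>Paths of the underlying undirected tree are represented by their vertex sequences.\<close>

definition simple_path :: "'v wdtap \<Rightarrow> 'v \<Rightarrow> 'v list \<Rightarrow> 'v \<Rightarrow> bool" where
  "simple_path I u p v \<longleftrightarrow>
     p \<noteq> [] \<and> hd p = u \<and> last p = v \<and> set p \<subseteq> verts I \<and> distinct p \<and>
     successively (adj (arcs I)) p"

definition tree_path :: "'v wdtap \<Rightarrow> 'v \<Rightarrow> 'v \<Rightarrow> 'v list" where
  "tree_path I u v = (THE p. simple_path I u p v)"

definition link_path :: "'v wdtap \<Rightarrow> 'v link \<Rightarrow> 'v list" where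
  "link_path I l = tree_path I (fst l) (snd l)"

definition steps :: "'v list \<Rightarrow> ('v \<times> 'v) set" where
  "steps p = set (zip p (tl p))"

definition path_arcs :: "'v wdtap \<Rightarrow> 'v list \<Rightarrow> 'v arc set" where
  "path_arcs I p = {a \<in> arcs I. a \<in> steps p \<or> prod.swap a \<in> steps p}"

definition cov :: "'v wdtap \<Rightarrow> 'v link \<Rightarrow> 'v arc set" where
  "cov I l = path_arcs I (link_path I l)"

text \<open>\<open>fcov\<close> are the arcs traversed against their orientation, i.e. the arcs the link covers;
  \<open>bcov\<close> are the remaining arcs of the path.\<close>

definition fcov :: "'v wdtap \<Rightarrow> 'v link \<Rightarrow> 'v arc set" where
  "fcov I l = {a \<in> arcs I. prod.swap a \<in> steps (link_path I l)}"

definition bcov :: "'v wdtap \<Rightarrow> 'v link \<Rightarrow> 'v arc set" where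
  "bcov I l = cov I l - fcov I l"

definition shadow :: "'v wdtap \<Rightarrow> 'v link \<Rightarrow> 'v link \<Rightarrow> bool" where
  "shadow I l' l \<longleftrightarrow>
     (\<exists>i j. i < j \<and> j < length (link_path I l) \<and>
            l' = (link_path I l ! i, link_path I l ! j))"

definition shadow_complete :: "'v wdtap \<Rightarrow> bool" where
  "shadow_complete I \<longleftrightarrow>
     (\<forall>l\<in>links I. \<forall>l'. shadow I l' l \<longrightarrow> l' \<in> links I \<and> cost I l' \<le> cost I l)"

section \<open>The linear program and splittings\<close>

definition cov_matrix :: "'v wdtap \<Rightarrow> 'v arc \<Rightarrow> 'v link \<Rightarrow> real" where
  "cov_matrix I a l = (if a \<in> fcov I l then 1 else 0)"

definition lp_feasible :: "'v wdtap \<Rightarrow> ('v link \<Rightarrow> real) \<Rightarrow> bool" where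
  "lp_feasible I x \<longleftrightarrow>
     (\<forall>a\<in>arcs I. (\<Sum>l\<in>links I. cov_matrix I a l * x l) \<ge> 1) \<and> (\<forall>l\<in>links I. x l \<ge> 0)"

definition cost_of :: "'v wdtap \<Rightarrow> ('v link \<Rightarrow> real) \<Rightarrow> real" where
  "cost_of I x = (\<Sum>l\<in>links I. cost I l * x l)"

definition supp :: "'v wdtap \<Rightarrow> ('v link \<Rightarrow> real) \<Rightarrow> 'v link set" where
  "supp I x = {l \<in> links I. x l > 0}"

definition covered :: "'v wdtap \<Rightarrow> ('v link \<Rightarrow> real) \<Rightarrow> real \<Rightarrow> 'v arc \<Rightarrow> bool" where
  "covered I x \<alpha> a \<longleftrightarrow> sum x {l \<in> links I. a \<in> fcov I l} \<ge> \<alpha>"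

definition heavy :: "'v wdtap \<Rightarrow> ('v link \<Rightarrow> real) \<Rightarrow> real \<Rightarrow> 'v arc \<Rightarrow> bool" where
  "heavy I x \<alpha> a \<longleftrightarrow> sum x {l \<in> links I. a \<in> bcov I l} \<ge> \<alpha>"

definition splitting :: "'v wdtap \<Rightarrow> ('v link \<Rightarrow> 'v link set) \<Rightarrow> bool" where
  "splitting I \<sigma> \<longleftrightarrow>
     (\<forall>l\<in>links I. \<sigma> l \<subseteq> links I \<and> (\<forall>l'\<in>\<sigma> l. shadow I l' l) \<and>
        disjoint_family_on (cov I) (\<sigma> l) \<and> (\<Union>l'\<in>\<sigma> l. cov I l') = cov I l)"

definition split :: "'v wdtap \<Rightarrow> ('v link \<Rightarrow> real) \<Rightarrow> ('v link \<Rightarrow> 'v link set) \<Rightarrow> 'v link \<Rightarrow> real" where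
  "split I x \<sigma> l' = sum x {l \<in> links I. l' \<in> \<sigma> l}"

section \<open>The rooted structure\<close>

definition root_path :: "'v wdtap \<Rightarrow> 'v \<Rightarrow> 'v list" where
  "root_path I v = tree_path I v (root I)"

definition up_arcs :: "'v wdtap \<Rightarrow> 'v arc set" where
  "up_arcs I = {a \<in> arcs I. a \<in> steps (root_path I (fst a))}"

definition down_arcs :: "'v wdtap \<Rightarrow> 'v arc set" where
  "down_arcs I = {a \<in> arcs I. prod.swap a \<in> steps (root_path I (snd a))}"

definition desc_verts :: "'v wdtap \<Rightarrow> 'v \<Rightarrow> 'v set" where
  "desc_verts I v = {u \<in> verts I. v \<in> set (root_path I u)}"

definition desc_arcs :: "'v wdtap \<Rightarrow> 'v \<Rightarrow> 'v arc set" where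
  "desc_arcs I v = {a \<in> arcs I. fst a \<in> desc_verts I v \<and> snd a \<in> desc_verts I v}"

text \<open>Only meaningful for \<open>v \<noteq> root I\<close>.\<close>

definition parent :: "'v wdtap \<Rightarrow> 'v \<Rightarrow> 'v" where
  "parent I v = root_path I v ! 1"

definition parent_arc :: "'v wdtap \<Rightarrow> 'v \<Rightarrow> 'v arc" where
  "parent_arc I v = (if (v, parent I v) \<in> arcs I then (v, parent I v) else (parent I v, v))"

text \<open>The least common ancestor is the common ancestor that is a descendant of every common
  ancestor.\<close>

definition apex :: "'v wdtap \<Rightarrow> 'v link \<Rightarrow> 'v" where
  "apex I l =
     (let C = set (root_path I (fst l)) \<inter> set (root_path I (snd l))
      in THE w. w \<in> C \<and> (\<forall>w'\<in>C. w' \<in> set (root_path I w)))"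

definition up_link :: "'v wdtap \<Rightarrow> 'v link \<Rightarrow> bool" where
  "up_link I l \<longleftrightarrow> snd l = apex I l"

definition down_link :: "'v wdtap \<Rightarrow> 'v link \<Rightarrow> bool" where
  "down_link I l \<longleftrightarrow> fst l = apex I l"

definition cross_link :: "'v wdtap \<Rightarrow> 'v set \<Rightarrow> 'v link \<Rightarrow> bool" where
  "cross_link I W l \<longleftrightarrow> apex I l \<in> W \<and> \<not> up_link I l \<and> \<not> down_link I l"

definition up_independent :: "'v wdtap \<Rightarrow> 'v link set \<Rightarrow> 'v \<Rightarrow> bool" where
  "up_independent I L v \<longleftrightarrow>
     (\<forall>l\<in>L. fcov I l \<inter> desc_arcs I v \<inter> up_arcs I = {} \<or> fcov I l \<subseteq> desc_arcs I v)"

definition down_independent :: "'v wdtap \<Rightarrow> 'v link set \<Rightarrow> 'v \<Rightarrow> bool" where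
  "down_independent I L v \<longleftrightarrow>
     (\<forall>l\<in>L. fcov I l \<inter> desc_arcs I v \<inter> down_arcs I = {} \<or> fcov I l \<subseteq> desc_arcs I v)"

section \<open>Visibility\<close>

text \<open>If the link covers no arc, this is the empty sequence, which has no inner vertex.\<close>

definition short_path :: "'v wdtap \<Rightarrow> 'v link \<Rightarrow> 'v list" where
  "short_path I l =
     (ARG_MIN length q. sublist q (link_path I l) \<and> fcov I l \<subseteq> path_arcs I q)"

definition inner :: "'v list \<Rightarrow> 'v set" where
  "inner p = set (butlast (tl p))"

definition visible :: "'v wdtap \<Rightarrow> 'v link set \<Rightarrow> 'v \<Rightarrow> 'v arc \<Rightarrow> bool" where
  "visible I L v a \<longleftrightarrow>
     a \<in> desc_arcs I v \<and> (\<exists>l\<in>L. a \<in> fcov I l \<and> v \<in> inner (short_path I l))"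

definition arc_apex :: "'v wdtap \<Rightarrow> 'v arc \<Rightarrow> 'v" where
  "arc_apex I a =
     (if length (root_path I (fst a)) < length (root_path I (snd a)) then fst a else snd a)"

definition ancestor_free :: "'v wdtap \<Rightarrow> 'v arc set \<Rightarrow> bool" where
  "ancestor_free I F \<longleftrightarrow>
     \<not> (\<exists>a\<in>F. \<exists>a'\<in>F. a' \<in> path_arcs I (root_path I (arc_apex I a)))"

definition viwidth_up :: "'v wdtap \<Rightarrow> 'v link set \<Rightarrow> 'v \<Rightarrow> nat" where
  "viwidth_up I L v =
     Max (card ` {F. F \<subseteq> {a \<in> up_arcs I. visible I L v a} \<and> ancestor_free I F})"

definition viwidth_down :: "'v wdtap \<Rightarrow> 'v link set \<Rightarrow> 'v \<Rightarrow> nat" where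
  "viwidth_down I L v =
     Max (card ` {F. F \<subseteq> {a \<in> down_arcs I. visible I L v a} \<and> ancestor_free I F})"

definition viwidth_fwd :: "'v wdtap \<Rightarrow> 'v link set \<Rightarrow> 'v \<Rightarrow> nat" where
  "viwidth_fwd I L v =
     (if parent_arc I v \<in> up_arcs I then viwidth_up I L v else viwidth_down I L v)"

definition viwidth_bwd :: "'v wdtap \<Rightarrow> 'v link set \<Rightarrow> 'v \<Rightarrow> nat" where
  "viwidth_bwd I L v =
     (if parent_arc I v \<in> up_arcs I then viwidth_down I L v else viwidth_up I L v)"

section \<open>Parameters, hypotheses and guarantees\<close>

definition gamma :: "real \<Rightarrow> real \<Rightarrow> real" where
  "gamma \<epsilon> \<Delta> = \<epsilon> / (2 * \<Delta>)"

definition zeta1 :: "real \<Rightarrow> real" where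
  "zeta1 \<epsilon> = 2 / \<epsilon>"

definition zeta2 :: "real \<Rightarrow> real \<Rightarrow> real" where
  "zeta2 \<epsilon> \<Delta> = 6 * zeta1 \<epsilon> * \<Delta> / (\<epsilon> * (1 - \<epsilon>))"

definition kpar :: "real \<Rightarrow> real \<Rightarrow> real" where
  "kpar \<epsilon> \<Delta> = (1 + inverse (gamma \<epsilon> \<Delta>)) * zeta2 \<epsilon> \<Delta>"

definition admissible :: "real \<Rightarrow> real \<Rightarrow> 'v wdtap \<Rightarrow> ('v link \<Rightarrow> real) \<Rightarrow> bool" where
  "admissible \<epsilon> \<Delta> I x \<longleftrightarrow>
     0 < \<epsilon> \<and> \<epsilon> < 1 \<and> 0 < \<Delta> \<and>
     rooted_wdtap I \<and> shadow_complete I \<and> cost_ratio I \<le> \<Delta> \<and>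
     lp_feasible I x \<and> (\<forall>a\<in>arcs I. \<not> covered I x (zeta1 \<epsilon>) a)"

definition small_visible_width ::
  "real \<Rightarrow> real \<Rightarrow> 'v wdtap \<Rightarrow> ('v link \<Rightarrow> real) \<Rightarrow> 'v link set \<Rightarrow> bool" where
  "small_visible_width \<epsilon> \<Delta> I xs L \<longleftrightarrow>
     (\<forall>v\<in>verts I - {root I}. viwidth_fwd I L v \<le> kpar \<epsilon> \<Delta>) \<and>
     viwidth_up I L (root I) \<le> kpar \<epsilon> \<Delta> \<and> viwidth_down I L (root I) \<le> kpar \<epsilon> \<Delta> \<and>
     (\<forall>v\<in>verts I - {root I}.
        \<not> heavy I xs (zeta2 \<epsilon> \<Delta>) (parent_arc I v) \<longrightarrow> viwidth_bwd I L v \<le> kpar \<epsilon> \<Delta>)"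

definition guarantee ::
  "real \<Rightarrow> real \<Rightarrow> 'v wdtap \<Rightarrow> ('v link \<Rightarrow> real) \<Rightarrow> ('v link \<Rightarrow> 'v link set) \<Rightarrow> 'v set \<Rightarrow> bool" where
  "guarantee \<epsilon> \<Delta> I x \<sigma>s Ws \<longleftrightarrow>
     splitting I \<sigma>s \<and> Ws \<subseteq> verts I \<and>
     (let xs = split I x \<sigma>s in
        cost_of I xs \<le> (1 + \<epsilon>) * cost_of I x \<and>
        (\<forall>v\<in>Ws. up_independent I (supp I xs) v \<or> down_independent I (supp I xs) v) \<and>
        (\<forall>\<sigma>. splitting I \<sigma> \<longrightarrow>
             (\<forall>l\<in>links I. cross_link I Ws l \<longrightarrow> (\<forall>l'\<in>\<sigma> l. up_link I l' \<or> down_link I l')) \<longrightarrow>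
             small_visible_width \<epsilon> \<Delta> I xs (supp I (split I xs \<sigma>))))"

section \<open>Polynomial-time computation\<close>

text \<open>WHILE programs over binary trees with rational leaves, under the logarithmic cost criterion:
  evaluating an expression costs the total bit size of all intermediate values, so unit-cost
  arithmetic on large numbers is not available and polynomially bounded cost coincides with
  polynomial time on a Turing machine.\<close>

datatype val = Leaf rat | Node val val

datatype exp =
    Var nat | Const rat
  | Pair exp exp | Left exp | Right exp | IsNode exp
  | Plus exp exp | Minus exp exp | Times exp exp | Divide exp exp | Less exp exp

datatype com =
    Assign nat exp | Seq com com | If exp com com | While exp com

type_synonym state = "nat \<Rightarrow> val"

definition bits :: "int \<Rightarrow> nat" where
  "bits z = floorlog 2 (nat \<bar>z\<bar>)"

fun val_size :: "val \<Rightarrow> nat" where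
  "val_size (Leaf q) = 1 + bits (fst (quotient_of q)) + bits (snd (quotient_of q))"
| "val_size (Node a b) = 1 + val_size a + val_size b"

text \<open>Operations applied to operands of the wrong shape yield \<open>Leaf 0\<close>, which also represents
  falsity.\<close>

definition truth :: "bool \<Rightarrow> val" where
  "truth b = Leaf (if b then 1 else 0)"

definition is_true :: "val \<Rightarrow> bool" where
  "is_true v \<longleftrightarrow> v \<noteq> Leaf 0"

fun arith :: "(rat \<Rightarrow> rat \<Rightarrow> val) \<Rightarrow> val \<Rightarrow> val \<Rightarrow> val" where
  "arith f (Leaf p) (Leaf q) = f p q"
| "arith f _ _ = Leaf 0"

fun eval :: "exp \<Rightarrow> state \<Rightarrow> val" where
  "eval (Var i) s = s i"
| "eval (Const q) s = Leaf q"
| "eval (Pair e e') s = Node (eval e s) (eval e' s)"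
| "eval (Left e) s = (case eval e s of Node a b \<Rightarrow> a | Leaf _ \<Rightarrow> Leaf 0)"
| "eval (Right e) s = (case eval e s of Node a b \<Rightarrow> b | Leaf _ \<Rightarrow> Leaf 0)"
| "eval (IsNode e) s = truth (case eval e s of Node a b \<Rightarrow> True | Leaf _ \<Rightarrow> False)"
| "eval (Plus e e') s = arith (\<lambda>p q. Leaf (p + q)) (eval e s) (eval e' s)"
| "eval (Minus e e') s = arith (\<lambda>p q. Leaf (p - q)) (eval e s) (eval e' s)"
| "eval (Times e e') s = arith (\<lambda>p q. Leaf (p * q)) (eval e s) (eval e' s)"
| "eval (Divide e e') s = arith (\<lambda>p q. Leaf (p / q)) (eval e s) (eval e' s)"
| "eval (Less e e') s = arith (\<lambda>p q. truth (p < q)) (eval e s) (eval e' s)"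

primrec subexps :: "exp \<Rightarrow> exp list" where
  "subexps (Var i) = []"
| "subexps (Const q) = []"
| "subexps (Pair e e') = [e, e'] @ subexps e @ subexps e'"
| "subexps (Left e) = e # subexps e"
| "subexps (Right e) = e # subexps e"
| "subexps (IsNode e) = e # subexps e"
| "subexps (Plus e e') = [e, e'] @ subexps e @ subexps e'"
| "subexps (Minus e e') = [e, e'] @ subexps e @ subexps e'"
| "subexps (Times e e') = [e, e'] @ subexps e @ subexps e'"
| "subexps (Divide e e') = [e, e'] @ subexps e @ subexps e'"
| "subexps (Less e e') = [e, e'] @ subexps e @ subexps e'"

definition exp_cost :: "exp \<Rightarrow> state \<Rightarrow> nat" where
  "exp_cost e s = (\<Sum>e'\<leftarrow>e # subexps e. val_size (eval e' s))"

text \<open>\<open>exec c s t s'\<close>: started in state \<open>s\<close>, the program \<open>c\<close> halts in state \<open>s'\<close> at total cost \<open>t\<close>.\<close>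

inductive exec :: "com \<Rightarrow> state \<Rightarrow> nat \<Rightarrow> state \<Rightarrow> bool" where
  Assign: "exec (Assign i e) s (exp_cost e s) (s(i := eval e s))"
| Seq: "exec c s t s' \<Longrightarrow> exec c' s' t' s'' \<Longrightarrow> exec (Seq c c') s (t + t') s''"
| IfTrue: "is_true (eval e s) \<Longrightarrow> exec c s t s' \<Longrightarrow> exec (If e c c') s (exp_cost e s + t) s'"
| IfFalse: "\<not> is_true (eval e s) \<Longrightarrow> exec c' s t s' \<Longrightarrow> exec (If e c c') s (exp_cost e s + t) s'"
| WhileFalse: "\<not> is_true (eval e s) \<Longrightarrow> exec (While e c) s (exp_cost e s) s"
| WhileTrue: "is_true (eval e s) \<Longrightarrow> exec c s t s' \<Longrightarrow> exec (While e c) s' t' s'' \<Longrightarrow>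
    exec (While e c) s (exp_cost e s + t + t') s''"

text \<open>Input and output are passed in variable 0; all other variables are initially \<open>Leaf 0\<close>.\<close>

definition computes_within :: "com \<Rightarrow> nat poly \<Rightarrow> val \<Rightarrow> val \<Rightarrow> bool" where
  "computes_within P q inp out \<longleftrightarrow>
     (\<exists>t s. exec P ((\<lambda>_. Leaf 0)(0 := inp)) t s \<and> s 0 = out \<and> t \<le> poly q (val_size inp))"

subsection \<open>Encoding of instances and results\<close>

definition enc_list :: "('a \<Rightarrow> val) \<Rightarrow> 'a list \<Rightarrow> val" where
  "enc_list f xs = foldr (\<lambda>x. Node (f x)) xs (Leaf 0)"

definition enc_nat :: "nat \<Rightarrow> val" where
  "enc_nat n = Leaf (of_nat n)"

definition enc_pair :: "nat \<times> nat \<Rightarrow> val" where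
  "enc_pair p = Node (enc_nat (fst p)) (enc_nat (snd p))"

definition enc_input ::
  "rat \<Rightarrow> rat \<Rightarrow> nat list \<Rightarrow> nat arc list \<Rightarrow> nat \<Rightarrow> nat link list \<Rightarrow>
   (nat link \<Rightarrow> rat) \<Rightarrow> (nat link \<Rightarrow> rat) \<Rightarrow> val" where
  "enc_input \<epsilon> \<Delta> vl al r ll c x =
     Node (Leaf \<epsilon>) (Node (Leaf \<Delta>) (Node (enc_list enc_nat vl) (Node (enc_list enc_pair al)
       (Node (enc_nat r)
         (enc_list (\<lambda>l. Node (enc_pair l) (Node (Leaf (c l)) (Leaf (x l)))) ll)))))"

definition enc_output :: "nat link list \<Rightarrow> (nat link \<Rightarrow> nat link list) \<Rightarrow> nat list \<Rightarrow> val" where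
  "enc_output ll S wl =
     Node (enc_list (\<lambda>l. Node (enc_pair l) (enc_list enc_pair (S l))) ll) (enc_list enc_nat wl)"

definition rat_wdtap ::
  "nat list \<Rightarrow> nat arc list \<Rightarrow> nat \<Rightarrow> nat link list \<Rightarrow> (nat link \<Rightarrow> rat) \<Rightarrow> nat wdtap" where
  "rat_wdtap vl al r ll c =
     \<lparr>verts = set vl, arcs = set al, root = r, links = set ll, cost = (\<lambda>l. of_rat (c l))\<rparr>"

end

theory Submission
  imports Defs
begin

text \<open>
  An arc is identified with its lower endpoint \<open>s\<close>. For each of the two directions of traversal
  (\<open>True\<close>: towards the root), a set \<open>S d\<close> of vertices is chosen bottom-up: \<open>v\<close> is chosen if the links
  traversing the arc above \<open>v\<close> in direction \<open>d\<close> have total weight below \<open>\<zeta>\<^sub>2\<close> and more than \<open>k\<close> pairwise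
  incomparable arcs below \<open>v\<close> that are coverable in direction \<open>d\<close> are not yet shielded from \<open>v\<close> by a chosen
  vertex. Every link is cut at the chosen vertices it passes through, and \<open>W\<^sup>*\<close> consists of the root and
  all chosen vertices.

  Each of the more than \<open>k\<close> arcs below a chosen vertex is covered with weight at least 1, while a link
  meets these antichains for at most one vertex more than it is cut in direction \<open>d\<close>. As choosing a
  vertex creates cuts of weight at most \<open>\<zeta>\<^sub>2\<close>, the total weight \<open>D\<close> of the cuts satisfies
  \<open>(1 + 1/\<gamma>) D \<le> x(L) + D\<close>, so \<open>D \<le> \<gamma> x(L)\<close> in each direction; the bound on the cost ratio turns this
  into an extra cost of at most \<open>\<epsilon> c(x)\<close>. Nothing is visible to a chosen vertex in its direction, because
  links through it have been cut there and cross-links at it are excluded; at every other light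
  vertex the visible arcs are unshielded and hence have width at most \<open>k\<close>.

  The choice depends only on the tree and on sums of values of \<open>x\<close>, so it can be expressed by folds
  over lists whose accumulators grow additively. A class of polynomial-time functions closed under
  such folds yields the program.
\<close>

section \<open>Paths in trees\<close>

text \<open>The constants fit one computation. A chosen vertex creates cuts of weight at most
  \<open>\<zeta>\<^sub>2\<close> but is backed by covered arcs of weight more than \<open>k\<close>;
  the factor 1 + 1/\<gamma> between the two leaves 1/\<gamma> after the cut weight is subtracted
  from both sides. An extra piece costs at most the maximum cost, which is at most \<Delta> times
  the cost of any link, and two directions give 2 \<gamma> \<Delta> = \<epsilon>. The obstacle is
  circularity: cutting changes what is visible, and heaviness in the claim refers to
  \<open>x*\<close> while the choice is made with \<open>x\<close>. The choice at \<open>v\<close>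
  depends only on chosen vertices strictly below \<open>v\<close>, so it can be characterised as a
  fixed point; and splitting never lowers the load on an arc in either direction, so an arc that is
  not heavy for \<open>x*\<close> is light for \<open>x\<close>. The bound in the forward direction
  is unconditional because the load there is the coverage of the arc, which stays below
  \<open>\<zeta>\<^sub>1 \<le> \<zeta>\<^sub>2\<close>. A link that turns at a chosen vertex is not
  cut there; this is the case left to the later splitting. The root belongs to \<open>W*\<close>
  since only turning links have it as an inner vertex.\<close>

lemma distinct_walk_unique:
  assumes sym: "\<And>x y. R x y \<Longrightarrow> R y x"
    and acyc: "\<not> (\<exists>p. length p \<ge> 3 \<and> distinct p \<and> successively R p \<and> R (last p) (hd p))"
  shows "p \<noteq> [] \<Longrightarrow> q \<noteq> [] \<Longrightarrow> distinct p \<Longrightarrow> distinct q \<Longrightarrow> successively R p \<Longrightarrow> successively R q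
    \<Longrightarrow> hd p = hd q \<Longrightarrow> last p = last q \<Longrightarrow> p = q"
proof (induction p arbitrary: q)
  case Nil
  then show ?case by simp
next
  case (Cons u p')
  obtain q' where q: "q = u # q'" using Cons.prems by (cases q) auto
  show ?case
  proof (cases "p' = [] \<or> q' = []")
    case True
    \<comment> \<open>If one walk stops at \<open>u\<close>, the other must end at \<open>u\<close>
      as well, and distinctness forbids it to leave.\<close>
    have "set p' = {} \<longleftrightarrow> set q' = {}"
      using Cons.prems True q last_in_set[of p'] last_in_set[of q']
      by (metis distinct.simps(2) empty_set last_ConsL last_ConsR set_empty2)
    then show ?thesis using True q by auto
  next
    case False
    then have ne: "p' \<noteq> []" "q' \<noteq> []" by auto
    have sp: "successively R p'" "successively R q'" "R u (hd p')" "R u (hd q')"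
      using Cons.prems ne q by (auto simp: successively_Cons)
    have l: "last p' = last q'" using Cons.prems ne q by auto
    show ?thesis
    proof (cases "hd p' = hd q'")
      case True
      have "p' = q'"
        by (rule Cons.IH) (use Cons.prems sp ne l True q in auto)
      then show ?thesis using q by simp
    next
      case neq: False
      have "\<exists>x\<in>set p'. x \<in> set q'" using l ne by (metis last_in_set)
      then obtain ys w zs where p': "p' = ys @ w # zs" and w: "w \<in> set q'"
        and ys: "\<forall>y\<in>set ys. y \<notin> set q'"
        using split_list_first_prop[of p' "\<lambda>x. x \<in> set q'"] by blast
      obtain as bs where q': "q' = as @ w # bs" using w by (meson split_list)
      \<comment> \<open>\<open>w\<close> is the first vertex of \<open>p'\<close> on
        \<open>q'\<close>. Following \<open>p'\<close> from \<open>u\<close> to \<open>w\<close> and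
        returning along \<open>q'\<close> closes a cycle, of length at least 3 because the walks
        leave \<open>u\<close> towards different vertices.\<close>
      define c where "c = u # ys @ w # rev as"
      have "distinct c" using Cons.prems ys q p' q' by (auto simp: c_def)
      moreover have "successively R c"
      proof -
        have "successively R ((u # ys @ [w]) @ zs)"
          using Cons.prems p' by simp
        then have a: "successively R (u # ys @ [w])"
          by (simp only: successively_append_iff)
        have "successively R (as @ [w])"
          using sp q' by (auto simp: successively_append_iff)
        then have "successively (\<lambda>x y. R y x) (as @ [w])"
          using sym by (auto elim: successively_mono)
        then have "successively R (rev (as @ [w]))"
          by (simp only: successively_rev)
        then have b: "successively R (w # rev as)" by simp
        have "c = (u # ys @ [w]) @ rev as" by (simp add: c_def)
        moreover have "successively R (rev as)" "rev as = [] \<or> R (last (u # ys @ [w])) (hd (rev as))"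
          using b by (auto simp: successively_Cons)
        ultimately show ?thesis using a by (simp only: successively_append_iff) blast
      qed
      moreover have "last c = hd q'" using q' by (cases as) (auto simp: c_def)
      moreover have "R (hd q') (hd c)" using sp sym by (simp add: c_def)
      moreover have "length c \<ge> 3"
      proof -
        have "ys \<noteq> [] \<or> as \<noteq> []" using neq p' q' by auto
        then show ?thesis by (cases ys; cases as) (auto simp: c_def)
      qed
      ultimately show ?thesis using acyc by metis
    qed
  qed
qed

lemma rtranclp_distinct_walk:
  assumes "R\<^sup>*\<^sup>* u v"
  shows "\<exists>p. p \<noteq> [] \<and> hd p = u \<and> last p = v \<and> distinct p \<and> successively R p"
  using assms
proof (induction rule: converse_rtranclp_induct)
  case base
  show ?case by (rule exI[of _ "[v]"]) auto
next
  case (step u u')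
  then obtain p where p: "p \<noteq> []" "hd p = u'" "last p = v" "distinct p" "successively R p" by auto
  show ?case
  proof (cases "u \<in> set p")
    case True
    then obtain xs ys where "p = xs @ u # ys" by (meson split_list)
    then show ?thesis using p
      by (intro exI[of _ "u # ys"]) (auto simp: successively_append_iff)
  next
    case False
    then show ?thesis using p step
      by (intro exI[of _ "u # p"]) (auto simp: successively_Cons)
  qed
qed

lemma adj_sym: "adj A x y \<Longrightarrow> adj A y x"
  by (auto simp: adj_def)

definition anc :: "'v wdtap \<Rightarrow> 'v \<Rightarrow> 'v set" where
  "anc I v = set (root_path I v)"

text \<open>A vertex \<open>s\<close> stands for the arc joining it to its parent: \<open>asc I l\<close> and
  \<open>asc I (prod.swap l)\<close> are the arcs traversed towards and away from the root by \<open>l\<close>.\<close>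

definition asc :: "'v wdtap \<Rightarrow> 'v link \<Rightarrow> 'v set" where
  "asc I l = anc I (fst l) - anc I (snd l)"

lemma successively_in_set:
  "successively (adj A) p \<Longrightarrow> A \<subseteq> V \<times> V \<Longrightarrow> hd p \<in> V \<Longrightarrow> set p \<subseteq> V"
  by (induction p rule: induct_list012) (auto simp: adj_def)

section \<open>The ancestor order of the rooted tree\<close>

locale wdtap_tree =
  fixes I :: "'v wdtap"
  assumes rooted: "rooted_wdtap I"
begin

lemma finite_verts [simp]: "finite (verts I)"
  and arcs_verts: "arcs I \<subseteq> verts I \<times> verts I"
  and arcs_antisym: "(u, v) \<in> arcs I \<Longrightarrow> (v, u) \<notin> arcs I"
  and root_in [simp]: "root I \<in> verts I"
  and links_verts: "links I \<subseteq> verts I \<times> verts I"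
  and cost_pos: "l \<in> links I \<Longrightarrow> cost I l > 0"
  using rooted by (auto simp: rooted_wdtap_def oriented_tree_def)

lemma finite_arcs [simp]: "finite (arcs I)"
  using finite_subset[OF arcs_verts] by simp

lemma finite_links [simp]: "finite (links I)"
  using finite_subset[OF links_verts] by simp

lemma adj_verts: "adj (arcs I) u v \<Longrightarrow> u \<in> verts I \<and> v \<in> verts I"
  using arcs_verts by (auto simp: adj_def)

lemma adj_irrefl: "\<not> adj (arcs I) u u"
  using arcs_antisym by (auto simp: adj_def)

lemma simple_path_unique:
  assumes "simple_path I u p v" "simple_path I u q v"
  shows "p = q"
proof (rule distinct_walk_unique[where R = "adj (arcs I)"])
  show "\<not> (\<exists>p. length p \<ge> 3 \<and> distinct p \<and> successively (adj (arcs I)) p \<and> adj (arcs I) (last p) (hd p))"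
    using rooted by (auto simp: rooted_wdtap_def oriented_tree_def)
qed (use assms adj_sym in \<open>auto simp: simple_path_def\<close>)

lemma tree_path_eqI: "simple_path I u p v \<Longrightarrow> tree_path I u v = p"
  unfolding tree_path_def using simple_path_unique by blast

lemma simple_path_tree_path:
  assumes "u \<in> verts I" "v \<in> verts I"
  shows "simple_path I u (tree_path I u v) v"
proof -
  have "(adj (arcs I))\<^sup>*\<^sup>* u v"
    using rooted assms by (auto simp: rooted_wdtap_def oriented_tree_def)
  then obtain p where p: "p \<noteq> []" "hd p = u" "last p = v" "distinct p" "successively (adj (arcs I)) p"
    using rtranclp_distinct_walk by metis
  then have "simple_path I u p v"
    using successively_in_set[OF p(5) arcs_verts] assms by (auto simp: simple_path_def)
  then show ?thesis using tree_path_eqI by metis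
qed

lemma simple_path_sublist:
  assumes "simple_path I u (xs @ q @ ys) v" "q \<noteq> []"
  shows "simple_path I (hd q) q (last q)"
  using assms by (auto simp: simple_path_def successively_append_iff)

lemma simple_path_rev:
  assumes "simple_path I u p v"
  shows "simple_path I v (rev p) u"
proof -
  have "successively (\<lambda>x y. adj (arcs I) y x) p"
    using assms by (auto simp: simple_path_def elim: successively_mono intro: adj_sym)
  then show ?thesis using assms
    by (auto simp: simple_path_def hd_rev last_rev)
qed

lemma root_path: "v \<in> verts I \<Longrightarrow> simple_path I v (root_path I v) (root I)"
  unfolding root_path_def by (rule simple_path_tree_path) auto

lemma root_path_distinct: "v \<in> verts I \<Longrightarrow> distinct (root_path I v)"
  using root_path by (auto simp: simple_path_def)

lemma root_path_root [simp]: "root_path I (root I) = [root I]"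
  unfolding root_path_def by (rule tree_path_eqI) (auto simp: simple_path_def)

lemma anc_root [simp]: "anc I (root I) = {root I}"
  by (simp add: anc_def)

lemma anc_self [simp]: "v \<in> verts I \<Longrightarrow> v \<in> anc I v"
  using root_path[of v] by (auto simp: simple_path_def anc_def dest: hd_in_set)

lemma root_anc [simp]: "v \<in> verts I \<Longrightarrow> root I \<in> anc I v"
  using root_path[of v] by (auto simp: simple_path_def anc_def dest: last_in_set)

lemma anc_verts: "v \<in> verts I \<Longrightarrow> anc I v \<subseteq> verts I"
  using root_path[of v] by (auto simp: simple_path_def anc_def)

lemma finite_anc [simp]: "finite (anc I v)"
  by (simp add: anc_def)

text \<open>A tail of a simple path is simple, and simple paths are unique. The order properties of
  \<open>anc\<close> are read off from this suffix relation between root paths.\<close>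

lemma root_path_suffix:
  assumes "v \<in> verts I" "root_path I v = xs @ w # ys"
  shows "w # ys = root_path I w"
proof -
  have "simple_path I v (xs @ (w # ys) @ []) (root I)" using root_path[OF assms(1)] assms(2) by simp
  then have "simple_path I w (w # ys) (root I)"
    using simple_path_sublist[of v xs "w # ys" "[]" "root I"] by (auto simp: simple_path_def split: if_splits)
  then show ?thesis unfolding root_path_def using tree_path_eqI by metis
qed

lemma anc_split:
  assumes "v \<in> verts I" "w \<in> anc I v"
  obtains xs where "root_path I v = xs @ root_path I w"
  using assms root_path_suffix[OF assms(1)] by (metis anc_def split_list)

lemma anc_trans: "v \<in> verts I \<Longrightarrow> w \<in> anc I v \<Longrightarrow> anc I w \<subseteq> anc I v"
  by (metis anc_def anc_split set_append Un_upper2)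

lemma anc_antisym:
  assumes "v \<in> verts I" "w \<in> anc I v" "v \<in> anc I w"
  shows "v = w"
proof -
  have w: "w \<in> verts I" using anc_verts assms by auto
  obtain xs ys where "root_path I v = xs @ root_path I w" "root_path I w = ys @ root_path I v"
    using anc_split assms w by metis
  then have "root_path I v = root_path I w" by simp
  then show ?thesis using root_path[OF assms(1)] root_path[OF w] by (auto simp: simple_path_def)
qed

text \<open>The root paths of \<open>a\<close> and \<open>b\<close> are suffixes of the same list,
  hence one is a suffix of the other.\<close>

lemma anc_chain:
  assumes "v \<in> verts I" "a \<in> anc I v" "b \<in> anc I v"
  shows "a \<in> anc I b \<or> b \<in> anc I a"
proof -
  have ab: "a \<in> verts I" "b \<in> verts I" using anc_verts assms by auto
  obtain xs ys where "root_path I v = xs @ root_path I a" "root_path I v = ys @ root_path I b"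
    using anc_split assms by metis
  then consider zs where "root_path I a = zs @ root_path I b" | zs where "root_path I b = zs @ root_path I a"
    by (metis append_eq_append_conv2)
  then show ?thesis using ab anc_self unfolding anc_def by cases auto
qed

lemma parent_path:
  assumes "v \<in> verts I" "v \<noteq> root I"
  shows "root_path I v = v # root_path I (parent I v)" "parent I v \<in> verts I"
    "adj (arcs I) v (parent I v)"
proof -
  note sp = root_path[OF assms(1)]
  obtain ys where ys: "root_path I v = v # ys" using sp by (cases "root_path I v") (auto simp: simple_path_def)
  have "ys \<noteq> []" using sp ys assms by (auto simp: simple_path_def)
  then obtain w zs where w: "ys = w # zs" by (cases ys) auto
  have p: "parent I v = w" using ys w by (simp add: parent_def)
  have "root_path I v = [v] @ w # zs" using ys w by simp
  from root_path_suffix[OF assms(1) this] ys w p show "root_path I v = v # root_path I (parent I v)" by simp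
  show "parent I v \<in> verts I" "adj (arcs I) v (parent I v)"
    using sp ys w p by (auto simp: simple_path_def)
qed

lemma anc_parent:
  "v \<in> verts I \<Longrightarrow> v \<noteq> root I \<Longrightarrow> anc I v = insert v (anc I (parent I v))"
  by (simp add: anc_def parent_path(1))

lemma parent_notin_anc:
  "v \<in> verts I \<Longrightarrow> v \<noteq> root I \<Longrightarrow> v \<notin> anc I (parent I v)"
  using root_path_distinct[of v] by (simp add: anc_def parent_path(1))

text \<open>If \<open>v\<close> is an ancestor of \<open>u\<close>, uniqueness forces the root path
  of \<open>u\<close> to begin with \<open>u\<close>, \<open>v\<close>. Otherwise \<open>v\<close>
  can be prepended to the root path of \<open>u\<close>, which gives the root path of
  \<open>v\<close>.\<close>

lemma adj_parent:
  assumes "adj (arcs I) u v"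
  shows "(u \<noteq> root I \<and> v = parent I u) \<or> (v \<noteq> root I \<and> u = parent I v)"
proof -
  have uv: "u \<in> verts I" "v \<in> verts I" "u \<noteq> v" using assms adj_verts adj_irrefl by auto
  show ?thesis
  proof (cases "v \<in> anc I u")
    case True
    then obtain xs where xs: "root_path I u = xs @ root_path I v" using anc_split uv by metis
    obtain ys where ys: "root_path I v = v # ys"
      using root_path[OF uv(2)] by (cases "root_path I v") (auto simp: simple_path_def)
    have "simple_path I u ([] @ (xs @ [v]) @ ys) (root I)" using root_path[OF uv(1)] xs ys by simp
    then have "simple_path I (hd (xs @ [v])) (xs @ [v]) v"
      using simple_path_sublist[of u "[]" "xs @ [v]" ys "root I"] by simp
    moreover have "hd (xs @ [v]) = u" using root_path[OF uv(1)] xs ys by (cases xs) (auto simp: simple_path_def)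
    moreover have "simple_path I u [u, v] v" using uv assms by (auto simp: simple_path_def)
    ultimately have "xs @ [v] = [u, v]" using simple_path_unique by metis
    then have "root_path I u = u # v # ys" using xs ys by simp
    moreover from this have "u \<noteq> root I" by auto
    ultimately show ?thesis by (auto simp: parent_def)
  next
    case False
    have "simple_path I v (v # root_path I u) (root I)"
      using False root_path[OF uv(1)] uv adj_sym[OF assms] 
      by (auto simp: simple_path_def anc_def successively_Cons)
    then have e: "root_path I v = v # root_path I u" unfolding root_path_def using tree_path_eqI by metis
    moreover have "root_path I u = u # tl (root_path I u)"
      using root_path[OF uv(1)] by (cases "root_path I u") (auto simp: simple_path_def)
    ultimately have "root_path I v ! 1 = u" by (metis One_nat_def nth_Cons_0 nth_Cons_Suc)
    moreover have "v \<noteq> root I" using False uv by auto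
    ultimately show ?thesis by (auto simp: parent_def)
  qed
qed

lemma arc_parent_cases:
  assumes "a \<in> arcs I"
  obtains v where "v \<in> verts I" "v \<noteq> root I" "a = (v, parent I v)" "(parent I v, v) \<notin> arcs I"
  | v where "v \<in> verts I" "v \<noteq> root I" "a = (parent I v, v)" "(v, parent I v) \<notin> arcs I"
proof -
  obtain u v where a: "a = (u, v)" by (cases a)
  then have adj: "adj (arcs I) u v" using assms by (auto simp: adj_def)
  then show ?thesis using that adj_parent[OF adj] adj_verts[OF adj] assms a arcs_antisym by metis
qed

text \<open>\<open>w\<close> is the first vertex on the root path of \<open>a\<close> that is also
  an ancestor of \<open>b\<close>. The parts of the two root paths before \<open>w\<close> contain
  no common ancestor, so they are disjoint and can be joined at \<open>w\<close> to a simple path.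
  This normal form is the source of the later facts about link paths.\<close>

lemma path_decomp:
  assumes "a \<in> verts I" "b \<in> verts I"
  obtains xs ys w where "root_path I a = xs @ root_path I w" "root_path I b = ys @ root_path I w"
    "w \<in> verts I" "set xs = asc I (a, b)" "set ys = asc I (b, a)" "apex I (a, b) = w"
    "anc I a \<inter> anc I b = anc I w"
    "link_path I (a, b) = xs @ w # rev ys"
proof -
  have "\<exists>x\<in>set (root_path I a). x \<in> anc I b" using root_anc assms by (metis anc_def)
  then obtain xs w zs where w: "root_path I a = xs @ w # zs" "w \<in> anc I b" "\<forall>x\<in>set xs. x \<notin> anc I b"
    using split_list_first_prop[of "root_path I a" "\<lambda>x. x \<in> anc I b"] by blast
  have wz: "w # zs = root_path I w" using root_path_suffix[OF assms(1) w(1)] .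
  have wV: "w \<in> verts I" using anc_verts assms w by auto
  obtain ys where ys: "root_path I b = ys @ root_path I w" using anc_split assms w by metis
  have aw: "anc I w \<subseteq> anc I b" using anc_trans assms w by auto
  have sxs: "set xs = asc I (a, b)"
    using w wz aw by (auto simp: asc_def anc_def)
  have sys: "set ys = asc I (b, a)"
    using ys w wz root_path_distinct[OF assms(2)] by (auto simp: asc_def anc_def)
  have C: "anc I a \<inter> anc I b = anc I w"
    using w wz aw by (auto simp: anc_def)
  have apex: "apex I (a, b) = w"
    unfolding apex_def Let_def
  proof (rule the_equality)
    show "w \<in> set (root_path I (fst (a, b))) \<inter> set (root_path I (snd (a, b))) \<and>
      (\<forall>w'\<in>set (root_path I (fst (a, b))) \<inter> set (root_path I (snd (a, b))). w' \<in> set (root_path I w))"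
      using C wV anc_self by (auto simp: anc_def)
  next
    fix x assume "x \<in> set (root_path I (fst (a, b))) \<inter> set (root_path I (snd (a, b))) \<and>
      (\<forall>w'\<in>set (root_path I (fst (a, b))) \<inter> set (root_path I (snd (a, b))). w' \<in> set (root_path I x))"
    then have "x \<in> anc I w" "w \<in> anc I x" using C wV anc_self by (auto simp: anc_def)
    then show "x = w" using anc_antisym wV by metis
  qed
  have 1: "simple_path I a ([] @ (xs @ [w]) @ zs) (root I)" using root_path[OF assms(1)] w by simp
  have s1: "simple_path I a (xs @ [w]) w"
    using simple_path_sublist[OF 1] root_path[OF assms(1)] w
    by (cases xs) (auto simp: simple_path_def)
  have 2: "simple_path I b ([] @ (ys @ [w]) @ zs) (root I)" using root_path[OF assms(2)] ys wz[symmetric] by simp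
  have s2: "simple_path I b (ys @ [w]) w"
    using simple_path_sublist[OF 2] root_path[OF assms(2)] ys wz[symmetric]
    by (cases ys) (auto simp: simple_path_def)
  have s3: "simple_path I w (w # rev ys) b" using simple_path_rev[OF s2] by simp
  have dis: "set xs \<inter> set ys = {}" using sxs sys by (auto simp: asc_def)
  have "xs @ w # rev ys \<noteq> []" "hd (xs @ w # rev ys) = a" 
    using s1 by (cases xs; auto simp: simple_path_def)+
  moreover have "last (xs @ w # rev ys) = b" using s3 by (auto simp: simple_path_def)
  moreover have "distinct (xs @ w # rev ys)" using s1 s3 dis by (auto simp: simple_path_def)
  moreover have "successively (adj (arcs I)) (xs @ w # rev ys)"
    using s1 s3 by (auto simp: simple_path_def successively_append_iff successively_Cons)
  moreover have "set (xs @ w # rev ys) \<subseteq> verts I" using s1 s3 by (auto simp: simple_path_def)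
  ultimately have "simple_path I a (xs @ w # rev ys) b" by (simp add: simple_path_def)
  then have "link_path I (a, b) = xs @ w # rev ys" by (simp add: link_path_def tree_path_eqI)
  with that w wz ys wV sxs sys apex C show ?thesis by metis
qed

end

section \<open>Link paths\<close>

lemma steps_nth: "steps p = {(p ! k, p ! Suc k) | k. Suc k < length p}"
  by (auto simp: steps_def set_zip nth_tl)

lemma steps_Nil [simp]: "steps [] = {}" and steps_single [simp]: "steps [x] = {}"
  by (auto simp: steps_def)

lemma steps_Cons: "zs \<noteq> [] \<Longrightarrow> steps (x # zs) = insert (x, hd zs) (steps zs)"
  by (cases zs) (auto simp: steps_def)

lemma steps_append: "steps (xs @ w # zs) = steps (xs @ [w]) \<union> steps (w # zs)"
proof (induction xs)
  case Nil
  show ?case by (simp add: steps_def)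
next
  case (Cons x xs)
  have "hd (xs @ w # zs) = hd (xs @ [w])" by (cases xs) auto
  then show ?case using Cons by (simp add: steps_Cons)
qed

lemma steps_rev: "steps (rev p) = prod.swap ` steps p"
proof (induction p)
  case (Cons x p)
  show ?case
  proof (cases p)
    case (Cons y q)
    then have "steps (rev (x # p)) = steps (rev p) \<union> {(y, x)}"
      using steps_append[of "rev q" y "[x]"] by (simp add: steps_Cons)
    then show ?thesis using Cons.IH Cons by (auto simp: steps_Cons)
  qed simp
qed simp

lemma steps_conv: "(a, b) \<in> steps p \<longleftrightarrow> (\<exists>xs ys. p = xs @ a # b # ys)"
proof
  assume "(a, b) \<in> steps p"
  then obtain k where k: "Suc k < length p" "a = p ! k" "b = p ! Suc k" by (auto simp: steps_nth)
  then have "p = take k p @ a # b # drop (Suc (Suc k)) p"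
    by (metis Cons_nth_drop_Suc Suc_lessD append_take_drop_id)
  then show "\<exists>xs ys. p = xs @ a # b # ys" by blast
next
  assume "\<exists>xs ys. p = xs @ a # b # ys"
  then obtain xs ys where "p = xs @ a # b # ys" by blast
  then show "(a, b) \<in> steps p" using steps_append[of xs a "b # ys"] by (simp add: steps_Cons)
qed

lemma card_steps: "card (steps p) \<le> length p - 1"
  unfolding steps_def by (rule le_trans[OF card_length]) simp

lemma inner_distinct: "distinct p \<Longrightarrow> inner p = set p - {hd p, last p}"
  by (cases p; cases "tl p" rule: rev_cases) (auto simp: inner_def)

lemma inner_subset: "inner p \<subseteq> set p"
  unfolding inner_def by (metis in_set_butlastD list.set_sel(2) subsetI tl_Nil)

lemma inner_sublist:
  assumes "sublist q p" shows "inner q \<subseteq> inner p"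
proof -
  obtain xs ys where p: "p = xs @ q @ ys" using assms by (auto simp: sublist_def)
  show ?thesis
  proof (cases "q = [] \<or> tl q = []")
    case True
    then show ?thesis by (auto simp: inner_def)
  next
    case False
    then obtain a m b where q: "q = a # m @ [b]"
      by (metis list.collapse rev_exhaust)
    have "inner q = set m" by (simp add: inner_def q)
    moreover have "set m \<subseteq> inner p"
      unfolding inner_def p q by (cases xs) (auto simp: butlast_append)
    ultimately show ?thesis by simp
  qed
qed

context wdtap_tree
begin

lemma link_path_simple:
  assumes "fst l \<in> verts I" "snd l \<in> verts I"
  shows "simple_path I (fst l) (link_path I l) (snd l)"
  using simple_path_tree_path[OF assms] by (simp add: link_path_def)

lemma asc_props:
  assumes "fst l \<in> verts I" "snd l \<in> verts I" "s \<in> asc I l"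
  shows "s \<in> verts I" "s \<noteq> root I"
  using assms anc_verts[OF assms(1)] by (auto simp: asc_def)

lemma steps_root_path_prefix:
  "v \<in> verts I \<Longrightarrow> root_path I v = xs @ root_path I w \<Longrightarrow> w \<in> verts I \<Longrightarrow>
   steps (xs @ [w]) = (\<lambda>s. (s, parent I s)) ` set xs"
proof (induction xs arbitrary: v)
  case Nil
  then show ?case by simp
next
  case (Cons y ys)
  have "v \<noteq> root I"
  proof
    assume "v = root I"
    then have "[root I] = y # ys @ root_path I w" using Cons.prems by simp
    then show False using anc_self[OF Cons.prems(3)] by (auto simp: anc_def)
  qed
  note p = parent_path[OF Cons.prems(1) this]
  have y: "y = v" and ys: "root_path I (parent I v) = ys @ root_path I w"
    using p Cons.prems by auto
  have h: "hd (ys @ [w]) = parent I v"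
  proof -
    have "hd (root_path I (parent I v)) = parent I v" "hd (root_path I w) = w"
      using root_path[OF p(2)] root_path[OF Cons.prems(3)] by (auto simp: simple_path_def)
    then show ?thesis using ys by (metis hd_append list.sel(1))
  qed
  have "steps (ys @ [w]) = (\<lambda>s. (s, parent I s)) ` set ys"
    by (rule Cons.IH[OF p(2) ys Cons.prems(3)])
  then show ?case using h y by (simp add: steps_Cons)
qed

text \<open>The ascending half is a prefix of a root path, where each vertex is followed by its
  parent; the descending half is such a prefix reversed, which swaps the pairs.\<close>

lemma steps_link_path:
  assumes "fst l \<in> verts I" "snd l \<in> verts I"
  shows "steps (link_path I l) = (\<lambda>s. (s, parent I s)) ` asc I l \<union> (\<lambda>s. (parent I s, s)) ` asc I (prod.swap l)"
proof -
  obtain xs ys w where d: "root_path I (fst l) = xs @ root_path I w"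
    "root_path I (snd l) = ys @ root_path I w" "w \<in> verts I"
    "set xs = asc I (fst l, snd l)" "set ys = asc I (snd l, fst l)"
    "link_path I (fst l, snd l) = xs @ w # rev ys"
    using path_decomp[OF assms] by metis
  have 1: "steps (xs @ [w]) = (\<lambda>s. (s, parent I s)) ` set xs"
    by (rule steps_root_path_prefix[OF assms(1) d(1,3)])
  have 2: "steps (ys @ [w]) = (\<lambda>s. (s, parent I s)) ` set ys"
    by (rule steps_root_path_prefix[OF assms(2) d(2,3)])
  have "w # rev ys = rev (ys @ [w])" by simp
  then have "steps (w # rev ys) = (\<lambda>s. (parent I s, s)) ` set ys"
    using 2 by (simp only: steps_rev) (auto simp: image_image)
  then show ?thesis using 1 d steps_append[of xs w "rev ys"] by (simp add: prod.swap_def)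
qed

lemma set_link_path:
  assumes "fst l \<in> verts I" "snd l \<in> verts I"
  shows "set (link_path I l) = insert (apex I l) (asc I l \<union> asc I (prod.swap l))"
proof -
  obtain xs ys w where d: 
    "set xs = asc I (fst l, snd l)" "set ys = asc I (snd l, fst l)"
    "link_path I (fst l, snd l) = xs @ w # rev ys" "apex I (fst l, snd l) = w"
    using path_decomp[OF assms] by metis
  then show ?thesis by (auto simp: prod.swap_def)
qed

lemma apex_props:
  assumes "fst l \<in> verts I" "snd l \<in> verts I"
  shows "apex I l \<in> verts I" "anc I (fst l) \<inter> anc I (snd l) = anc I (apex I l)"
  using path_decomp[OF assms] by (metis prod.collapse)+

lemma apex_eqI:
  assumes "fst l \<in> verts I" "snd l \<in> verts I" "w \<in> verts I" "anc I (fst l) \<inter> anc I (snd l) = anc I w"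
  shows "apex I l = w"
  using apex_props[OF assms(1,2)] assms anc_antisym anc_self by metis

lemma apex_swap:
  assumes "fst l \<in> verts I" "snd l \<in> verts I"
  shows "apex I (prod.swap l) = apex I l"
  by (rule apex_eqI) (use apex_props[OF assms] assms in auto)

lemma inner_link_path:
  assumes "fst l \<in> verts I" "snd l \<in> verts I"
  shows "inner (link_path I l) = insert (apex I l) (asc I l \<union> asc I (prod.swap l)) - {fst l, snd l}"
  using inner_distinct[of "link_path I l"] link_path_simple[OF assms] set_link_path[OF assms]
  by (auto simp: simple_path_def)

lemma apex_anc_path:
  assumes "fst l \<in> verts I" "snd l \<in> verts I" "v \<in> set (link_path I l)"
  shows "apex I l \<in> anc I v"
proof -
  \<comment> \<open>For \<open>v\<close> on one half only: \<open>v\<close> and the apex are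
    comparable as ancestors of the same endpoint, and an ancestor of the apex would also be an
    ancestor of the other endpoint.\<close>
  have *: "apex I l \<in> anc I v" if "a \<in> verts I" "b \<in> verts I" "v \<in> anc I a" "v \<notin> anc I b"
    "anc I a \<inter> anc I b = anc I (apex I l)" for a b
  proof -
    have "apex I l \<in> anc I a" "apex I l \<in> anc I b"
      using that(5) anc_self[OF apex_props(1)[OF assms(1,2)]] by auto
    then show ?thesis using anc_chain[OF that(1) that(3), of "apex I l"] anc_trans[OF that(2), of "apex I l"] that(4) by auto
  qed
  consider "v = apex I l" | "v \<in> anc I (fst l)" "v \<notin> anc I (snd l)"
    | "v \<in> anc I (snd l)" "v \<notin> anc I (fst l)"
    using assms(3) unfolding set_link_path[OF assms(1,2)] by (auto simp: asc_def)
  then show ?thesis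
    by cases (use *[of "fst l" "snd l"] *[of "snd l" "fst l"] apex_props[OF assms(1,2)] assms(1,2)
        in \<open>simp_all add: Int_commute\<close>)
qed

text \<open>The reason why chosen vertices shield: a link that passes \<open>v\<close> and ascends
  over the arc above \<open>u\<close> has every vertex strictly between them as an inner vertex, so
  it would be cut at a chosen one.\<close>

lemma asc_between:
  assumes l: "fst l \<in> verts I" "snd l \<in> verts I" and v: "v \<in> set (link_path I l)"
    and u: "u \<in> asc I l" and s: "s \<in> anc I u" "v \<in> anc I s" "s \<noteq> v" "s \<noteq> u"
  shows "s \<in> asc I l" "s \<in> inner (link_path I l)"
proof -
  have uV: "u \<in> verts I" using asc_props(1)[OF l u] .
  have sV: "s \<in> verts I" using anc_verts[OF uV] s by auto
  have vV: "v \<in> verts I" using anc_verts[OF sV] s by auto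
  have sa: "s \<in> anc I (fst l)" using u s anc_trans[OF l(1), of u] by (auto simp: asc_def)
  have sb: "s \<notin> anc I (snd l)"
  \<comment> \<open>A common ancestor of both endpoints lies above the apex, and the apex lies above
    \<open>v\<close>; so \<open>s\<close> would be an ancestor of its own proper ancestor
    \<open>v\<close>.\<close>
  proof
    assume "s \<in> anc I (snd l)"
    then have "s \<in> anc I (apex I l)" using sa apex_props[OF l] by auto
    then have "s \<in> anc I v" using apex_anc_path[OF l v] anc_trans[OF vV, of "apex I l"] by auto
    then show False using s anc_antisym[OF sV s(2)] by auto
  qed
  show *: "s \<in> asc I l" using sa sb by (simp add: asc_def)
  have "s \<noteq> fst l"
  proof
    assume "s = fst l"
    then have "u \<in> anc I s" using u by (auto simp: asc_def)
    then show False using s anc_antisym[OF uV s(1)] by auto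
  qed
  moreover have "s \<noteq> snd l" using sb l by auto
  ultimately show "s \<in> inner (link_path I l)" using * by (auto simp: inner_link_path[OF l])
qed

subsection \<open>Arcs and directions\<close>

text \<open>A link traversing the arc above \<open>s\<close> towards the root covers it iff the arc points away from the
  root, hence \<open>dir_arc True\<close> yields down-arcs and \<open>dir_arc False\<close> yields up-arcs.\<close>

definition dir_arc :: "bool \<Rightarrow> 'v \<Rightarrow> 'v arc" where
  "dir_arc d s = (if d then (parent I s, s) else (s, parent I s))"

text \<open>The flag absorbs the symmetry that swaps the endpoints of a link, so that the argument
  is carried out once for both directions.\<close>

definition side :: "bool \<Rightarrow> 'v link \<Rightarrow> 'v set" where
  "side d l = asc I (if d then l else prod.swap l)"

text \<open>The vertices whose parent arc is covered by being traversed in direction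
  \<open>d\<close>. As arcs are not antiparallel, every non-root vertex belongs to exactly one of
  the two sets.\<close>

definition dir_verts :: "bool \<Rightarrow> 'v set" where
  "dir_verts d = {s \<in> verts I - {root I}. dir_arc d s \<in> arcs I}"

lemma dir_arc_eq_iff:
  assumes "s \<in> verts I - {root I}" "s' \<in> verts I - {root I}"
  shows "dir_arc d s = dir_arc d' s' \<longleftrightarrow> d = d' \<and> s = s'"
proof -
  \<comment> \<open>Arcs of different flags could coincide only if each of the two vertices were the
    parent of the other.\<close>
  have "\<not> (parent I s = s' \<and> parent I s' = s)"
  proof
    assume *: "parent I s = s' \<and> parent I s' = s"
    then have "s \<notin> anc I s'" "s' \<notin> anc I s" using parent_notin_anc[of s] parent_notin_anc[of s'] assms by simp_all
    moreover have "parent I s \<in> anc I s" using assms anc_parent[of s] parent_path(2)[of s] by auto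
    ultimately show False using * by simp
  qed
  then show ?thesis by (auto simp: dir_arc_def split: if_splits)
qed

lemma arc_cases:
  assumes "a \<in> arcs I"
  obtains d s where "s \<in> dir_verts d" "a = dir_arc d s"
proof (cases rule: arc_parent_cases[OF assms])
  case (1 v)
  then show ?thesis using assms by (intro that[of v False]) (auto simp: dir_arc_def dir_verts_def)
next
  case (2 v)
  then show ?thesis using assms by (intro that[of v True]) (auto simp: dir_arc_def dir_verts_def)
qed

lemma dir_verts_cover:
  assumes "s \<in> verts I - {root I}" shows "s \<in> dir_verts True \<or> s \<in> dir_verts False"
  using parent_path(3)[of s] assms by (auto simp: dir_verts_def dir_arc_def adj_def)

lemma dir_vertsD: "s \<in> dir_verts d \<Longrightarrow> s \<in> verts I - {root I}" "s \<in> dir_verts d \<Longrightarrow> dir_arc d s \<in> arcs I"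
  by (auto simp: dir_verts_def)

lemma side_props:
  assumes "fst l \<in> verts I" "snd l \<in> verts I" "s \<in> side d l"
  shows "s \<in> verts I - {root I}"
  using assms asc_props[of l s] asc_props[of "prod.swap l" s] by (auto simp: side_def split: if_splits)

lemma side_disj: "s \<in> side d l \<Longrightarrow> s \<notin> side (\<not> d) l"
  by (cases d) (auto simp: side_def asc_def)

lemma steps_link_path_side:
  assumes "fst l \<in> verts I" "snd l \<in> verts I" "s \<in> verts I - {root I}"
  shows "prod.swap (dir_arc d s) \<in> steps (link_path I l) \<longleftrightarrow> s \<in> side d l"
    "dir_arc d s \<in> steps (link_path I l) \<longleftrightarrow> s \<in> side (\<not> d) l"
proof -
  have 1: "(\<lambda>s. (s, parent I s)) ` asc I l = dir_arc False ` side True l"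
    "(\<lambda>s. (parent I s, s)) ` asc I (prod.swap l) = dir_arc True ` side False l"
    by (auto simp: dir_arc_def side_def)
  have *: "dir_arc d s \<in> steps (link_path I l) \<longleftrightarrow> s \<in> side (\<not> d) l" for d
    unfolding steps_link_path[OF assms(1,2)] 1
    using dir_arc_eq_iff[OF assms(3)] side_props[OF assms(1,2)] by (cases d) (auto simp: image_iff; metis)+
  from * show "dir_arc d s \<in> steps (link_path I l) \<longleftrightarrow> s \<in> side (\<not> d) l" .
  have "prod.swap (dir_arc d s) = dir_arc (\<not> d) s" by (simp add: dir_arc_def)
  then show "prod.swap (dir_arc d s) \<in> steps (link_path I l) \<longleftrightarrow> s \<in> side d l" using * by simp
qed

text \<open>This lemma and the two after it replace arcs by vertices: for the arc above
  \<open>s\<close> in \<open>dir_verts d\<close>, traversal in direction \<open>d\<close> is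
  coverage and traversal in the opposite direction is what heaviness counts.\<close>

lemma fcov_iff:
  assumes "fst l \<in> verts I" "snd l \<in> verts I" "s \<in> dir_verts d"
  shows "dir_arc d s \<in> fcov I l \<longleftrightarrow> s \<in> side d l"
  using steps_link_path_side(1)[OF assms(1,2), of s d] dir_vertsD[OF assms(3)] by (auto simp: fcov_def)

lemma cov_iff:
  assumes "fst l \<in> verts I" "snd l \<in> verts I" "s \<in> dir_verts d"
  shows "dir_arc d s \<in> cov I l \<longleftrightarrow> s \<in> side d l \<or> s \<in> side (\<not> d) l"
  using steps_link_path_side[OF assms(1,2), of s d] dir_vertsD[OF assms(3)]
  by (auto simp: cov_def path_arcs_def)

lemma bcov_iff:
  assumes "fst l \<in> verts I" "snd l \<in> verts I" "s \<in> dir_verts d"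
  shows "dir_arc d s \<in> bcov I l \<longleftrightarrow> s \<in> side (\<not> d) l"
  using fcov_iff[OF assms] cov_iff[OF assms] side_disj[of s d l] side_disj[of s "\<not> d" l] by (auto simp: bcov_def)

lemma steps_root_path:
  assumes "v \<in> verts I"
  shows "steps (root_path I v) = (\<lambda>s. (s, parent I s)) ` (anc I v - {root I})"
proof -
  obtain xs where xs: "root_path I v = xs @ root_path I (root I)"
    using anc_split[OF assms root_anc[OF assms]] by metis
  have "steps (xs @ [root I]) = (\<lambda>s. (s, parent I s)) ` set xs"
    by (rule steps_root_path_prefix[OF assms xs]) simp
  moreover have "set xs = anc I v - {root I}"
    using xs root_path_distinct[OF assms] by (auto simp: anc_def)
  ultimately show ?thesis using xs by simp
qed

lemma up_arcs_eq: "up_arcs I = dir_arc False ` dir_verts False"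
proof (intro equalityI subsetI)
  fix a assume "a \<in> up_arcs I"
  then have a: "a \<in> arcs I" "a \<in> steps (root_path I (fst a))" by (auto simp: up_arcs_def)
  then have "fst a \<in> verts I" using arcs_verts by auto
  then obtain s where "s \<in> verts I" "s \<noteq> root I" "a = (s, parent I s)"
    using a(2) anc_verts by (auto simp: steps_root_path)
  then show "a \<in> dir_arc False ` dir_verts False" using a by (auto simp: dir_arc_def dir_verts_def)
next
  fix a assume "a \<in> dir_arc False ` dir_verts False"
  then obtain s where "s \<in> verts I" "s \<noteq> root I" "a = (s, parent I s)" "a \<in> arcs I"
    by (auto simp: dir_arc_def dir_verts_def)
  then show "a \<in> up_arcs I" by (auto simp: up_arcs_def steps_root_path)
qed

lemma down_arcs_eq: "down_arcs I = dir_arc True ` dir_verts True"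
proof (intro equalityI subsetI)
  fix a assume "a \<in> down_arcs I"
  then have a: "a \<in> arcs I" "prod.swap a \<in> steps (root_path I (snd a))" by (auto simp: down_arcs_def)
  then have "snd a \<in> verts I" using arcs_verts by auto
  then obtain s where s: "s \<in> verts I" "s \<noteq> root I" "prod.swap a = (s, parent I s)"
    using a(2) anc_verts by (auto simp: steps_root_path)
  then have "a = (parent I s, s)" by (cases a) auto
  then show "a \<in> dir_arc True ` dir_verts True" using a s by (auto simp: dir_arc_def dir_verts_def)
next
  fix a assume "a \<in> dir_arc True ` dir_verts True"
  then obtain s where "s \<in> verts I" "s \<noteq> root I" "a = (parent I s, s)" "a \<in> arcs I"
    by (auto simp: dir_arc_def dir_verts_def)
  then show "a \<in> down_arcs I" by (auto simp: down_arcs_def steps_root_path)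
qed

lemma desc_arcs_iff:
  assumes "s \<in> dir_verts d"
  shows "dir_arc d s \<in> desc_arcs I v \<longleftrightarrow> v \<in> anc I s \<and> v \<noteq> s"
proof -
  note s = dir_vertsD[OF assms]
  have p: "parent I s \<in> verts I" "anc I s = insert s (anc I (parent I s))" "s \<notin> anc I (parent I s)"
    using parent_path(2) anc_parent parent_notin_anc s by auto
  have "dir_arc d s \<in> desc_arcs I v \<longleftrightarrow> v \<in> anc I s \<and> v \<in> anc I (parent I s)"
    using s p(1) by (auto simp: desc_arcs_def desc_verts_def dir_arc_def anc_def)
  then show ?thesis using p by auto
qed

lemma parent_arc_dir:
  assumes "s \<in> dir_verts d" shows "parent_arc I s = dir_arc d s"
  using assms by (auto simp: parent_arc_def dir_arc_def dir_verts_def dest: arcs_antisym)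

end

section \<open>Shadows and splittings\<close>

text \<open>Bridges two views of a cut link: its pieces are computed by filtering the path, whereas
  \<open>shadow\<close> speaks of positions on the path.\<close>

lemma steps_filter_iff:
  "l \<in> steps (filter K p) \<longleftrightarrow>
    (\<exists>i j. i < j \<and> j < length p \<and> l = (p ! i, p ! j) \<and> K (p ! i) \<and> K (p ! j) \<and>
      (\<forall>k. i < k \<and> k < j \<longrightarrow> \<not> K (p ! k)))"
proof
  show "l \<in> steps (filter K p) \<Longrightarrow> (\<exists>i j. i < j \<and> j < length p \<and> l = (p ! i, p ! j) \<and> K (p ! i) \<and> K (p ! j) \<and>
      (\<forall>k. i < k \<and> k < j \<longrightarrow> \<not> K (p ! k)))"
  proof (induction p)
    case (Cons x p)
    show ?case
    proof (cases "l \<in> steps (filter K p)")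
      case True
      then obtain i j where "i < j" "j < length p" "l = (p ! i, p ! j)" "K (p ! i)" "K (p ! j)"
        "\<forall>k. i < k \<and> k < j \<longrightarrow> \<not> K (p ! k)" using Cons.IH by blast
      then show ?thesis
        by (intro exI[of _ "Suc i"] exI[of _ "Suc j"]) (auto simp: nth_Cons split: nat.splits)
    next
      case False
      then have K: "K x" and st: "l \<in> steps (x # filter K p)" using Cons.prems by (auto split: if_splits)
      have ne: "filter K p \<noteq> []"
      proof
        assume e: "filter K p = []"
        show False using st unfolding e by simp
      qed
      have l: "l = (x, hd (filter K p))" using st False unfolding steps_Cons[OF ne] by simp
      obtain b bs where b: "filter K p = b # bs" using ne by (cases "filter K p") auto
      then obtain m vs where m: "p = m @ b # vs" "\<forall>u\<in>set m. \<not> K u" "K b"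
        using filter_eq_ConsD[of K p b bs] by blast
      have "\<not> K ((x # p) ! k)" if "0 < k" "k < Suc (length m)" for k
        using that m by (cases k) (auto simp: nth_append)
      then show ?thesis using K l b m
        by (intro exI[of _ 0] exI[of _ "Suc (length m)"]) auto
    qed
  qed simp
next
  assume "\<exists>i j. i < j \<and> j < length p \<and> l = (p ! i, p ! j) \<and> K (p ! i) \<and> K (p ! j) \<and>
      (\<forall>k. i < k \<and> k < j \<longrightarrow> \<not> K (p ! k))"
  then obtain i j where ij: "i < j" "j < length p" "l = (p ! i, p ! j)" "K (p ! i)" "K (p ! j)"
    "\<And>k. i < k \<Longrightarrow> k < j \<Longrightarrow> \<not> K (p ! k)" by blast
  define m where "m = take (j - Suc i) (drop (Suc i) p)"
  have "drop (Suc i) p = m @ drop j p"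
    using ij unfolding m_def by (metis append_take_drop_id drop_drop le_add_diff_inverse2 Suc_leI)
  then have p: "p = take i p @ p ! i # m @ p ! j # drop (Suc j) p"
    using ij by (metis Cons_nth_drop_Suc id_take_nth_drop order.strict_trans)
  have m: "filter K m = []"
    using ij by (auto simp: filter_empty_conv m_def in_set_conv_nth)
  have "filter K p = filter K (take i p @ p ! i # m @ p ! j # drop (Suc j) p)"
    using p by (rule arg_cong)
  also have "\<dots> = filter K (take i p) @ p ! i # p ! j # filter K (drop (Suc j) p)"
    using m ij(4,5) by simp
  finally have "filter K p = filter K (take i p) @ p ! i # p ! j # filter K (drop (Suc j) p)" .
  then show "l \<in> steps (filter K p)" unfolding ij(3) steps_conv by blast
qed

lemma steps_segment:
  assumes "i < j" "j < length p"
  shows "steps (take (Suc (j - i)) (drop i p)) = {(p ! k, p ! Suc k) | k. i \<le> k \<and> k < j}"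
proof (intro equalityI subsetI)
  fix e assume "e \<in> steps (take (Suc (j - i)) (drop i p))"
  then obtain k where "k < j - i" "e = (p ! (i + k), p ! Suc (i + k))"
    using assms by (auto simp: steps_nth)
  then show "e \<in> {(p ! k, p ! Suc k) | k. i \<le> k \<and> k < j}"
    by (intro CollectI exI[of _ "i + k"]) auto
next
  fix e assume "e \<in> {(p ! k, p ! Suc k) | k. i \<le> k \<and> k < j}"
  then obtain k where "i \<le> k" "k < j" "e = (p ! k, p ! Suc k)" by auto
  then show "e \<in> steps (take (Suc (j - i)) (drop i p))"
    using assms unfolding steps_nth by (intro CollectI exI[of _ "k - i"]) auto
qed

text \<open>Locates the piece that contains the step from position \<open>k\<close> to
  \<open>Suc k\<close>: its ends are the last kept position up to \<open>k\<close> and the first one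
  beyond.\<close>

lemma consecutive_around:
  fixes k n :: nat
  assumes "K 0" "K n" "k < n"
  obtains i j where "i \<le> k" "k < j" "j \<le> n" "K i" "K j" "\<And>m. i < m \<Longrightarrow> m < j \<Longrightarrow> \<not> K m"
proof -
  define A where "A = {i. i \<le> k \<and> K i}"
  define B where "B = {j. k < j \<and> j \<le> n \<and> K j}"
  have fA: "finite A" "A \<noteq> {}" and fB: "finite B" "B \<noteq> {}"
    using assms by (auto simp: A_def B_def)
  have A: "Max A \<in> A" "\<And>i. i \<in> A \<Longrightarrow> i \<le> Max A" using fA by auto
  have B: "Min B \<in> B" "\<And>i. i \<in> B \<Longrightarrow> Min B \<le> i" using fB by auto
  show ?thesis
  proof (rule that[of "Max A" "Min B"])
    fix m assume m: "Max A < m" "m < Min B"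
    show "\<not> K m"
    proof
      assume "K m"
      then have "m \<in> A \<or> m \<in> B" using m B(1) by (auto simp: A_def B_def)
      then show False using A(2)[of m] B(2)[of m] m by auto
    qed
  qed (use A(1) B(1) in \<open>auto simp: A_def B_def\<close>)
qed

section \<open>Segments of link paths and monotonicity under shadows\<close>

context wdtap_tree
begin

lemma link_path_segment:
  assumes l: "fst l \<in> verts I" "snd l \<in> verts I" and ij: "i < j" "j < length (link_path I l)"
  shows "link_path I (link_path I l ! i, link_path I l ! j) = take (Suc (j - i)) (drop i (link_path I l))"
proof -
  define p where "p = link_path I l"
  define q where "q = take (Suc (j - i)) (drop i p)"
  have p: "p = take i p @ q @ drop (Suc (j - i)) (drop i p)"
    by (simp only: q_def append_take_drop_id)
  have q: "q \<noteq> []" "hd q = p ! i" "last q = p ! j" 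
    using ij by (auto simp: q_def p_def[symmetric] hd_drop_conv_nth last_conv_nth)
  have "simple_path I (fst l) (take i p @ q @ drop (Suc (j - i)) (drop i p)) (snd l)"
    using link_path_simple[OF l] p by (simp add: p_def)
  then have "simple_path I (p ! i) q (p ! j)" using simple_path_sublist q by metis
  then show ?thesis unfolding link_path_def[of I "(_,_)"] fst_conv snd_conv p_def q_def
    by (rule tree_path_eqI)
qed

lemma shadow_props:
  assumes l: "fst l \<in> verts I" "snd l \<in> verts I" and sh: "shadow I l' l"
  shows "fst l' \<in> verts I" "snd l' \<in> verts I" "sublist (link_path I l') (link_path I l)"
proof -
  obtain i j where ij: "i < j" "j < length (link_path I l)" "l' = (link_path I l ! i, link_path I l ! j)"
    using sh by (auto simp: shadow_def)
  have "set (link_path I l) \<subseteq> verts I" using link_path_simple[OF l] by (auto simp: simple_path_def)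
  then show "fst l' \<in> verts I" "snd l' \<in> verts I" using ij by (auto simp: subset_iff)
  show "sublist (link_path I l') (link_path I l)"
    unfolding ij(3) link_path_segment[OF l ij(1,2)]
    by (metis append_take_drop_id sublist_appendI)
qed

lemma steps_sublist: "sublist q p \<Longrightarrow> steps q \<subseteq> steps p"
proof
  fix e assume "sublist q p" "e \<in> steps q"
  then obtain xs ys us vs where "p = xs @ q @ ys" "q = us @ fst e # snd e # vs"
    using steps_conv[of "fst e" "snd e" q] by (auto simp: sublist_def)
  then have "p = (xs @ us) @ fst e # snd e # (vs @ ys)" by simp
  then show "e \<in> steps p" using steps_conv[of "fst e" "snd e" p] by (metis prod.collapse)
qed

text \<open>The path of a shadow is a contiguous part of the path of the link, so its steps are
  steps of the link, in the same direction.\<close>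

lemma shadow_mono:
  assumes l: "fst l \<in> verts I" "snd l \<in> verts I" and sh: "shadow I l' l"
  shows "side d l' \<subseteq> side d l" "inner (link_path I l') \<subseteq> inner (link_path I l)"
    "cov I l' \<subseteq> cov I l" "bcov I l' \<subseteq> bcov I l"
proof -
  note s = shadow_props[OF l sh]
  have st: "steps (link_path I l') \<subseteq> steps (link_path I l)" by (rule steps_sublist[OF s(3)])
  show side: "side d l' \<subseteq> side d l" for d
  proof
    fix x assume x: "x \<in> side d l'"
    have xV: "x \<in> verts I - {root I}" by (rule side_props[OF s(1,2) x])
    show "x \<in> side d l"
      using steps_link_path_side(1)[OF s(1,2) xV, of d] steps_link_path_side(1)[OF l xV, of d] x st by auto
  qed
  show "inner (link_path I l') \<subseteq> inner (link_path I l)" by (rule inner_sublist[OF s(3)])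
  show c: "cov I l' \<subseteq> cov I l" using st by (auto simp: cov_def path_arcs_def)
  show "bcov I l' \<subseteq> bcov I l"
  proof
    fix a assume a: "a \<in> bcov I l'"
    then have "a \<in> arcs I" by (auto simp: bcov_def cov_def path_arcs_def)
    then obtain d s where ds: "s \<in> dir_verts d" "a = dir_arc d s" using arc_cases by metis
    show "a \<in> bcov I l"
      using a side[of "\<not> d"] unfolding ds(2) bcov_iff[OF s(1,2) ds(1)] bcov_iff[OF l ds(1)] by auto
  qed
qed

text \<open>If one endpoint were an ancestor of the other, it would itself be the apex and hence not
  an inner vertex.\<close>

lemma inner_apex_anc:
  assumes l: "fst l \<in> verts I" "snd l \<in> verts I" and v: "apex I l \<in> inner (link_path I l)"
  shows "fst l \<in> side True l" "snd l \<in> side False l"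
proof -
  have *: "fst l \<noteq> apex I l" "snd l \<noteq> apex I l" using v by (auto simp: inner_link_path[OF l])
  have "fst l \<notin> anc I (snd l)"
  proof
    assume "fst l \<in> anc I (snd l)"
    then have "anc I (fst l) \<inter> anc I (snd l) = anc I (fst l)"
      using anc_trans[OF l(2), of "fst l"] by auto
    then show False using apex_eqI[OF l l(1)] * by auto
  qed
  then show "fst l \<in> side True l" using l by (simp add: side_def asc_def)
  have "snd l \<notin> anc I (fst l)"
  proof
    assume "snd l \<in> anc I (fst l)"
    then have "anc I (fst l) \<inter> anc I (snd l) = anc I (snd l)"
      using anc_trans[OF l(1), of "snd l"] by auto
    then show False using apex_eqI[OF l l(2)] * by auto
  qed
  then show "snd l \<in> side False l" using l by (simp add: side_def asc_def)
qed

text \<open>A link with a shadow that turns at an inner vertex turns there too: the ends of the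
  shadow lie on the two halves of the link, so the apex of the shadow is a common ancestor of the
  ends of the link, and the only such vertex on the path is the apex of the link.\<close>

lemma apex_shadow:
  assumes l: "fst l \<in> verts I" "snd l \<in> verts I" and sh: "shadow I l' l"
    and v: "apex I l' \<in> inner (link_path I l')"
  shows "apex I l = apex I l'" "\<not> up_link I l" "\<not> down_link I l" "\<not> up_link I l'" "\<not> down_link I l'"
proof -
  note s = shadow_props[OF l sh]
  have il: "apex I l' \<in> inner (link_path I l)" using v shadow_mono(2)[OF l sh] by auto
  have 1: "fst l' \<in> anc I (fst l)" "snd l' \<in> anc I (snd l)"
    using inner_apex_anc[OF s(1,2) v] shadow_mono(1)[OF l sh, of True] shadow_mono(1)[OF l sh, of False]
    by (auto simp: side_def asc_def)
  have 2: "apex I l' \<in> anc I (fst l')" "apex I l' \<in> anc I (snd l')"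
    using apex_props(2)[OF s(1,2)] anc_self[OF apex_props(1)[OF s(1,2)]] by auto
  have "apex I l' \<in> anc I (fst l)" "apex I l' \<in> anc I (snd l)"
    using 1 2 anc_trans[OF l(1), of "fst l'"] anc_trans[OF l(2), of "snd l'"] by auto
  then show e: "apex I l = apex I l'"
    using il by (auto simp: inner_link_path[OF l] asc_def)
  show "\<not> up_link I l" "\<not> down_link I l" "\<not> up_link I l'" "\<not> down_link I l'"
    using il v e unfolding inner_link_path[OF l] inner_link_path[OF s(1,2)]
    by (auto simp: up_link_def down_link_def)
qed

subsection \<open>Cutting links\<close>

text \<open>A link is cut only at vertices chosen for the direction in which it passes them. The
  apex lies on neither side, so a link that turns at a chosen vertex is left whole there. The
  endpoints are kept so that the pieces exhaust the path.\<close>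

definition cut_keep :: "(bool \<Rightarrow> 'v set) \<Rightarrow> 'v link \<Rightarrow> 'v \<Rightarrow> bool" where
  "cut_keep S l w \<longleftrightarrow> w = fst l \<or> w = snd l \<or> (\<exists>d. w \<in> S d \<inter> side d l)"

definition cut :: "(bool \<Rightarrow> 'v set) \<Rightarrow> 'v link \<Rightarrow> 'v link set" where
  "cut S l = steps (filter (cut_keep S l) (link_path I l))"

text \<open>The lower end of the half that is traversed in direction \<open>d\<close>.\<close>

definition link_end :: "bool \<Rightarrow> 'v link \<Rightarrow> 'v" where
  "link_end d l = (if d then fst l else snd l)"

text \<open>The vertices that really produce an additional piece. The lower end lies in
  \<open>side d l\<close> but separates nothing; the other end never lies in
  \<open>side d l\<close>.\<close>

definition cut_verts :: "(bool \<Rightarrow> 'v set) \<Rightarrow> bool \<Rightarrow> 'v link \<Rightarrow> 'v set" where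
  "cut_verts S d l = S d \<inter> side d l - {link_end d l}"

lemma cut_iff:
  "l' \<in> cut S l \<longleftrightarrow> (\<exists>i j. i < j \<and> j < length (link_path I l) \<and> l' = (link_path I l ! i, link_path I l ! j) \<and>
     cut_keep S l (link_path I l ! i) \<and> cut_keep S l (link_path I l ! j) \<and>
     (\<forall>k. i < k \<and> k < j \<longrightarrow> \<not> cut_keep S l (link_path I l ! k)))"
  unfolding cut_def by (rule steps_filter_iff)

lemma cut_shadow: "l' \<in> cut S l \<Longrightarrow> shadow I l' l"
  unfolding cut_iff shadow_def by blast

lemma cut_inner:
  assumes l: "fst l \<in> verts I" "snd l \<in> verts I" and l': "l' \<in> cut S l"
    and w: "w \<in> inner (link_path I l')"
  shows "\<not> cut_keep S l w"
proof -
  obtain i j where ij: "i < j" "j < length (link_path I l)" "l' = (link_path I l ! i, link_path I l ! j)"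
     "\<And>k. i < k \<Longrightarrow> k < j \<Longrightarrow> \<not> cut_keep S l (link_path I l ! k)"
    using l' unfolding cut_iff by blast
  define p where "p = link_path I l"
  have seg: "link_path I l' = take (Suc (j - i)) (drop i p)"
    unfolding ij(3) p_def by (rule link_path_segment[OF l ij(1,2)])
  have s: "simple_path I (fst l') (link_path I l') (snd l')"
    using link_path_simple shadow_props[OF l cut_shadow[OF l']] by auto
  then have w': "w \<in> set (link_path I l')" "w \<noteq> p ! i" "w \<noteq> p ! j"
    using w inner_distinct[of "link_path I l'"] by (auto simp: simple_path_def ij(3) p_def)
  from w'(1) obtain k where "k < length (take (Suc (j - i)) (drop i p))" "take (Suc (j - i)) (drop i p) ! k = w"
    unfolding seg in_set_conv_nth by blast
  then have k: "k \<le> j - i" "w = p ! (i + k)" using ij(1,2) by (auto simp: p_def)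
  then have "k \<noteq> 0" "k \<noteq> j - i" using w' ij(1) by (auto intro: ccontr)
  then show ?thesis using ij(4)[of "i + k"] k by (auto simp: p_def)
qed

lemma splitting_cut:
  assumes sc: "shadow_complete I"
  shows "splitting I (cut S)"
  unfolding splitting_def
proof (rule ballI, intro conjI)
  fix l assume lL: "l \<in> links I"
  then have l: "fst l \<in> verts I" "snd l \<in> verts I" using links_verts by auto
  define p where "p = link_path I l"
  have sp: "simple_path I (fst l) p (snd l)" unfolding p_def by (rule link_path_simple[OF l])
  then have dp: "distinct p" by (simp add: simple_path_def)
  show sh: "\<forall>l'\<in>cut S l. shadow I l' l" using cut_shadow by blast
  then show "cut S l \<subseteq> links I" using sc lL by (auto simp: shadow_complete_def)
  \<comment> \<open>An arc of the piece between positions \<open>i\<close> and \<open>j\<close> is a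
    step of the whole path at some position in that range, in one of the two orientations.\<close>
  have st: "\<exists>k. i \<le> k \<and> k < j \<and> (c = (p ! k, p ! Suc k) \<or> prod.swap c = (p ! k, p ! Suc k))"
    if "c \<in> cov I (p ! i, p ! j)" "i < j" "j < length p" for c i j
  proof -
    have "c \<in> steps (take (Suc (j - i)) (drop i p)) \<or> prod.swap c \<in> steps (take (Suc (j - i)) (drop i p))"
      using that link_path_segment[OF l, of i j] by (auto simp: cov_def path_arcs_def p_def)
    then show ?thesis unfolding steps_segment[OF that(2,3)] by auto
  qed
  show "disjoint_family_on (cov I) (cut S l)"
    unfolding disjoint_family_on_def
  proof (intro ballI impI equals0I)
    fix l1 l2 c assume l1: "l1 \<in> cut S l" and l2: "l2 \<in> cut S l" and ne: "l1 \<noteq> l2"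
      and c: "c \<in> cov I l1 \<inter> cov I l2"
    obtain i j where ij: "i < j" "j < length p" "l1 = (p ! i, p ! j)" "cut_keep S l (p ! i)" "cut_keep S l (p ! j)"
      "\<And>k. i < k \<Longrightarrow> k < j \<Longrightarrow> \<not> cut_keep S l (p ! k)"
      using l1 unfolding cut_iff p_def by blast
    obtain i' j' where ij': "i' < j'" "j' < length p" "l2 = (p ! i', p ! j')" "cut_keep S l (p ! i')" "cut_keep S l (p ! j')"
      "\<And>k. i' < k \<Longrightarrow> k < j' \<Longrightarrow> \<not> cut_keep S l (p ! k)"
      using l2 unfolding cut_iff p_def by blast
    obtain k where k: "i \<le> k" "k < j" "c = (p ! k, p ! Suc k) \<or> prod.swap c = (p ! k, p ! Suc k)"
      using st[of c i j] c ij by auto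
    obtain k' where k': "i' \<le> k'" "k' < j'" "c = (p ! k', p ! Suc k') \<or> prod.swap c = (p ! k', p ! Suc k')"
      using st[of c i' j'] c ij' by auto
    have lt: "k < length p" "Suc k < length p" "k' < length p" "Suc k' < length p"
      using k k' ij ij' by auto
    \<comment> \<open>A distinct vertex sequence uses each arc at one position only. The position in
      turn determines the kept positions around it, so two pieces sharing an arc coincide.\<close>
    have "k = k'"
    proof -
      consider "(p ! k, p ! Suc k) = (p ! k', p ! Suc k')" | "(p ! k, p ! Suc k) = (p ! Suc k', p ! k')"
        using k(3) k'(3) by (cases c) auto
      then show ?thesis
        by cases (use dp lt in \<open>auto simp: nth_eq_iff_index_eq\<close>)
    qed
    then have "i = i'" using ij(4,6) ij'(4,6) k k' by (metis linorder_neqE_nat order.strict_trans1)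
    moreover have "j = j'" using ij(5,6) ij'(5,6) k k' \<open>k = k'\<close>
      by (metis linorder_neqE_nat order.strict_trans1)
    ultimately show False using ne ij(3) ij'(3) by simp
  qed
  show "(\<Union>l'\<in>cut S l. cov I l') = cov I l"
  proof (intro equalityI subsetI)
    fix a assume "a \<in> (\<Union>l'\<in>cut S l. cov I l')"
    then show "a \<in> cov I l" using shadow_mono(3)[OF l cut_shadow] by blast
  next
    fix a assume a: "a \<in> cov I l"
    then obtain k where k: "Suc k < length p" "a = (p ! k, p ! Suc k) \<or> prod.swap a = (p ! k, p ! Suc k)"
      by (auto simp: cov_def path_arcs_def steps_nth p_def)
    have ne: "p \<noteq> []" using k by auto
    \<comment> \<open>Both ends of the path are kept, so every step has a kept position on either
      side.\<close>
    have K0: "cut_keep S l (p ! 0)" "cut_keep S l (p ! (length p - 1))"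
      using sp hd_conv_nth[OF ne] last_conv_nth[OF ne] by (auto simp: cut_keep_def simple_path_def)
    have kn: "k < length p - 1" using k by simp
    obtain i j where ij: "i \<le> k" "k < j" "j \<le> length p - 1" "cut_keep S l (p ! i)" "cut_keep S l (p ! j)"
      "\<And>m. i < m \<Longrightarrow> m < j \<Longrightarrow> \<not> cut_keep S l (p ! m)"
      by (rule consecutive_around[of "\<lambda>i. cut_keep S l (p ! i)", OF K0 kn]) blast
    have j: "i < j" "j < length p" using ij k by auto
    have "(p ! i, p ! j) \<in> cut S l" using ij j unfolding cut_iff p_def by blast
    moreover have "a \<in> cov I (p ! i, p ! j)"
    proof -
      have "(p ! k, p ! Suc k) \<in> steps (link_path I (p ! i, p ! j))"
        using link_path_segment[OF l, of i j] steps_segment[OF j] ij j by (auto simp: p_def)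
      then show ?thesis using a k(2) by (auto simp: cov_def path_arcs_def)
    qed
    ultimately show "a \<in> (\<Union>l'\<in>cut S l. cov I l')" by blast
  qed
qed

text \<open>There is one piece fewer than there are kept vertices, and the kept vertices are the two
  ends and the cut vertices of either direction.\<close>

lemma card_cut:
  assumes l: "fst l \<in> verts I" "snd l \<in> verts I"
  shows "card (cut S l) \<le> 1 + card (cut_verts S True l) + card (cut_verts S False l)"
proof -
  define p where "p = link_path I l"
  have sp: "simple_path I (fst l) p (snd l)" unfolding p_def by (rule link_path_simple[OF l])
  let ?C = "cut_verts S True l \<union> cut_verts S False l"
  have fin: "finite (cut_verts S d l)" for d by (auto simp: cut_verts_def side_def asc_def)
  have "card (cut S l) \<le> length (filter (cut_keep S l) p) - 1"
    unfolding cut_def p_def by (rule card_steps)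
  also have "length (filter (cut_keep S l) p) = card (set (filter (cut_keep S l) p))"
    using sp by (metis distinct_card distinct_filter simple_path_def)
  also have "\<dots> \<le> card ({fst l, snd l} \<union> ?C)"
  proof (rule card_mono)
    have "w \<in> ?C" if "cut_keep S l w" "w \<noteq> fst l" "w \<noteq> snd l" for w
      using that by (auto simp: cut_keep_def cut_verts_def link_end_def split: if_splits) (metis (full_types))+
    then show "set (filter (cut_keep S l) p) \<subseteq> {fst l, snd l} \<union> ?C" by auto
  qed (use fin in auto)
  also have "\<dots> \<le> 2 + card ?C"
    by (rule le_trans[OF card_Un_le]) (simp add: card_insert_if)
  also have "card ?C \<le> card (cut_verts S True l) + card (cut_verts S False l)" by (rule card_Un_le)
  finally show ?thesis by simp
qed

end

section \<open>Charging the cuts\<close>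

context wdtap_tree
begin

text \<open>The load on the arc above \<open>v\<close> in direction \<open>d\<close>: its coverage
  if \<open>v\<close> lies in \<open>dir_verts d\<close>, and otherwise the quantity compared with
  the threshold for heaviness.\<close>

definition mass :: "('v link \<Rightarrow> real) \<Rightarrow> bool \<Rightarrow> 'v \<Rightarrow> real" where
  "mass x d v = sum x {l \<in> links I. v \<in> side d l}"

text \<open>Shielding vertices lie strictly between \<open>v\<close> and \<open>u\<close>. A chosen
  \<open>u\<close> does not shield its own arc, because a link cut at \<open>u\<close> still
  traverses the arc above \<open>u\<close>.\<close>

definition reach :: "'v set \<Rightarrow> bool \<Rightarrow> 'v \<Rightarrow> 'v set" where
  "reach S d v = {u \<in> dir_verts d. v \<in> anc I u \<and> v \<noteq> u \<and>
     (\<forall>s\<in>anc I u. v \<in> anc I s \<and> s \<noteq> u \<and> s \<noteq> v \<longrightarrow> s \<notin> S)}"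

text \<open>The elements of \<open>reach\<close> without further elements below them; they form an antichain of maximum
  size, since the ancestors of a vertex form a chain.\<close>

definition front :: "'v set \<Rightarrow> bool \<Rightarrow> 'v \<Rightarrow> 'v set" where
  "front S d v = {u \<in> reach S d v. \<forall>u'\<in>reach S d v. u \<in> anc I u' \<longrightarrow> u' = u}"

lemma side_eq: "side d l = anc I (link_end d l) - anc I (link_end (\<not> d) l)"
  by (simp add: side_def asc_def link_end_def)

lemma finite_reach [simp]: "finite (reach S d v)"
  by (rule finite_subset[OF _ finite_verts]) (auto simp: reach_def dir_verts_def)

lemma finite_front [simp]: "finite (front S d v)"
  by (rule finite_subset[OF _ finite_reach]) (auto simp: front_def)

lemma link_end_verts: "l \<in> links I \<Longrightarrow> link_end d l \<in> verts I"
  using links_verts by (auto simp: link_end_def)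

text \<open>\<open>side d l\<close> is part of a root path and hence a chain, while
  \<open>front\<close> is an antichain.\<close>

lemma card_front_side:
  assumes "l \<in> links I"
  shows "card (front S d v \<inter> side d l) \<le> 1"
proof -
  have "u = u'" if u: "u \<in> front S d v \<inter> side d l" and u': "u' \<in> front S d v \<inter> side d l" for u u'
  proof -
    have "u \<in> anc I u' \<or> u' \<in> anc I u"
      using anc_chain[OF link_end_verts[OF assms, of d], of u u'] u u' by (auto simp: side_eq)
    then show ?thesis using u u' by (auto simp: front_def)
  qed
  then have "is_singleton (front S d v \<inter> side d l) \<or> front S d v \<inter> side d l = {}"
    by (metis is_singletonI' )
  then show ?thesis by (auto simp: is_singleton_def)
qed

text \<open>A charged vertex is either a cut vertex of \<open>l\<close> or an ancestor of its apex; of two charged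
  ancestors of the apex, the lower one would shield the arcs of \<open>l\<close> from the upper one.\<close>

lemma card_charged:
  assumes l: "l \<in> links I"
  shows "card {v \<in> S d. front (S d) d v \<inter> side d l \<noteq> {}} \<le> 1 + card (cut_verts S d l)"
proof -
  define N where "N = {v \<in> S d. front (S d) d v \<inter> side d l \<noteq> {}}"
  let ?e = "link_end d l" and ?f = "link_end (\<not> d) l"
  note e = link_end_verts[OF l, of d] and f = link_end_verts[OF l, of "\<not> d"]
  \<comment> \<open>A charged \<open>v\<close> is a proper ancestor of some \<open>u\<close> on the
    side of \<open>l\<close>, hence an ancestor of the lower end and different from it. If it were
    not above the other end too, it would lie on the side and be a cut vertex.\<close>
  have NB: "v \<in> anc I ?e \<and> v \<in> anc I ?f" if v: "v \<in> N - cut_verts S d l" for v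
  proof -
    obtain u where u: "u \<in> front (S d) d v" "u \<in> side d l" and vS: "v \<in> S d" using v by (auto simp: N_def)
    then have vu: "v \<in> anc I u" "v \<noteq> u" by (auto simp: front_def reach_def)
    have ue: "u \<in> anc I ?e" using u by (simp add: side_eq)
    then have ve: "v \<in> anc I ?e" using vu anc_trans[OF e ue] by auto
    moreover have "v \<in> anc I ?f"
    proof (rule ccontr)
      assume "v \<notin> anc I ?f"
      then have "v \<in> side d l" using ve by (simp add: side_eq)
      then have "v = ?e" using v vS by (auto simp: cut_verts_def)
      then show False using anc_antisym[OF e ue] vu by auto
    qed
    ultimately show ?thesis by simp
  qed
  have no: False if v: "v \<in> N - cut_verts S d l" and w: "w \<in> N - cut_verts S d l"
    and wv: "w \<in> anc I v" "w \<noteq> v" for v w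
  proof -
    obtain u where u: "u \<in> front (S d) d w" "u \<in> side d l" using w by (auto simp: N_def)
    have ue: "u \<in> anc I ?e" "u \<notin> anc I ?f" using u by (auto simp: side_eq)
    have "u \<notin> anc I v" using anc_trans[OF f, of v] NB[OF v] ue by auto
    then have "v \<in> anc I u" using anc_chain[OF e ue(1), of v] NB[OF v] by auto
    moreover have "v \<noteq> u" using NB[OF v] ue by auto
    moreover have "v \<in> S d" using v by (simp add: N_def)
    ultimately show False using u wv by (auto simp: front_def reach_def)
  qed
  have "v = w" if "v \<in> N - cut_verts S d l" "w \<in> N - cut_verts S d l" for v w
    using no[OF that] no[OF that(2,1)] anc_chain[OF e, of v w] NB[OF that(1)] NB[OF that(2)] by auto
  then have "is_singleton (N - cut_verts S d l) \<or> N - cut_verts S d l = {}"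
    by (metis is_singletonI')
  then have 1: "card (N - cut_verts S d l) \<le> 1"
    by (metis card.empty is_singleton_altdef order_refl zero_le)
  have fin: "finite (cut_verts S d l)" by (simp add: cut_verts_def side_eq)
  show ?thesis
  proof (cases "finite N")
    case True
    have "card N \<le> card ((N - cut_verts S d l) \<union> cut_verts S d l)"
      by (rule card_mono) (use True fin in auto)
    also have "\<dots> \<le> card (N - cut_verts S d l) + card (cut_verts S d l)" by (rule card_Un_le)
    finally show ?thesis using 1 by (simp add: N_def)
  next
    case False
    \<comment> \<open>An infinite set has \<open>card\<close> 0.\<close>
    then show ?thesis by (simp add: N_def)
  qed
qed

text \<open>A fixed-point equation: \<open>S d\<close> occurs on both sides. It is solvable because
  \<open>front\<close> at \<open>v\<close> consults only members of \<open>S d\<close> strictly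
  below \<open>v\<close>, and the cost and width bounds argue from the equation alone, independently
  of how \<open>S\<close> was computed.\<close>

definition cut_system :: "real \<Rightarrow> real \<Rightarrow> ('v link \<Rightarrow> real) \<Rightarrow> (bool \<Rightarrow> 'v set) \<Rightarrow> bool" where
  "cut_system \<zeta> k x S \<longleftrightarrow> (\<forall>d v. v \<in> S d \<longleftrightarrow>
     v \<in> verts I - {root I} \<and> mass x d v < \<zeta> \<and> k < card (front (S d) d v))"

lemma sum_if_mem: "finite A \<Longrightarrow> (\<Sum>a\<in>A. if P a then c else 0) = c * real (card {a \<in> A. P a})"
  for c :: real
  by (subst sum.inter_filter[symmetric]) (auto simp: mult.commute)

text \<open>Double counting of the pairs of a chosen vertex and an element of its front, each
  weighted by its mass.\<close>

lemma charging:
  assumes S: "cut_system \<zeta> k x S"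
    and nn: "\<And>l. l \<in> links I \<Longrightarrow> x l \<ge> 0"
    and cover: "\<And>u. u \<in> dir_verts d \<Longrightarrow> mass x d u \<ge> 1"
  shows "k * card (S d) \<le> sum x (links I) + (\<Sum>l\<in>links I. x l * card (cut_verts S d l))"
    and "(\<Sum>l\<in>links I. x l * card (cut_verts S d l)) \<le> \<zeta> * card (S d)"
proof -
  have SV: "S d \<subseteq> verts I" using S by (auto simp: cut_system_def)
  then have fS: "finite (S d)" using finite_verts by (rule finite_subset)
  have massE: "mass x d u = (\<Sum>l\<in>links I. if u \<in> side d l then x l else 0)" for u
    unfolding mass_def by (rule sum.inter_filter) simp
  have "k * card (S d) = (\<Sum>v\<in>S d. k)" by simp
  also have "\<dots> \<le> (\<Sum>v\<in>S d. real (card (front (S d) d v)))"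
    by (rule sum_mono) (use S in \<open>auto simp: cut_system_def\<close>)
  also have "\<dots> \<le> (\<Sum>v\<in>S d. \<Sum>u\<in>front (S d) d v. mass x d u)"
  proof (rule sum_mono)
    fix v
    have "real (card (front (S d) d v)) = (\<Sum>u\<in>front (S d) d v. 1)" by simp
    also have "\<dots> \<le> (\<Sum>u\<in>front (S d) d v. mass x d u)"
      by (rule sum_mono) (use cover in \<open>auto simp: front_def reach_def\<close>)
    finally show "real (card (front (S d) d v)) \<le> (\<Sum>u\<in>front (S d) d v. mass x d u)" .
  qed
  also have "\<dots> = (\<Sum>v\<in>S d. \<Sum>l\<in>links I. \<Sum>u\<in>front (S d) d v. if u \<in> side d l then x l else 0)"
    unfolding massE by (intro sum.cong refl sum.swap)
  \<comment> \<open>From here the count is organised by links, so that for a fixed link only the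
    chosen vertices whose front meets its side contribute.\<close>
  also have "\<dots> = (\<Sum>l\<in>links I. \<Sum>v\<in>S d. \<Sum>u\<in>front (S d) d v. if u \<in> side d l then x l else 0)"
    by (rule sum.swap)
  also have "\<dots> \<le> (\<Sum>l\<in>links I. x l + x l * card (cut_verts S d l))"
  proof (rule sum_mono)
    fix l assume l: "l \<in> links I"
    have "(\<Sum>u\<in>front (S d) d v. if u \<in> side d l then x l else 0)
        \<le> (if front (S d) d v \<inter> side d l \<noteq> {} then x l else 0)" for v
    proof -
      have "(\<Sum>u\<in>front (S d) d v. if u \<in> side d l then x l else 0) = x l * card (front (S d) d v \<inter> side d l)"
        by (subst sum_if_mem) (auto simp: Int_def)
      also have "\<dots> \<le> (if front (S d) d v \<inter> side d l \<noteq> {} then x l else 0)"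
        using card_front_side[OF l, of "S d" d v] mult_left_le[of "real (card (front (S d) d v \<inter> side d l))" "x l"] nn[OF l]
        by auto
      finally show ?thesis .
    qed
    then have "(\<Sum>v\<in>S d. \<Sum>u\<in>front (S d) d v. if u \<in> side d l then x l else 0)
        \<le> (\<Sum>v\<in>S d. if front (S d) d v \<inter> side d l \<noteq> {} then x l else 0)"
      by (rule sum_mono)
    also have "\<dots> = x l * card {v \<in> S d. front (S d) d v \<inter> side d l \<noteq> {}}"
      by (rule sum_if_mem[OF fS])
    also have "\<dots> \<le> x l * real (1 + card (cut_verts S d l))"
      by (intro mult_left_mono of_nat_mono card_charged l nn)
    finally show "(\<Sum>v\<in>S d. \<Sum>u\<in>front (S d) d v. if u \<in> side d l then x l else 0)
        \<le> x l + x l * card (cut_verts S d l)" by (simp add: algebra_simps)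
  qed
  finally show "k * card (S d) \<le> sum x (links I) + (\<Sum>l\<in>links I. x l * card (cut_verts S d l))"
    by (simp add: sum.distrib)
  have "(\<Sum>l\<in>links I. x l * card (cut_verts S d l)) \<le> (\<Sum>l\<in>links I. \<Sum>v\<in>S d. if v \<in> side d l then x l else 0)"
  proof (rule sum_mono)
    fix l assume l: "l \<in> links I"
    have "x l * card (cut_verts S d l) \<le> x l * card {v \<in> S d. v \<in> side d l}"
      by (intro mult_left_mono of_nat_mono card_mono nn l) (use fS in \<open>auto simp: cut_verts_def\<close>)
    then show "x l * card (cut_verts S d l) \<le> (\<Sum>v\<in>S d. if v \<in> side d l then x l else 0)"
      by (simp add: sum_if_mem[OF fS])
  qed
  \<comment> \<open>The weight cut at \<open>v\<close> is at most the load at \<open>v\<close>,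
    which is below \<zeta> for a chosen vertex.\<close>
  also have "\<dots> = (\<Sum>v\<in>S d. mass x d v)" unfolding massE by (rule sum.swap)
  also have "\<dots> \<le> (\<Sum>v\<in>S d. \<zeta>)"
    by (rule sum_mono) (use S in \<open>auto simp: cut_system_def\<close>)
  finally show "(\<Sum>l\<in>links I. x l * card (cut_verts S d l)) \<le> \<zeta> * card (S d)"
    by (simp add: mult.commute)
qed

lemma cut_total:
  assumes S: "cut_system \<zeta> ((1 + inverse \<gamma>) * \<zeta>) x S" and \<gamma>: "\<gamma> > 0"
    and nn: "\<And>l. l \<in> links I \<Longrightarrow> x l \<ge> 0"
    and cover: "\<And>u. u \<in> dir_verts d \<Longrightarrow> mass x d u \<ge> 1"
  shows "(\<Sum>l\<in>links I. x l * card (cut_verts S d l)) \<le> \<gamma> * sum x (links I)"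
proof -
  let ?D = "\<Sum>l\<in>links I. x l * card (cut_verts S d l)"
  have 1: "(1 + inverse \<gamma>) * \<zeta> * card (S d) \<le> sum x (links I) + ?D"
    by (rule charging(1)[OF S nn cover])
  have 2: "?D \<le> \<zeta> * card (S d)" by (rule charging(2)[OF S nn cover])
  \<comment> \<open>Scaling the second bound by 1 + 1/\<gamma> makes its right-hand side the
    left-hand side of the first; one copy of \<open>?D\<close> then cancels.\<close>
  have "(1 + inverse \<gamma>) * ?D \<le> (1 + inverse \<gamma>) * (\<zeta> * card (S d))"
    by (rule mult_left_mono[OF 2]) (use \<gamma> in simp)
  then have "inverse \<gamma> * ?D \<le> sum x (links I)" using 1 by (simp add: algebra_simps)
  then show ?thesis using \<gamma> by (simp add: field_simps)
qed

text \<open>After exchanging the sums, each piece of \<open>l\<close> carries the weight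
  \<open>x l\<close>, and by shadow-completeness its cost is at most that of
  \<open>l\<close>.\<close>

lemma cost_split:
  assumes \<sigma>: "splitting I \<sigma>" and sc: "shadow_complete I"
    and nn: "\<And>l. l \<in> links I \<Longrightarrow> x l \<ge> 0"
  shows "cost_of I (split I x \<sigma>) \<le> (\<Sum>l\<in>links I. x l * (cost I l * card (\<sigma> l)))"
proof -
  have "cost_of I (split I x \<sigma>) = (\<Sum>l'\<in>links I. \<Sum>l\<in>links I. if l' \<in> \<sigma> l then cost I l' * x l else 0)"
    unfolding cost_of_def split_def by (simp add: sum.inter_filter sum_distrib_left if_distrib cong: if_cong)
  also have "\<dots> = (\<Sum>l\<in>links I. \<Sum>l'\<in>links I. if l' \<in> \<sigma> l then cost I l' * x l else 0)"
    by (rule sum.swap)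
  also have "\<dots> \<le> (\<Sum>l\<in>links I. x l * (cost I l * card (\<sigma> l)))"
  proof (rule sum_mono)
    fix l assume l: "l \<in> links I"
    have sl: "\<sigma> l \<subseteq> links I" "\<And>l'. l' \<in> \<sigma> l \<Longrightarrow> cost I l' \<le> cost I l"
      using \<sigma> l sc by (auto simp: splitting_def shadow_complete_def)
    have "(\<Sum>l'\<in>links I. if l' \<in> \<sigma> l then cost I l' * x l else 0)
        \<le> (\<Sum>l'\<in>links I. if l' \<in> \<sigma> l then cost I l * x l else 0)"
      by (rule sum_mono) (use sl nn[OF l] in \<open>auto intro: mult_right_mono\<close>)
    also have "\<dots> = cost I l * x l * card {l' \<in> links I. l' \<in> \<sigma> l}" by (rule sum_if_mem) simp
    also have "{l' \<in> links I. l' \<in> \<sigma> l} = \<sigma> l" using sl by auto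
    finally show "(\<Sum>l'\<in>links I. if l' \<in> \<sigma> l then cost I l' * x l else 0) \<le> x l * (cost I l * card (\<sigma> l))"
      by (simp add: mult_ac)
  qed
  finally show ?thesis .
qed

text \<open>The second part needs a link to exist, so that the minimum is positive and attained; it
  is what later compares the two thresholds.\<close>

lemma cost_ratio_bound:
  assumes "cost_ratio I \<le> \<Delta>" "l \<in> links I" "l' \<in> links I"
  shows "cost I l \<le> \<Delta> * cost I l'" "1 \<le> \<Delta>"
proof -
  let ?M = "Max (cost I ` links I)" and ?m = "Min (cost I ` links I)"
  have "?m \<in> cost I ` links I" using assms by (intro Min_in) auto
  then have m: "?m > 0" using cost_pos by auto
  have le: "cost I l \<le> ?M" "?m \<le> cost I l'" "?m \<le> cost I l" using assms by auto
  have M: "?M \<le> \<Delta> * ?m" using assms(1) m by (simp add: cost_ratio_def pos_divide_le_eq)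
  then have "1 * ?m \<le> \<Delta> * ?m" using le by linarith
  then show "1 \<le> \<Delta>" using m by simp
  then have "\<Delta> * ?m \<le> \<Delta> * cost I l'" using le(2) by (intro mult_left_mono) auto
  then show "cost I l \<le> \<Delta> * cost I l'" using M le by linarith
qed

lemma covered_mass:
  assumes "s \<in> dir_verts d"
  shows "{l \<in> links I. dir_arc d s \<in> fcov I l} = {l \<in> links I. s \<in> side d l}"
    "{l \<in> links I. dir_arc d s \<in> bcov I l} = {l \<in> links I. s \<in> side (\<not> d) l}"
  using fcov_iff[OF _ _ assms] bcov_iff[OF _ _ assms] links_verts by auto

lemma feasible_mass:
  assumes "lp_feasible I x" "s \<in> dir_verts d"
  shows "mass x d s \<ge> 1"
proof -
  have "(\<Sum>l\<in>links I. cov_matrix I (dir_arc d s) l * x l) \<ge> 1"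
    using assms dir_vertsD[OF assms(2)] by (simp add: lp_feasible_def)
  also have "(\<Sum>l\<in>links I. cov_matrix I (dir_arc d s) l * x l)
      = (\<Sum>l\<in>links I. if dir_arc d s \<in> fcov I l then x l else 0)"
    by (rule sum.cong) (auto simp: cov_matrix_def)
  also have "\<dots> = sum x {l \<in> links I. dir_arc d s \<in> fcov I l}"
    by (rule sum.inter_filter[symmetric]) simp
  finally show ?thesis by (simp add: mass_def covered_mass(1)[OF assms(2)])
qed

lemma cost_cut:
  assumes adm: "admissible \<epsilon> \<Delta> I x" and S: "cut_system (zeta2 \<epsilon> \<Delta>) (kpar \<epsilon> \<Delta>) x S"
  shows "cost_of I (split I x (cut S)) \<le> (1 + \<epsilon>) * cost_of I x"
proof -
  have a: "0 < \<epsilon>" "0 < \<Delta>" "shadow_complete I" "cost_ratio I \<le> \<Delta>" "lp_feasible I x"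
    using adm by (auto simp: admissible_def)
  have nn: "\<And>l. l \<in> links I \<Longrightarrow> x l \<ge> 0" using a by (auto simp: lp_feasible_def)
  have \<gamma>: "gamma \<epsilon> \<Delta> > 0" using a by (simp add: gamma_def)
  let ?X = "sum x (links I)" and ?D = "\<lambda>d. \<Sum>l\<in>links I. x l * card (cut_verts S d l)"
  have D: "?D d \<le> gamma \<epsilon> \<Delta> * ?X" for d
    by (rule cut_total[OF _ \<gamma> nn feasible_mass[OF a(5)]]) (use S in \<open>simp_all add: kpar_def\<close>)
  show ?thesis
  proof (cases "links I = {}")
    case True
    then show ?thesis by (simp add: cost_of_def)
  next
    case False
    define cm where "cm = Max (cost I ` links I)"
    have cm: "\<And>l. l \<in> links I \<Longrightarrow> cost I l \<le> cm" by (simp add: cm_def)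
    have "cm \<in> cost I ` links I" unfolding cm_def using False by (intro Max_in) auto
    then obtain l0 where l0: "l0 \<in> links I" "cm = cost I l0" by auto
    have cm0: "cm > 0" using l0 cost_pos by auto
    have "cost_of I (split I x (cut S)) \<le> (\<Sum>l\<in>links I. x l * (cost I l * card (cut S l)))"
      by (rule cost_split[OF splitting_cut[OF a(3)] a(3) nn])
    \<comment> \<open>One piece is paid for by the original cost of the link, every further piece by
      the maximum cost \<open>cm\<close>.\<close>
    also have "\<dots> \<le> (\<Sum>l\<in>links I. cost I l * x l + cm * (x l * card (cut_verts S True l)) + cm * (x l * card (cut_verts S False l)))"
    proof (rule sum_mono)
      fix l assume l: "l \<in> links I"
      let ?n = "real (card (cut_verts S True l)) + real (card (cut_verts S False l))"
      have "card (cut S l) \<le> 1 + card (cut_verts S True l) + card (cut_verts S False l)"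
        by (rule card_cut) (use l links_verts in auto)
      then have "real (card (cut S l)) \<le> 1 + ?n" by linarith
      then have "cost I l * card (cut S l) \<le> cost I l * (1 + ?n)"
        by (rule mult_left_mono) (use cost_pos[OF l] in simp)
      also have "\<dots> \<le> cost I l + cm * ?n"
        using mult_right_mono[OF cm[OF l], of ?n] by (simp add: algebra_simps)
      finally have "x l * (cost I l * card (cut S l)) \<le> x l * (cost I l + cm * ?n)"
        by (rule mult_left_mono[OF _ nn[OF l]])
      then show "x l * (cost I l * card (cut S l)) \<le> cost I l * x l + cm * (x l * card (cut_verts S True l)) + cm * (x l * card (cut_verts S False l))"
        by (simp add: algebra_simps)
    qed
    also have "\<dots> = cost_of I x + cm * ?D True + cm * ?D False"
      by (simp add: sum.distrib cost_of_def sum_distrib_left)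
    also have "\<dots> \<le> cost_of I x + cm * (gamma \<epsilon> \<Delta> * ?X) + cm * (gamma \<epsilon> \<Delta> * ?X)"
      by (intro add_mono order_refl mult_left_mono[OF D]) (use cm0 in simp_all)
    \<comment> \<open>The two directions together contribute 2 \<gamma> = \<epsilon> / \<Delta>, and
      \<open>cm\<close> / \<Delta> is a lower bound for every cost.\<close>
    also have "\<dots> = cost_of I x + \<epsilon> * (\<Sum>l\<in>links I. cm / \<Delta> * x l)"
      using a by (simp add: gamma_def field_simps sum_distrib_left sum_divide_distrib)
    also have "\<dots> \<le> cost_of I x + \<epsilon> * cost_of I x"
    proof -
      have "(\<Sum>l\<in>links I. cm / \<Delta> * x l) \<le> cost_of I x"
        unfolding cost_of_def
      proof (rule sum_mono)
        fix l assume l: "l \<in> links I"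
        have "cm / \<Delta> \<le> cost I l" using cost_ratio_bound(1)[OF a(4) l0(1) l] l0 a
          by (simp add: field_simps)
        then show "cm / \<Delta> * x l \<le> cost I l * x l" by (rule mult_right_mono[OF _ nn[OF l]])
      qed
      then show ?thesis using a by simp
    qed
    finally show ?thesis by (simp add: algebra_simps)
  qed
qed

end

section \<open>Visible width\<close>

context wdtap_tree
begin

definition viwidth :: "bool \<Rightarrow> 'v link set \<Rightarrow> 'v \<Rightarrow> nat" where
  "viwidth d L v = (if d then viwidth_down I L v else viwidth_up I L v)"

definition dir_arcs :: "bool \<Rightarrow> 'v arc set" where
  "dir_arcs d = dir_arc d ` dir_verts d"

lemma viwidth_eq:
  "viwidth d L v = Max (card ` {F. F \<subseteq> {a \<in> dir_arcs d. visible I L v a} \<and> ancestor_free I F})"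
  by (cases d) (simp_all add: viwidth_def viwidth_down_def viwidth_up_def up_arcs_eq down_arcs_eq dir_arcs_def)

lemma viwidth_le:
  fixes k :: real
  assumes "\<And>F. F \<subseteq> {a \<in> dir_arcs d. visible I L v a} \<Longrightarrow> ancestor_free I F \<Longrightarrow> real (card F) \<le> k"
  shows "viwidth d L v \<le> k"
proof -
  let ?A = "{F. F \<subseteq> {a \<in> dir_arcs d. visible I L v a} \<and> ancestor_free I F}"
  have "finite (Pow (arcs I))" by simp
  moreover have "?A \<subseteq> Pow (arcs I)" by (auto simp: dir_arcs_def dir_verts_def)
  ultimately have f: "finite (card ` ?A)" using finite_subset by blast
  \<comment> \<open>The maximum is taken over a nonempty finite family, hence attained.\<close>
  have "{} \<in> ?A" by (simp add: ancestor_free_def)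
  then have "card ` ?A \<noteq> {}" by blast
  from Max_in[OF f this] obtain F where "F \<in> ?A" "Max (card ` ?A) = card F" by blast
  then show ?thesis using assms[of F] unfolding viwidth_eq by auto
qed

lemma arc_apex_dir_arc:
  assumes "s \<in> verts I - {root I}"
  shows "arc_apex I (dir_arc d s) = parent I s"
  using parent_path(1)[of s] assms by (auto simp: arc_apex_def dir_arc_def)

lemma ancestor_freeD:
  assumes F: "ancestor_free I F" and s: "s \<in> dir_verts d" "dir_arc d s \<in> F"
    and t: "t \<in> dir_verts d" "dir_arc d t \<in> F" and st: "s \<in> anc I t"
  shows "s = t"
proof (rule ccontr)
  assume ne: "s \<noteq> t"
  note sV = dir_vertsD[OF s(1)] and tV = dir_vertsD[OF t(1)]
  have p: "parent I t \<in> verts I" using parent_path(2) tV by auto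
  have "s \<in> anc I (parent I t)" using anc_parent[of t] tV st ne by auto
  then have "(s, parent I s) \<in> steps (root_path I (parent I t))"
    using sV by (simp add: steps_root_path[OF p])
  then have "dir_arc d s \<in> path_arcs I (root_path I (arc_apex I (dir_arc d t)))"
    unfolding arc_apex_dir_arc[OF tV(1)] using sV by (auto simp: path_arcs_def dir_arc_def)
  then show False using F s(2) t(2) by (auto simp: ancestor_free_def)
qed

text \<open>Among the elements of \<open>reach\<close> below \<open>u\<close>, one with the largest
  number of ancestors has no further element below it.\<close>

lemma below_front:
  assumes u: "u \<in> reach S d v"
  obtains m where "m \<in> front S d v" "u \<in> anc I m"
proof -
  let ?B = "{m \<in> reach S d v. u \<in> anc I m}"
  have uV: "u \<in> verts I" using u by (auto simp: reach_def dir_verts_def)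
  have fB: "finite ?B" and ne: "?B \<noteq> {}" using u uV by auto
  let ?c = "\<lambda>m. card (anc I m)"
  have "Max (?c ` ?B) \<in> ?c ` ?B" using fB ne by (intro Max_in) auto
  then obtain m where m: "m \<in> ?B" "?c m = Max (?c ` ?B)" by auto
  have mx: "?c m' \<le> ?c m" if "m' \<in> ?B" for m'
    unfolding m(2) using fB that by (intro Max_ge) auto
  have "m' = m" if m': "m' \<in> reach S d v" "m \<in> anc I m'" for m'
  proof (rule ccontr)
    assume ne: "m' \<noteq> m"
    have mV: "m' \<in> verts I" using m' by (auto simp: reach_def dir_verts_def)
    have sub: "anc I m \<subseteq> anc I m'" by (rule anc_trans[OF mV m'(2)])
    then have "m' \<in> ?B" using m m' by auto
    moreover have "m' \<in> anc I m' - anc I m" using anc_antisym[OF mV m'(2)] ne mV by auto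
    then have "card (anc I m) < card (anc I m')" using sub by (intro psubset_card_mono) auto
    ultimately show False using mx[of m'] by simp
  qed
  then show ?thesis using that[of m] m(1) by (auto simp: front_def)
qed

text \<open>Each arc of \<open>F\<close> is mapped to a front element below it. Two arcs with the
  same image lie above a common vertex, are therefore comparable, and coincide because
  \<open>F\<close> is ancestor-free.\<close>

lemma ancestor_free_card:
  assumes sub: "F \<subseteq> dir_arc d ` reach S d v" and F: "ancestor_free I F"
  shows "card F \<le> card (front S d v)"
proof -
  define G where "G = {u \<in> reach S d v. dir_arc d u \<in> F}"
  have FG: "F = dir_arc d ` G" using sub by (auto simp: G_def)
  have "\<forall>u\<in>G. \<exists>m. m \<in> front S d v \<and> u \<in> anc I m" using below_front by (metis (no_types, lifting) G_def mem_Collect_eq)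
  then obtain f where f: "\<And>u. u \<in> G \<Longrightarrow> f u \<in> front S d v \<and> u \<in> anc I (f u)" by metis
  have "inj_on f G"
  proof (rule inj_onI)
    fix u u' assume u: "u \<in> G" and u': "u' \<in> G" and e: "f u = f u'"
    have "f u \<in> verts I" using f[OF u] by (auto simp: front_def reach_def dir_verts_def)
    then have "u \<in> anc I u' \<or> u' \<in> anc I u" using f[OF u] f[OF u'] e anc_chain[of "f u" u u'] by auto
    then show "u = u'"
      using ancestor_freeD[OF F, of u d u'] ancestor_freeD[OF F, of u' d u] u u' by (auto simp: G_def reach_def)
  qed
  then have "card G \<le> card (front S d v)"
    by (rule card_inj_on_le) (use f in auto)
  moreover have "card F \<le> card G" unfolding FG by (rule card_image_le) (simp add: G_def)
  ultimately show ?thesis by simp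
qed

text \<open>Shortening a path only loses inner vertices, so an upper bound on visibility may be
  proved with the whole link path.\<close>

lemma short_path_sublist: "sublist (short_path I l) (link_path I l)"
proof -
  have "sublist (link_path I l) (link_path I l) \<and> fcov I l \<subseteq> path_arcs I (link_path I l)"
    by (auto simp: fcov_def path_arcs_def)
  then have "sublist (short_path I l) (link_path I l) \<and> fcov I l \<subseteq> path_arcs I (short_path I l)"
    unfolding short_path_def by (rule arg_min_natI)
  then show ?thesis by simp
qed

lemma side_between:
  assumes l: "fst l \<in> verts I" "snd l \<in> verts I" and v: "v \<in> set (link_path I l)"
    and u: "u \<in> side d l" and s: "s \<in> anc I u" "v \<in> anc I s" "s \<noteq> v" "s \<noteq> u"
  shows "s \<in> side d l" "s \<in> inner (link_path I l)"
proof -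
  have "s \<in> side d l \<and> s \<in> inner (link_path I l)"
  proof (cases d)
    case True
    then show ?thesis using asc_between[OF l v _ s] u by (simp add: side_def)
  next
    case False
    have l': "fst (prod.swap l) \<in> verts I" "snd (prod.swap l) \<in> verts I" using l by auto
    have "v \<in> set (link_path I (prod.swap l))"
      using v unfolding set_link_path[OF l] set_link_path[OF l'] apex_swap[OF l] by auto
    moreover have "u \<in> asc I (prod.swap l)" using u False by (simp add: side_def)
    ultimately have "s \<in> asc I (prod.swap l)" "s \<in> inner (link_path I (prod.swap l))"
      using asc_between[OF l' _ _ s] by blast+
    then show ?thesis using False unfolding inner_link_path[OF l] inner_link_path[OF l'] apex_swap[OF l]
      by (auto simp: side_def)
  qed
  then show "s \<in> side d l" "s \<in> inner (link_path I l)" by auto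
qed

text \<open>An ancestor of a vertex on one half is an ancestor of the lower end of that half, so it
  cannot lie on the other half.\<close>

lemma on_path_cases:
  assumes l: "fst l \<in> verts I" "snd l \<in> verts I" and v: "v \<in> set (link_path I l)"
    and u: "u \<in> side d l" "v \<in> anc I u"
  shows "v \<in> side d l \<or> v = apex I l"
proof -
  have e: "link_end d l \<in> verts I" using l by (simp add: link_end_def)
  have "v \<in> anc I (link_end d l)" using u anc_trans[OF e, of u] by (auto simp: side_eq)
  then have "v \<notin> side (\<not> d) l" by (simp add: side_eq)
  then show ?thesis using v unfolding set_link_path[OF l] by (cases d) (auto simp: side_def)
qed

lemma supp_split:
  assumes nn: "\<And>l. l \<in> links I \<Longrightarrow> x l \<ge> 0" and l': "l' \<in> supp I (split I x \<sigma>)"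
  obtains l where "l \<in> supp I x" "l' \<in> \<sigma> l"
proof -
  have pos: "sum x {l \<in> links I. l' \<in> \<sigma> l} > 0" using l' by (simp add: supp_def split_def)
  have "\<exists>l\<in>links I. l' \<in> \<sigma> l \<and> x l > 0"
  proof (rule ccontr)
    assume "\<not> (\<exists>l\<in>links I. l' \<in> \<sigma> l \<and> x l > 0)"
    then have "sum x {l \<in> links I. l' \<in> \<sigma> l} \<le> 0" by (intro sum_nonpos) force
    then show False using pos by simp
  qed
  then show ?thesis using that by (auto simp: supp_def)
qed

section \<open>Visibility after both splittings\<close>

lemma split_nonneg: "(\<And>l. l \<in> links I \<Longrightarrow> x l \<ge> 0) \<Longrightarrow> split I x \<sigma> l' \<ge> 0"
  unfolding split_def by (rule sum_nonneg) simp

text \<open>The root lies on no side, so a link having it as an inner vertex turns there. Including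
  the root makes these links cross-links, which the later splitting has to break.\<close>

definition cut_points :: "(bool \<Rightarrow> 'v set) \<Rightarrow> 'v set" where
  "cut_points S = {root I} \<union> S True \<union> S False"

text \<open>The witnessing link \<open>l'\<close> is traced back through both splittings: it is a
  shadow of a piece \<open>l\<close>, and \<open>l\<close> is a piece of some \<open>l0\<close> in
  the support of \<open>x\<close>. A chosen vertex inside \<open>l'\<close>, passed in its
  direction, would have cut \<open>l0\<close>.\<close>

lemma visible_reach:
  assumes nn: "\<And>l. l \<in> links I \<Longrightarrow> x l \<ge> 0"
    and \<sigma>: "splitting I \<sigma>"
    and cross: "\<forall>l\<in>links I. cross_link I (cut_points S) l \<longrightarrow> (\<forall>l'\<in>\<sigma> l. up_link I l' \<or> down_link I l')"
    and u: "u \<in> dir_verts d" and vis: "visible I (supp I (split I (split I x (cut S)) \<sigma>)) v (dir_arc d u)"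
  shows "u \<in> reach (S d) d v \<and> v \<notin> S d \<and> v \<noteq> root I"
proof -
  obtain l' where l': "l' \<in> supp I (split I (split I x (cut S)) \<sigma>)" "dir_arc d u \<in> fcov I l'"
    "v \<in> inner (short_path I l')" and da: "dir_arc d u \<in> desc_arcs I v"
    using vis by (auto simp: visible_def)
  have vu: "v \<in> anc I u" "v \<noteq> u" using da unfolding desc_arcs_iff[OF u] by auto
  obtain l where l: "l \<in> supp I (split I x (cut S))" "l' \<in> \<sigma> l"
    using supp_split[OF split_nonneg l'(1)] nn by blast
  obtain l0 where l0: "l0 \<in> supp I x" "l \<in> cut S l0"
    using supp_split[OF nn l(1)] by blast
  have lL: "l \<in> links I" "l0 \<in> links I" using l l0 by (auto simp: supp_def)
  have ends0: "fst l0 \<in> verts I" "snd l0 \<in> verts I" and ends: "fst l \<in> verts I" "snd l \<in> verts I"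
    using lL links_verts by auto
  have sh0: "shadow I l l0" by (rule cut_shadow[OF l0(2)])
  have sh: "shadow I l' l" using \<sigma> lL l(2) by (auto simp: splitting_def)
  note ends' = shadow_props(1,2)[OF ends sh]
  have vin: "v \<in> inner (link_path I l')" using inner_sublist[OF short_path_sublist] l'(3) by blast
  then have vp: "v \<in> set (link_path I l')" using inner_subset by (rule subsetD[rotated])
  have us: "u \<in> side d l'" using l'(2) fcov_iff[OF ends' u] by simp
  have nocut: "s \<notin> S d" if "s \<in> side d l'" "s \<in> inner (link_path I l')" for s
  proof -
    have "s \<in> inner (link_path I l)" using that shadow_mono(2)[OF ends sh] by blast
    then have "\<not> cut_keep S l0 s" by (rule cut_inner[OF ends0 l0(2)])
    moreover have "s \<in> side d l0" using that(1) shadow_mono(1)[OF ends sh, of d] shadow_mono(1)[OF ends0 sh0, of d] by blast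
    ultimately show ?thesis by (auto simp: cut_keep_def)
  qed
  have "s \<notin> S d" if "s \<in> anc I u" "v \<in> anc I s" "s \<noteq> u" "s \<noteq> v" for s
    by (rule nocut; rule side_between[OF ends' vp us that(1,2,4,3)])
  then have 1: "u \<in> reach (S d) d v" using u vu by (simp add: reach_def)
  \<comment> \<open>If \<open>l'\<close> turned at a member of the cut points, so would
    \<open>l\<close>, making \<open>l\<close> a cross-link; but then \<open>l'\<close> would have to
    be an up-link or a down-link.\<close>
  have 2: "v \<notin> cut_points S" if "v = apex I l'"
  proof
    assume vW: "v \<in> cut_points S"
    have ap: "apex I l' \<in> inner (link_path I l')" using vin that by simp
    note A = apex_shadow[OF ends sh ap]
    have "cross_link I (cut_points S) l" using A vW that by (simp add: cross_link_def)
    then show False using cross lL(1) l(2) A by blast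
  qed
  have "v \<notin> S d \<and> v \<noteq> root I"
  proof (cases "v = apex I l'")
    case True
    then show ?thesis using 2 by (cases d) (auto simp: cut_points_def)
  next
    case False
    then have "v \<in> side d l'" using on_path_cases[OF ends' vp us vu(1)] by blast
    then show ?thesis using nocut[OF _ vin] side_props[OF ends'] by blast
  qed
  then show ?thesis using 1 by simp
qed

text \<open>At the root and at chosen vertices nothing is visible. At any other light vertex the
  fixed-point equation says that being unchosen means a front of size at most
  \<open>k\<close>.\<close>

lemma viwidth_bound:
  fixes k :: real
  assumes nn: "\<And>l. l \<in> links I \<Longrightarrow> x l \<ge> 0" and S: "cut_system \<zeta> k x S" and k: "k \<ge> 0"
    and \<sigma>: "splitting I \<sigma>"
    and cross: "\<forall>l\<in>links I. cross_link I (cut_points S) l \<longrightarrow> (\<forall>l'\<in>\<sigma> l. up_link I l' \<or> down_link I l')"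
    and v: "v \<in> verts I" "v = root I \<or> mass x d v < \<zeta>"
  shows "viwidth d (supp I (split I (split I x (cut S)) \<sigma>)) v \<le> k"
proof (rule viwidth_le)
  fix F assume F: "F \<subseteq> {a \<in> dir_arcs d. visible I (supp I (split I (split I x (cut S)) \<sigma>)) v a}" "ancestor_free I F"
  note R = visible_reach[OF nn \<sigma> cross]
  show "real (card F) \<le> k"
  proof (cases "v = root I \<or> v \<in> S d")
    case True
    then have "F = {}" using F(1) R by (fastforce simp: dir_arcs_def)
    then show ?thesis using k by simp
  next
    case False
    then have "real (card (front (S d) d v)) \<le> k" using S v by (auto simp: cut_system_def not_less)
    moreover have "F \<subseteq> dir_arc d ` reach (S d) d v" using F(1) R by (fastforce simp: dir_arcs_def)
    then have "card F \<le> card (front (S d) d v)" by (rule ancestor_free_card[OF _ F(2)])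
    ultimately show ?thesis by linarith
  qed
qed

text \<open>Transfers lightness from the split solution back to \<open>x\<close>: a link that loads
  the arc backwards has a piece containing the arc, and this piece traverses it in the same
  direction.\<close>

lemma heavy_split:
  assumes nn: "\<And>l. l \<in> links I \<Longrightarrow> x l \<ge> 0" and \<sigma>: "splitting I \<sigma>" and s: "s \<in> dir_verts d"
    and h: "\<not> heavy I (split I x \<sigma>) \<zeta> (dir_arc d s)"
  shows "mass x (\<not> d) s < \<zeta>"
proof -
  let ?B = "{l \<in> links I. dir_arc d s \<in> bcov I l}"
  have fB: "finite ?B" by simp
  have "mass x (\<not> d) s = sum x ?B" by (simp add: mass_def covered_mass(2)[OF s])
  also have "\<dots> \<le> (\<Sum>l\<in>links I. \<Sum>l'\<in>?B. if l' \<in> \<sigma> l then x l else 0)"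
  proof -
    have "sum x ?B = (\<Sum>l\<in>links I. if dir_arc d s \<in> bcov I l then x l else 0)"
      by (rule sum.inter_filter) simp
    also have "\<dots> \<le> (\<Sum>l\<in>links I. \<Sum>l'\<in>?B. if l' \<in> \<sigma> l then x l else 0)"
    proof (rule sum_mono)
      fix l assume l: "l \<in> links I"
      then have ends: "fst l \<in> verts I" "snd l \<in> verts I" using links_verts by auto
      have sl: "\<sigma> l \<subseteq> links I" "\<And>l'. l' \<in> \<sigma> l \<Longrightarrow> shadow I l' l" "(\<Union>l'\<in>\<sigma> l. cov I l') = cov I l"
        using \<sigma> l by (auto simp: splitting_def)
      show "(if dir_arc d s \<in> bcov I l then x l else 0) \<le> (\<Sum>l'\<in>?B. if l' \<in> \<sigma> l then x l else 0)"
      proof (cases "dir_arc d s \<in> bcov I l")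
        case True
        then have "dir_arc d s \<in> cov I l" by (simp add: bcov_def)
        then obtain l' where l': "l' \<in> \<sigma> l" "dir_arc d s \<in> cov I l'" using sl(3) by blast
        note ends' = shadow_props(1,2)[OF ends sl(2)[OF l'(1)]]
        have "s \<in> side (\<not> d) l" using True bcov_iff[OF ends s] by simp
        then have "s \<notin> side d l'" using shadow_mono(1)[OF ends sl(2)[OF l'(1)], of d] side_disj[of s d l] by blast
        then have "s \<in> side (\<not> d) l'" using l'(2) cov_iff[OF ends' s] by simp
        then have "l' \<in> ?B" using bcov_iff[OF ends' s] l'(1) sl(1) by auto
        then have "(if l' \<in> \<sigma> l then x l else 0) \<le> (\<Sum>l'\<in>?B. if l' \<in> \<sigma> l then x l else 0)"
          by (rule member_le_sum) (use nn[OF l] in auto)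
        then show ?thesis using True l'(1) by simp
      next
        case False
        then show ?thesis using nn[OF l] by (simp add: sum_nonneg)
      qed
    qed
    finally show ?thesis .
  qed
  also have "\<dots> = (\<Sum>l'\<in>?B. \<Sum>l\<in>links I. if l' \<in> \<sigma> l then x l else 0)" by (rule sum.swap)
  also have "\<dots> = sum (split I x \<sigma>) ?B"
    by (rule sum.cong[OF refl]) (simp add: split_def sum.inter_filter)
  also have "\<dots> < \<zeta>" using h by (simp add: heavy_def)
  finally show ?thesis .
qed

text \<open>A link that covers a \<open>d\<close>-arc below \<open>v\<close> and leaves the subtree
  would pass \<open>v\<close> in direction \<open>d\<close> and would have been cut there. So both
  its ends lie below \<open>v\<close> or at \<open>v\<close>, and the whole link stays in the
  subtree.\<close>

lemma cut_independent:
  assumes nn: "\<And>l. l \<in> links I \<Longrightarrow> x l \<ge> 0" and v: "v \<in> S d" "v \<in> verts I"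
    and l: "l \<in> supp I (split I x (cut S))"
  shows "fcov I l \<inter> desc_arcs I v \<inter> dir_arcs d = {} \<or> fcov I l \<subseteq> desc_arcs I v"
proof (cases "fcov I l \<inter> desc_arcs I v \<inter> dir_arcs d = {}")
  case False
  obtain l0 where l0: "l0 \<in> supp I x" "l \<in> cut S l0"
    using supp_split[OF nn l] by blast
  have lL: "l \<in> links I" "l0 \<in> links I" using l l0 by (auto simp: supp_def)
  have ends0: "fst l0 \<in> verts I" "snd l0 \<in> verts I" and ends: "fst l \<in> verts I" "snd l \<in> verts I"
    using lL links_verts by auto
  have sh0: "shadow I l l0" by (rule cut_shadow[OF l0(2)])
  obtain u where u: "u \<in> dir_verts d" "dir_arc d u \<in> fcov I l" "dir_arc d u \<in> desc_arcs I v"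
    using False by (auto simp: dir_arcs_def)
  have us: "u \<in> side d l" using u fcov_iff[OF ends u(1)] by simp
  have vu: "v \<in> anc I u" "v \<noteq> u" using u(3) unfolding desc_arcs_iff[OF u(1)] by auto
  have e: "link_end d l \<in> verts I" "link_end (\<not> d) l \<in> verts I" using ends by (auto simp: link_end_def)
  have ue: "u \<in> anc I (link_end d l)" using us by (simp add: side_eq)
  have ve: "v \<in> anc I (link_end d l)" using anc_trans[OF e(1) ue] vu by blast
  have "v \<notin> side d l"
  proof
    assume vs: "v \<in> side d l"
    have "v \<noteq> link_end d l" using anc_antisym[OF e(1) ue] vu by auto
    moreover have "v \<noteq> link_end (\<not> d) l" using vs e by (auto simp: side_eq)
    ultimately have "v \<in> inner (link_path I l)"
      using vs unfolding inner_link_path[OF ends] by (cases d) (auto simp: side_def link_end_def)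
    then have "\<not> cut_keep S l0 v" by (rule cut_inner[OF ends0 l0(2)])
    then show False using v vs shadow_mono(1)[OF ends0 sh0, of d] by (auto simp: cut_keep_def)
  qed
  then have vf: "v \<in> anc I (link_end (\<not> d) l)" using ve by (simp add: side_eq)
  have "fcov I l \<subseteq> desc_arcs I v"
  proof
    fix a assume a: "a \<in> fcov I l"
    then have "a \<in> arcs I" by (simp add: fcov_def)
    then obtain d' t where t: "t \<in> dir_verts d'" "a = dir_arc d' t" using arc_cases by metis
    have ts: "t \<in> side d' l" using a fcov_iff[OF ends t(1)] t(2) by simp
    have e': "link_end d' l \<in> verts I" "link_end (\<not> d') l \<in> verts I" using ends by (auto simp: link_end_def)
    have v': "v \<in> anc I (link_end d' l)" "v \<in> anc I (link_end (\<not> d') l)" using ve vf by (cases d; cases d'; simp)+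
    have te: "t \<in> anc I (link_end d' l)" "t \<notin> anc I (link_end (\<not> d') l)" using ts by (auto simp: side_eq)
    have "t \<notin> anc I v" using anc_trans[OF e'(2) v'(2)] te by blast
    then have "v \<in> anc I t" "v \<noteq> t" using anc_chain[OF e'(1) v'(1) te(1)] v(2) by auto
    then show "a \<in> desc_arcs I v" using desc_arcs_iff[OF t(1)] t(2) by simp
  qed
  then show ?thesis by simp
qed simp

theorem guarantee_cut:
  assumes adm: "admissible \<epsilon> \<Delta> I x" and S: "cut_system (zeta2 \<epsilon> \<Delta>) (kpar \<epsilon> \<Delta>) x S"
  shows "guarantee \<epsilon> \<Delta> I x (cut S) (cut_points S)"
proof -
  have a: "0 < \<epsilon>" "\<epsilon> < 1" "0 < \<Delta>" "shadow_complete I" "cost_ratio I \<le> \<Delta>" "lp_feasible I x"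
    "\<And>a. a \<in> arcs I \<Longrightarrow> \<not> covered I x (zeta1 \<epsilon>) a"
    using adm by (auto simp: admissible_def)
  have nn: "\<And>l. l \<in> links I \<Longrightarrow> x l \<ge> 0" using a by (auto simp: lp_feasible_def)
  have SV: "S d \<subseteq> verts I - {root I}" for d using S by (auto simp: cut_system_def)
  have z1: "zeta1 \<epsilon> > 0" using a by (simp add: zeta1_def)
  have k0: "kpar \<epsilon> \<Delta> \<ge> 0" using a z1 by (simp add: kpar_def gamma_def zeta2_def)
  \<comment> \<open>The comparison of the thresholds uses \<Delta> \<ge> 1, which follows once there
    is a link.\<close>
  have z12: "zeta1 \<epsilon> \<le> zeta2 \<epsilon> \<Delta>" if L: "links I \<noteq> {}"
  proof -
    obtain l where "l \<in> links I" using L by blast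
    then have D1: "1 \<le> \<Delta>" using cost_ratio_bound(2)[OF a(5)] by blast
    have "\<epsilon> * (1 - \<epsilon>) \<le> 1 * 1" using a by (intro mult_mono) auto
    then have "\<epsilon> * (1 - \<epsilon>) \<le> 6 * \<Delta>" using D1 by linarith
    then have "zeta1 \<epsilon> * (\<epsilon> * (1 - \<epsilon>)) \<le> zeta1 \<epsilon> * (6 * \<Delta>)" using z1 by (intro mult_left_mono) auto
    moreover have "\<epsilon> * (1 - \<epsilon>) > 0" using a by simp
    ultimately show ?thesis unfolding zeta2_def by (simp add: pos_le_divide_eq mult_ac)
  qed
  \<comment> \<open>In the direction in which its parent arc is covered, every vertex is light: its
    load there is the coverage of the arc. Feasibility at that arc also supplies a link.\<close>
  have fwd: "mass x d v < zeta2 \<epsilon> \<Delta>" if v: "v \<in> dir_verts d" for d v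
  proof -
    have "links I \<noteq> {}" using feasible_mass[OF a(6) v] by (auto simp: mass_def)
    moreover have "mass x d v < zeta1 \<epsilon>"
      using a(7)[OF dir_vertsD(2)[OF v]] by (simp add: covered_def mass_def covered_mass(1)[OF v])
    ultimately show ?thesis using z12 by simp
  qed
  have indep: "up_independent I (supp I (split I x (cut S))) v \<or> down_independent I (supp I (split I x (cut S))) v"
    if v: "v \<in> cut_points S" for v
  proof -
    consider "v = root I" | "v \<in> S False" | "v \<in> S True" using v by (auto simp: cut_points_def)
    then show ?thesis
    proof cases
      case 1
      have "fcov I l \<subseteq> desc_arcs I (root I)" for l
      proof
        fix a assume "a \<in> fcov I l"
        then have "a \<in> arcs I" by (simp add: fcov_def)
        then obtain d s where s: "s \<in> dir_verts d" "a = dir_arc d s" using arc_cases by metis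
        then show "a \<in> desc_arcs I (root I)" using desc_arcs_iff[OF s(1)] dir_vertsD(1)[OF s(1)] by auto
      qed
      then show ?thesis using 1 by (auto simp: up_independent_def)
    next
      case 2
      then show ?thesis using cut_independent[of x v S False, OF nn 2] SV[of False]
        by (auto simp: up_independent_def up_arcs_eq dir_arcs_def)
    next
      case 3
      then show ?thesis using cut_independent[of x v S True, OF nn 3] SV[of True]
        by (auto simp: down_independent_def down_arcs_eq dir_arcs_def)
    qed
  qed
  have width: "small_visible_width \<epsilon> \<Delta> I (split I x (cut S)) (supp I (split I (split I x (cut S)) \<sigma>))"
    if \<sigma>: "splitting I \<sigma>"
      and cross: "\<forall>l\<in>links I. cross_link I (cut_points S) l \<longrightarrow> (\<forall>l'\<in>\<sigma> l. up_link I l' \<or> down_link I l')"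
    for \<sigma>
  proof -
    let ?L = "supp I (split I (split I x (cut S)) \<sigma>)"
    note B = viwidth_bound[OF nn S k0 \<sigma> cross]
    have sp: "splitting I (cut S)" by (rule splitting_cut[OF a(4)])
    have 1: "viwidth_fwd I ?L v \<le> kpar \<epsilon> \<Delta>"
      "\<not> heavy I (split I x (cut S)) (zeta2 \<epsilon> \<Delta>) (parent_arc I v) \<Longrightarrow> viwidth_bwd I ?L v \<le> kpar \<epsilon> \<Delta>"
      if v: "v \<in> verts I - {root I}" for v
    proof -
      obtain d where d: "v \<in> dir_verts d" using dir_verts_cover[OF v] by blast
      \<comment> \<open>Flag \<open>False\<close> stands for up-arcs, so the forward width at
        \<open>v\<close> is \<open>viwidth d\<close> for the \<open>d\<close> with \<open>v\<close>
        in \<open>dir_verts d\<close>, and the backward width has the opposite flag.\<close>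
      have up: "parent_arc I v \<in> up_arcs I \<longleftrightarrow> \<not> d"
        using d dir_arc_eq_iff[OF v] dir_vertsD(1)[of _ False]
        by (auto simp: parent_arc_dir[OF d] up_arcs_eq image_iff)
      have fw: "viwidth_fwd I ?L v = viwidth d ?L v" and bw: "viwidth_bwd I ?L v = viwidth (\<not> d) ?L v"
        using up by (cases d; simp add: viwidth_fwd_def viwidth_bwd_def viwidth_def)+
      show "viwidth_fwd I ?L v \<le> kpar \<epsilon> \<Delta>"
        unfolding fw by (rule B) (use v fwd[OF d] in auto)
      assume "\<not> heavy I (split I x (cut S)) (zeta2 \<epsilon> \<Delta>) (parent_arc I v)"
      then have "mass x (\<not> d) v < zeta2 \<epsilon> \<Delta>"
        unfolding parent_arc_dir[OF d] using heavy_split[of x "cut S" v d "zeta2 \<epsilon> \<Delta>", OF nn sp d] by blast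
      then show "viwidth_bwd I ?L v \<le> kpar \<epsilon> \<Delta>"
        unfolding bw by (intro B) (use v in auto)
    qed
    have "viwidth_up I ?L (root I) \<le> kpar \<epsilon> \<Delta>" "viwidth_down I ?L (root I) \<le> kpar \<epsilon> \<Delta>"
      using B[of "root I" False] B[of "root I" True] by (auto simp: viwidth_def)
    then show ?thesis using 1 by (simp add: small_visible_width_def)
  qed
  show ?thesis
    unfolding guarantee_def Let_def
    using splitting_cut[OF a(4)] SV cost_cut[OF adm S] indep width
    by (auto simp: cut_points_def)
qed

end

section \<open>The algorithm\<close>

definition known :: "'v \<Rightarrow> ('v \<times> 'v) list \<Rightarrow> 'v \<Rightarrow> bool" where
  "known r ps w \<longleftrightarrow> w = r \<or> w \<in> set (map fst ps)"

text \<open>One step of a graph search: an arc with exactly one known endpoint attaches the other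
  endpoint below it. New pairs go to the front, so parents end up behind their children.\<close>

definition scan :: "'v \<Rightarrow> 'v \<times> 'v \<Rightarrow> ('v \<times> 'v) list \<Rightarrow> ('v \<times> 'v) list" where
  "scan r e ps =
     (if known r ps (fst e) \<and> \<not> known r ps (snd e) then (snd e, fst e) # ps
      else if known r ps (snd e) \<and> \<not> known r ps (fst e) then e # ps else ps)"

text \<open>Pairs of a vertex and its parent, every vertex before its ancestors.\<close>

definition parent_list :: "'v list \<Rightarrow> ('v \<times> 'v) list \<Rightarrow> 'v \<Rightarrow> ('v \<times> 'v) list" where
  "parent_list vl al r = fold (scan r) (concat (map (\<lambda>_. al) vl)) []"

text \<open>The accumulator is the current vertex with the reversed path so far. One pass over the
  list suffices because the entry of a parent comes after those of its children.\<close>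

definition rpath_step :: "'v \<times> 'v \<Rightarrow> 'v \<times> 'v list \<Rightarrow> 'v \<times> 'v list" where
  "rpath_step e acc = (if fst e = fst acc then (snd e, snd e # snd acc) else acc)"

definition rpath :: "('v \<times> 'v) list \<Rightarrow> 'v \<Rightarrow> 'v list" where
  "rpath ps v = rev (snd (fold rpath_step ps (v, [v])))"

text \<open>Only arcs pointing away from the root are tested; the other direction is obtained by
  passing the list of arcs reversed. Likewise \<open>mass_list\<close> is to be given swapped
  links.\<close>

definition reach_list :: "('v \<times> 'v) list \<Rightarrow> ('v \<times> 'v) list \<Rightarrow> 'v list \<Rightarrow> 'v \<Rightarrow> 'v list" where
  "reach_list ps al S v = map fst (filter (\<lambda>e. (snd e, fst e) \<in> set al \<and>
     v \<in> set (rpath ps (fst e)) \<and> v \<noteq> fst e \<and>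
     (\<forall>s\<in>set (rpath ps (fst e)). \<not> (v \<in> set (rpath ps s) \<and> s \<noteq> fst e \<and> s \<noteq> v \<and> s \<in> set S))) ps)"

definition front_list :: "('v \<times> 'v) list \<Rightarrow> ('v \<times> 'v) list \<Rightarrow> 'v list \<Rightarrow> 'v \<Rightarrow> 'v list" where
  "front_list ps al S v = filter (\<lambda>u. \<forall>u'\<in>set (reach_list ps al S v).
     \<not> (u \<in> set (rpath ps u') \<and> u' \<noteq> u)) (reach_list ps al S v)"

definition mass_list :: "('v \<times> 'v) list \<Rightarrow> (('v \<times> 'v) \<times> rat) list \<Rightarrow> 'v \<Rightarrow> rat" where
  "mass_list ps xs v = sum_list (map snd (filter (\<lambda>y. v \<in> set (rpath ps (fst (fst y))) \<and>
     v \<notin> set (rpath ps (snd (fst y)))) xs))"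

definition cut_fold :: "('v \<Rightarrow> 'v list \<Rightarrow> bool) \<Rightarrow> ('v \<times> 'v) list \<Rightarrow> 'v list" where
  "cut_fold Q ps = fold (\<lambda>e S. if Q (fst e) S then fst e # S else S) ps []"

definition cut_list :: "('v \<times> 'v) list \<Rightarrow> ('v \<times> 'v) list \<Rightarrow> (('v \<times> 'v) \<times> rat) list \<Rightarrow> rat \<Rightarrow> rat \<Rightarrow> 'v list" where
  "cut_list ps al xs \<zeta> k =
     cut_fold (\<lambda>v S. mass_list ps xs v < \<zeta> \<and> k < of_nat (length (front_list ps al S v))) ps"

definition asc_list :: "('v \<times> 'v) list \<Rightarrow> 'v \<Rightarrow> 'v \<Rightarrow> 'v list" where
  "asc_list ps a b = filter (\<lambda>s. s \<notin> set (rpath ps b)) (rpath ps a)"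

text \<open>The middle part has at most one element: the first vertex on the root path of one end
  that is an ancestor of the other end, which is the apex.\<close>

definition path_list :: "('v \<times> 'v) list \<Rightarrow> 'v \<times> 'v \<Rightarrow> 'v list" where
  "path_list ps l = asc_list ps (fst l) (snd l) @
     take (Suc 0) (filter (\<lambda>s. s \<in> set (rpath ps (snd l))) (rpath ps (fst l))) @
     rev (asc_list ps (snd l) (fst l))"

text \<open>The first component remembers the previous vertex as a list of length at most 1, empty
  at the start, so no partial head operation is needed.\<close>

definition steps_step :: "'v \<Rightarrow> 'v list \<times> ('v \<times> 'v) list \<Rightarrow> 'v list \<times> ('v \<times> 'v) list" where
  "steps_step b acc = ([b], map (\<lambda>a. (a, b)) (take (Suc 0) (fst acc)) @ snd acc)"

definition steps_list :: "'v list \<Rightarrow> ('v \<times> 'v) list" where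
  "steps_list p = snd (fold steps_step p ([], []))"

definition pieces :: "('v \<times> 'v) list \<Rightarrow> 'v list \<Rightarrow> 'v list \<Rightarrow> 'v \<times> 'v \<Rightarrow> ('v \<times> 'v) list" where
  "pieces ps SU SD l = steps_list (filter (\<lambda>w. w = fst l \<or> w = snd l \<or>
     (w \<in> set SU \<and> w \<in> set (asc_list ps (fst l) (snd l))) \<or>
     (w \<in> set SD \<and> w \<in> set (asc_list ps (snd l) (fst l)))) (path_list ps l))"

text \<open>A structurally recursive form of \<open>rpath\<close> for inductions;
  \<open>rpath\<close> itself is a fold so that it can be turned into a loop.\<close>

primrec root_walk :: "('v \<times> 'v) list \<Rightarrow> 'v \<Rightarrow> 'v list" where
  "root_walk [] v = [v]"
| "root_walk (e # ps) v = (if fst e = v then v # root_walk ps (snd e) else root_walk ps v)"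

lemma rpath_eq: "rpath ps v = root_walk ps v"
proof -
  have "snd (fold rpath_step ps (v, v # acc)) = rev (root_walk ps v) @ acc" for acc
    by (induction ps arbitrary: v acc) (auto simp: rpath_step_def)
  from this[of "[]"] show ?thesis by (simp add: rpath_def)
qed

lemma set_steps_list: "set (steps_list p) = steps p"
proof -
  have *: "set (snd (fold steps_step p ([a], out))) = steps (a # p) \<union> set out" for p a out
  proof (induction p arbitrary: a out)
    case (Cons b p)
    then show ?case using steps_Cons[of "b # p" a] by (simp add: steps_step_def)
  qed simp
  show ?thesis
  proof (cases p)
    case (Cons a q)
    then show ?thesis using *[of q a "[]"] by (simp add: steps_list_def steps_step_def)
  qed (simp add: steps_list_def)
qed

section \<open>Correctness of the tree search and of the bottom-up choice\<close>

context wdtap_tree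
begin

text \<open>The invariant of the search: each entry attaches a vertex unknown so far to one already
  known.\<close>

primrec parent_chain :: "('v \<times> 'v) list \<Rightarrow> bool" where
  "parent_chain [] = True"
| "parent_chain (e # ps) = (parent_chain ps \<and> adj (arcs I) (fst e) (snd e) \<and>
     known (root I) ps (snd e) \<and> \<not> known (root I) ps (fst e))"

lemma parent_chain_known:
  "parent_chain ps \<Longrightarrow> known (root I) ps v \<Longrightarrow>
    v \<in> verts I \<and> anc I v \<subseteq> {w. known (root I) ps w} \<and> rpath ps v = root_path I v"
  unfolding rpath_eq
proof (induction ps arbitrary: v)
  case Nil
  then show ?case by (simp add: known_def)
next
  case (Cons e ps)
  obtain b a where e: "e = (b, a)" by (cases e)
  have pc: "parent_chain ps" and adj: "adj (arcs I) b a" and ka: "known (root I) ps a" and kb: "\<not> known (root I) ps b"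
    using Cons.prems e by auto
  note IHa = Cons.IH[OF pc ka]
  have b: "b \<noteq> root I" "b \<in> verts I" using kb adj adj_verts by (auto simp: known_def)
  \<comment> \<open>Otherwise \<open>b\<close> would be the parent of \<open>a\<close>; but the
    ancestors of the known vertex \<open>a\<close> are known and \<open>b\<close> is not.\<close>
  have "a = parent I b"
  proof (rule ccontr)
    assume "a \<noteq> parent I b"
    then have a: "a \<noteq> root I" "b = parent I a" using adj_parent[OF adj] by auto
    then have "b \<in> anc I a" using anc_parent[of a] anc_self[of "parent I a"] parent_path(2)[of a] IHa by auto
    then show False using IHa kb by auto
  qed
  note pb = parent_path(1)[OF b(2,1)] anc_parent[OF b(2,1)]
  have mono: "known (root I) (e # ps) w" if "known (root I) ps w" for w
    using that by (auto simp: known_def)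
  show ?case
  proof (cases "v = b")
    case True
    then show ?thesis using b pb IHa mono e \<open>a = parent I b\<close> by (auto simp: known_def)
  next
    case False
    then have "known (root I) ps v" using Cons.prems(2) e by (auto simp: known_def)
    from Cons.IH[OF pc this] show ?thesis using False e mono by auto
  qed
qed

lemma parent_chain_distinct: "parent_chain ps \<Longrightarrow> distinct (map fst ps) \<and> root I \<notin> set (map fst ps)"
  by (induction ps) (auto simp: known_def)

lemma parent_chain_pair: "parent_chain ps \<Longrightarrow> e \<in> set ps \<Longrightarrow> fst e \<in> verts I - {root I} \<and> snd e = parent I (fst e)"
proof (induction ps)
  case (Cons f ps)
  show ?case
  proof (cases "e \<in> set ps")
    case False
    then have e: "e = f" using Cons.prems by simp
    have "known (root I) (f # ps) (fst f)" by (simp add: known_def)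
    from parent_chain_known[OF Cons.prems(1) this]
    have f: "fst f \<in> verts I" "rpath (f # ps) (fst f) = root_path I (fst f)" by auto
    have nr: "fst f \<noteq> root I" using Cons.prems(1) by (auto simp: known_def)
    have "rpath ps (snd f) = root_path I (snd f)" "snd f \<in> verts I"
      using parent_chain_known[of ps "snd f"] Cons.prems(1) by auto
    then have "root_path I (fst f) = fst f # root_path I (snd f)" using f by (simp add: rpath_eq)
    moreover have "root_path I (snd f) = snd f # tl (root_path I (snd f))"
      using root_path[OF \<open>snd f \<in> verts I\<close>] by (cases "root_path I (snd f)") (auto simp: simple_path_def)
    ultimately have "root_path I (fst f) ! 1 = snd f" by (metis One_nat_def nth_Cons_0 nth_Cons_Suc)
    then show ?thesis using f nr e by (auto simp: parent_def)
  qed (use Cons in auto)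
qed simp

lemma scan_cases: "scan r e ps = ps \<or> length (scan r e ps) = Suc (length ps)"
  by (simp add: scan_def)

lemma fold_scan_length: "length ps \<le> length (fold (scan r) es ps)"
proof (induction es arbitrary: ps)
  case (Cons e es)
  show ?case using Cons.IH[of "scan r e ps"] scan_cases[of r e ps] by auto
qed simp

text \<open>A scan step never shortens the list, so if the final length is unchanged then no step
  changed anything.\<close>

lemma fold_scan_stable:
  "length (fold (scan r) es ps) = length ps \<Longrightarrow> e \<in> set es \<Longrightarrow> scan r e ps = ps"
proof (induction es arbitrary: ps)
  case (Cons f es)
  have "scan r f ps = ps"
    using scan_cases[of r f ps] fold_scan_length[of "scan r f ps" r es] Cons.prems(1) by auto
  then show ?case using Cons by auto
qed simp

lemma parent_chain_scan:
  assumes "parent_chain ps" "e \<in> arcs I" shows "parent_chain (scan (root I) e ps)"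
  using assms by (cases e) (auto simp: scan_def adj_def)

lemma parent_chain_fold: "parent_chain ps \<Longrightarrow> set es \<subseteq> arcs I \<Longrightarrow> parent_chain (fold (scan (root I)) es ps)"
  by (induction es arbitrary: ps) (auto simp: parent_chain_scan)

lemma stable_known_all:
  assumes "\<And>e. e \<in> arcs I \<Longrightarrow> scan (root I) e ps = ps" "v \<in> verts I"
  shows "known (root I) ps v"
proof -
  have "(adj (arcs I))\<^sup>*\<^sup>* (root I) v"
    using rooted assms(2) by (auto simp: rooted_wdtap_def oriented_tree_def)
  then show ?thesis
  proof induction
    case base
    show ?case by (simp add: known_def)
  next
    case (step y z)
    have "scan (root I) (y, z) ps = ps \<or> scan (root I) (z, y) ps = ps"
      using step.hyps(2) assms(1) by (auto simp: adj_def)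
    then show ?case using step.IH by (auto simp: scan_def split: if_splits)
  qed
qed

text \<open>One round over the arcs for each entry of \<open>vl\<close> is enough, since a round
  that adds nothing has reached everything by connectivity.\<close>

lemma parent_list_correct:
  assumes vl: "set vl = verts I" and al: "set al = arcs I"
  shows "parent_chain (parent_list vl al (root I))" "set (map fst (parent_list vl al (root I))) = verts I - {root I}"
proof -
  let ?ps = "\<lambda>n. fold (scan (root I)) (concat (replicate n al)) []"
  have sub: "set (concat (replicate n al)) \<subseteq> arcs I" for n using al by auto
  have pc: "parent_chain (?ps n)" for n by (rule parent_chain_fold[OF _ sub]) simp
  have eq: "parent_list vl al (root I) = ?ps (length vl)"
    by (simp add: parent_list_def map_replicate_const)
  show "parent_chain (parent_list vl al (root I))" unfolding eq by (rule pc)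
  have in_verts: "set (map fst (?ps n)) \<subseteq> verts I - {root I}" for n
    using parent_chain_pair[OF pc[of n]] by fastforce
  have grow: "n \<le> length (?ps n) \<or> (\<forall>v\<in>verts I. known (root I) (?ps n) v)" for n
  proof (induction n)
    case (Suc n)
    have "replicate (Suc n) al = replicate n al @ [al]" by (simp add: replicate_append_same)
    then have st: "?ps (Suc n) = fold (scan (root I)) al (?ps n)"
      by (simp del: replicate_Suc)
    show ?case
    proof (cases "length (?ps (Suc n)) = length (?ps n)")
      case True
      then have stab: "scan (root I) e (?ps n) = ?ps n" if "e \<in> arcs I" for e
        using fold_scan_stable[of "root I" al "?ps n" e] st that al by simp
      then have "fold (scan (root I)) es (?ps n) = ?ps n" if "set es \<subseteq> arcs I" for es
        using that by (induction es) auto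
      then have "?ps (Suc n) = ?ps n" using st al by simp
      then show ?thesis using stable_known_all[OF stab] by simp
    next
      case False
      then have lt: "length (?ps n) < length (?ps (Suc n))"
        using fold_scan_length[of "?ps n" "root I" al] st by simp
      show ?thesis
      proof (cases "n \<le> length (?ps n)")
        case True
        then show ?thesis using lt by linarith
      next
        case False
        then have k: "\<forall>v\<in>verts I. known (root I) (?ps n) v" using Suc by blast
        have "scan (root I) e (?ps n) = ?ps n" if "e \<in> arcs I" for e
          using k that arcs_verts by (auto simp: scan_def)
        then have "fold (scan (root I)) es (?ps n) = ?ps n" if "set es \<subseteq> arcs I" for es
          using that by (induction es) auto
        then show ?thesis using st al lt by simp
      qed
    qed
  qed simp
  \<comment> \<open>Otherwise \<open>length vl\<close> rounds would have found at least that many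
    distinct non-root vertices, more than exist.\<close>
  have "\<forall>v\<in>verts I. known (root I) (?ps (length vl)) v"
  proof (rule ccontr)
    assume "\<not> ?thesis"
    then have "length vl \<le> length (?ps (length vl))" using grow[of "length vl"] by blast
    also have "\<dots> = card (set (map fst (?ps (length vl))))"
      using parent_chain_distinct[OF pc] by (metis distinct_card length_map)
    also have "\<dots> \<le> card (verts I - {root I})" by (rule card_mono[OF _ in_verts]) simp
    also have "\<dots> < card (verts I)" by (rule card_Diff1_less) simp_all
    also have "\<dots> \<le> length vl" using card_length[of vl] vl by simp
    finally show False by simp
  qed
  then show "set (map fst (parent_list vl al (root I))) = verts I - {root I}"
    unfolding eq using in_verts[of "length vl"] by (auto simp: known_def)
qed

text \<open>The loop decides \<open>v\<close> with the intermediate set \<open>S1\<close>, whereas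
  the fixed point asks about the final set. The two agree strictly below \<open>v\<close>, and the
  decision is assumed to depend on nothing else.\<close>

lemma cut_fold_correct:
  assumes pc: "parent_chain ps" and all: "set (map fst ps) = verts I - {root I}"
    and Q: "\<And>v S. v \<in> verts I \<Longrightarrow> Q v S \<longleftrightarrow> R v (set S)"
    and local: "\<And>v S S'. v \<in> verts I \<Longrightarrow> (\<And>s. s \<in> verts I \<Longrightarrow> v \<in> anc I s \<Longrightarrow> s \<noteq> v \<Longrightarrow> s \<in> S \<longleftrightarrow> s \<in> S') \<Longrightarrow> R v S \<Longrightarrow> R v S'"
  shows "v \<in> set (cut_fold Q ps) \<longleftrightarrow> v \<in> verts I - {root I} \<and> R v (set (cut_fold Q ps))"
proof -
  let ?g = "\<lambda>e S. if Q (fst e) S then fst e # S else S"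
  have sub: "set (fold ?g es S) \<subseteq> set S \<union> set (map fst es) \<and> set S \<subseteq> set (fold ?g es S)" for es S
  proof (induction es arbitrary: S)
    case (Cons e es)
    show ?case using Cons.IH[of "?g e S"] by (cases "Q (fst e) S") auto
  qed simp
  show ?thesis
  proof (cases "v \<in> verts I - {root I}")
    case False
    then show ?thesis using sub[of ps "[]"] all by (auto simp: cut_fold_def)
  next
    case True
    then have "v \<in> fst ` set ps" using all by simp
    then obtain e where e: "e \<in> set ps" "fst e = v" by blast
    obtain xs ys where ps: "ps = xs @ e # ys" using e(1) by (meson split_list)
    have d: "distinct (map fst ps)" using parent_chain_distinct[OF pc] by simp
    have pcy: "parent_chain (e # ys)" using pc unfolding ps by (induction xs) auto
    define S1 where "S1 = fold ?g xs []"
    have F: "cut_fold Q ps = fold ?g ys (?g e S1)" by (simp add: cut_fold_def ps S1_def)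
    have S1: "set S1 \<subseteq> set (map fst xs)" using sub[of xs "[]"] by (simp add: S1_def)
    have iff1: "v \<in> set (cut_fold Q ps) \<longleftrightarrow> Q v S1"
    proof
      assume "Q v S1"
      then show "v \<in> set (cut_fold Q ps)" unfolding F using sub[of ys "?g e S1"] e by auto
    next
      assume v: "v \<in> set (cut_fold Q ps)"
      show "Q v S1"
      proof (rule ccontr)
        assume "\<not> Q v S1"
        then have "v \<in> set S1 \<union> set (map fst ys)" using v sub[of ys S1] e by (auto simp: F)
        then show False using S1 d e(2) by (auto simp: ps)
      qed
    qed
    have agree: "s \<in> set S1 \<longleftrightarrow> s \<in> set (cut_fold Q ps)" if s: "s \<in> verts I" "v \<in> anc I s" "s \<noteq> v" for s
    proof
      assume "s \<in> set S1"
      then show "s \<in> set (cut_fold Q ps)" using sub[of ys "?g e S1"] by (auto simp: F split: if_splits)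
    next
      assume "s \<in> set (cut_fold Q ps)"
      then have "s \<in> set S1 \<or> s = v \<or> s \<in> set (map fst ys)"
        using sub[of ys "?g e S1"] e by (auto simp: F split: if_splits)
      \<comment> \<open>Later entries cannot be descendants of \<open>v\<close>: a known vertex has
        only known ancestors, and \<open>v\<close> is not yet known in the tail
        \<open>ys\<close>.\<close>
      moreover have "s \<notin> set (map fst ys)"
      proof
        assume "s \<in> set (map fst ys)"
        then have "known (root I) ys s" by (simp add: known_def)
        then have "known (root I) ys v" using parent_chain_known[of ys s] pcy s by auto
        then show False using pcy e(2) by simp
      qed
      ultimately show "s \<in> set S1" using s by simp
    qed
    have vV: "v \<in> verts I" using True by simp
    have "R v (set S1) \<longleftrightarrow> R v (set (cut_fold Q ps))"
      using local[OF vV, of "set S1" "set (cut_fold Q ps)"] local[OF vV, of "set (cut_fold Q ps)" "set S1"] agree by blast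
    then show ?thesis using iff1 Q[OF vV] True by simp
  qed
qed

lemma reach_local:
  assumes "\<And>s. s \<in> verts I \<Longrightarrow> v \<in> anc I s \<Longrightarrow> s \<noteq> v \<Longrightarrow> s \<in> S \<longleftrightarrow> s \<in> S'"
  shows "reach S d v = reach S' d v"
proof -
  have "s \<in> S \<longleftrightarrow> s \<in> S'" if "u \<in> dir_verts d" "s \<in> anc I u" "v \<in> anc I s" "s \<noteq> v" for u s
    using assms that anc_verts[of u] dir_vertsD(1)[OF that(1)] by auto
  then show ?thesis by (auto simp: reach_def)
qed

lemma front_local:
  assumes "\<And>s. s \<in> verts I \<Longrightarrow> v \<in> anc I s \<Longrightarrow> s \<noteq> v \<Longrightarrow> s \<in> S \<longleftrightarrow> s \<in> S'"
  shows "front S d v = front S' d v"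
  using reach_local[of v S S' d, OF assms] by (simp add: front_def)

text \<open>The same fold serves as recursion along the tree for arbitrary vertex types and real
  weights; the lists come from finiteness.\<close>

lemma cut_system_exists: "\<exists>S. cut_system \<zeta> k x S"
proof -
  obtain vl al where vl: "set vl = verts I" and al: "set al = arcs I"
    using finite_list[OF finite_verts] finite_list[OF finite_arcs] by blast
  note ps = parent_list_correct[OF vl al]
  define S where "S d = set (cut_fold (\<lambda>v S. mass x d v < \<zeta> \<and> k < card (front (set S) d v)) (parent_list vl al (root I)))" for d
  have "cut_system \<zeta> k x S"
    unfolding cut_system_def
  proof (intro allI)
    fix d v
    show "v \<in> S d \<longleftrightarrow> v \<in> verts I - {root I} \<and> mass x d v < \<zeta> \<and> k < card (front (S d) d v)"
      unfolding S_def
      by (rule cut_fold_correct[OF ps, where R = "\<lambda>v S. mass x d v < \<zeta> \<and> k < card (front S d v)"])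
        (simp, metis front_local)
  qed
  then show ?thesis by blast
qed

subsection \<open>Correctness of the list functions\<close>

context
  fixes ps
  assumes pc: "parent_chain ps" and all: "set (map fst ps) = verts I - {root I}"
begin

lemma rpath_correct: "v \<in> verts I \<Longrightarrow> rpath ps v = root_path I v"
  using parent_chain_known[OF pc, of v] all by (auto simp: known_def)

lemma set_rpath: "v \<in> verts I \<Longrightarrow> set (rpath ps v) = anc I v"
  by (simp add: rpath_correct anc_def)

lemma reach_list_correct:
  assumes al: "set al = (if d then arcs I else prod.swap ` arcs I)"
  shows "set (reach_list ps al S v) = reach (set S) d v" "distinct (reach_list ps al S v)"
proof -
  have pe: "fst e \<in> verts I - {root I}" "snd e = parent I (fst e)" if "e \<in> set ps" for e
    using parent_chain_pair[OF pc that] by auto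
  have T: "(snd e, fst e) \<in> set al \<longleftrightarrow> fst e \<in> dir_verts d" if "e \<in> set ps" for e
    using pe[OF that] al by (auto simp: dir_verts_def dir_arc_def)
  have set_eq: "set ps = (\<lambda>u. (u, parent I u)) ` (verts I - {root I})"
  proof (intro equalityI subsetI)
    fix e assume e: "e \<in> set ps"
    have "e = (fst e, parent I (fst e))" using pe(2)[OF e] by (simp add: prod_eq_iff)
    then show "e \<in> (\<lambda>u. (u, parent I u)) ` (verts I - {root I})" using pe(1)[OF e] by (rule image_eqI)
  next
    fix e assume "e \<in> (\<lambda>u. (u, parent I u)) ` (verts I - {root I})"
    then obtain u where u: "u \<in> verts I - {root I}" "e = (u, parent I u)" by blast
    then have "u \<in> fst ` set ps" using all by simp
    then obtain f where f: "f \<in> set ps" "fst f = u" by blast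
    have "f = e" using pe(2)[OF f(1)] f(2) u(2) by (simp add: prod_eq_iff)
    then show "e \<in> set ps" using f(1) by simp
  qed
  have cond: "((snd e, fst e) \<in> set al \<and>
     v \<in> set (rpath ps (fst e)) \<and> v \<noteq> fst e \<and>
     (\<forall>s\<in>set (rpath ps (fst e)). \<not> (v \<in> set (rpath ps s) \<and> s \<noteq> fst e \<and> s \<noteq> v \<and> s \<in> set S)))
     \<longleftrightarrow> fst e \<in> reach (set S) d v" if "e \<in> set ps" for e
  proof -
    have "fst e \<in> verts I" using pe[OF that] by simp
    moreover from this have "set (rpath ps s) = anc I s" if "s \<in> anc I (fst e)" for s
      using anc_verts[of "fst e"] that set_rpath by blast
    ultimately show ?thesis unfolding T[OF that] by (auto simp: reach_def set_rpath)
  qed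
  have "set (reach_list ps al S v) = fst ` {e \<in> set ps. fst e \<in> reach (set S) d v}"
    unfolding reach_list_def set_map set_filter using cond by blast
  also have "\<dots> = reach (set S) d v"
    unfolding set_eq by (auto simp: reach_def dir_verts_def image_iff)
  finally show "set (reach_list ps al S v) = reach (set S) d v" .
  show "distinct (reach_list ps al S v)"
    using parent_chain_distinct[OF pc] by (auto simp: reach_list_def intro: distinct_map_filter)
qed

lemma front_list_correct:
  assumes al: "set al = (if d then arcs I else prod.swap ` arcs I)"
  shows "length (front_list ps al S v) = card (front (set S) d v)"
proof -
  have "u' \<in> verts I" if "u' \<in> reach (set S) d v" for u'
    using that by (auto simp: reach_def dir_verts_def)
  then have "set (front_list ps al S v) = front (set S) d v"
    unfolding front_list_def front_def set_filter reach_list_correct(1)[OF al] by (auto simp: set_rpath)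
  moreover have "distinct (front_list ps al S v)"
    unfolding front_list_def by (rule distinct_filter[OF reach_list_correct(2)[OF al]])
  ultimately show ?thesis by (metis distinct_card)
qed

text \<open>Swapping links and flags reduces both directions to one list expression; distinctness of
  the links turns the list sum into a sum over a set.\<close>

lemma mass_list_correct:
  assumes L: "distinct (map fst L)" "set (map fst L) = links I"
    and x: "\<And>y. y \<in> set L \<Longrightarrow> x (fst y) = of_rat (snd y)"
    and xs: "xs = (if d then L else map (\<lambda>y. (prod.swap (fst y), snd y)) L)"
  shows "of_rat (mass_list ps xs v) = mass x d v"
proof -
  have side: "(v \<in> set (rpath ps (link_end d l)) \<and> v \<notin> set (rpath ps (link_end (\<not> d) l))) \<longleftrightarrow> v \<in> side d l"
    if "l \<in> links I" for l
    using link_end_verts[OF that] by (simp add: side_eq set_rpath)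
  have "mass_list ps xs v = sum_list (map snd (filter (\<lambda>y. v \<in> set (rpath ps (link_end d (fst y))) \<and>
     v \<notin> set (rpath ps (link_end (\<not> d) (fst y)))) L))"
    unfolding mass_list_def xs by (cases d) (simp_all add: filter_map o_def link_end_def)
  also have "\<dots> = sum_list (map snd (filter (\<lambda>y. v \<in> side d (fst y)) L))"
  proof (intro arg_cong[where f = "\<lambda>zs. sum_list (map snd zs)"] filter_cong refl)
    fix y assume "y \<in> set L"
    then have "fst y \<in> links I" using L(2) by auto
    then show "(v \<in> set (rpath ps (link_end d (fst y))) \<and> v \<notin> set (rpath ps (link_end (\<not> d) (fst y))))
      \<longleftrightarrow> v \<in> side d (fst y)" by (rule side)
  qed
  also have "of_rat \<dots> = sum_list (map (\<lambda>y. x (fst y)) (filter (\<lambda>y. v \<in> side d (fst y)) L))"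
    using x by (induction L) (auto simp: of_rat_add)
  also have "\<dots> = sum_list (map x (map fst (filter (\<lambda>y. v \<in> side d (fst y)) L)))"
    by (simp add: o_def)
  also have "map fst (filter (\<lambda>y. v \<in> side d (fst y)) L) = filter (\<lambda>l. v \<in> side d l) (map fst L)"
    by (simp add: filter_map o_def)
  also have "sum_list (map x \<dots>) = sum x (set (filter (\<lambda>l. v \<in> side d l) (map fst L)))"
    by (rule sum_list_distinct_conv_sum_set) (rule distinct_filter[OF L(1)])
  also have "set (filter (\<lambda>l. v \<in> side d l) (map fst L)) = {l \<in> links I. v \<in> side d l}"
    using L(2) by auto
  finally show ?thesis by (simp add: mass_def)
qed

lemma cut_list_correct:
  assumes al: "set al = (if d then arcs I else prod.swap ` arcs I)"
    and L: "distinct (map fst L)" "set (map fst L) = links I"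
    and x: "\<And>y. y \<in> set L \<Longrightarrow> x (fst y) = of_rat (snd y)"
    and xs: "xs = (if d then L else map (\<lambda>y. (prod.swap (fst y), snd y)) L)"
  shows "v \<in> set (cut_list ps al xs \<zeta> k) \<longleftrightarrow> v \<in> verts I - {root I} \<and>
    mass x d v < of_rat \<zeta> \<and> of_rat k < card (front (set (cut_list ps al xs \<zeta> k)) d v)"
  unfolding cut_list_def
proof (rule cut_fold_correct[OF pc all, where R = "\<lambda>v S. mass x d v < of_rat \<zeta> \<and> of_rat k < card (front S d v)"])
  fix v S
  have "mass x d v = of_rat (mass_list ps xs v)" using mass_list_correct[OF L x xs, of v] by simp
  moreover have "k < rat_of_nat n \<longleftrightarrow> real_of_rat k < real n" for n
    by (metis of_rat_less of_rat_of_nat_eq)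
  ultimately show "(mass_list ps xs v < \<zeta> \<and> k < of_nat (length (front_list ps al S v))) \<longleftrightarrow>
    mass x d v < of_rat \<zeta> \<and> of_rat k < card (front (set S) d v)"
    by (simp add: front_list_correct[OF al] of_rat_less)
qed (metis front_local)

lemma path_list_correct:
  assumes "fst l \<in> verts I" "snd l \<in> verts I"
  shows "path_list ps l = link_path I l" "set (asc_list ps (fst l) (snd l)) = side True l"
    "set (asc_list ps (snd l) (fst l)) = side False l"
proof -
  obtain xs ys w where d: "root_path I (fst l) = xs @ root_path I w"
    "root_path I (snd l) = ys @ root_path I w" "w \<in> verts I"
    "set xs = asc I (fst l, snd l)" "set ys = asc I (snd l, fst l)"
    "anc I (fst l) \<inter> anc I (snd l) = anc I w"
    "link_path I (fst l, snd l) = xs @ w # rev ys"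
    using path_decomp[OF assms] by metis
  have w: "set (root_path I w) = anc I w" "take (Suc 0) (root_path I w) = [w]"
    using root_path[OF d(3)] by (cases "root_path I w"; auto simp: anc_def simple_path_def)+
  have wa: "anc I w \<subseteq> anc I (fst l)" "anc I w \<subseteq> anc I (snd l)" using d(6) by auto
  have A: "asc_list ps (fst l) (snd l) = xs"
    unfolding asc_list_def set_rpath[OF assms(2)] rpath_correct[OF assms(1)] d(1)
    using d(4) w wa by (auto simp: asc_def filter_empty_conv filter_id_conv)
  have B: "asc_list ps (snd l) (fst l) = ys"
    unfolding asc_list_def set_rpath[OF assms(1)] rpath_correct[OF assms(2)] d(2)
    using d(5) w wa by (auto simp: asc_def filter_empty_conv filter_id_conv)
  have e: "filter (\<lambda>s. s \<in> anc I (snd l)) xs = []" using d(4) by (auto simp: asc_def filter_empty_conv)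
  have e2: "filter (\<lambda>s. s \<in> anc I (snd l)) (root_path I w) = root_path I w" using w wa by (auto simp: filter_id_conv)
  have C: "take (Suc 0) (filter (\<lambda>s. s \<in> set (rpath ps (snd l))) (rpath ps (fst l))) = [w]"
    unfolding set_rpath[OF assms(2)] rpath_correct[OF assms(1)] d(1) using w e e2 by simp
  show "path_list ps l = link_path I l" using d(7) by (simp add: path_list_def A B C)
  show "set (asc_list ps (fst l) (snd l)) = side True l" "set (asc_list ps (snd l) (fst l)) = side False l"
    using A B d(4,5) by (simp_all add: side_def prod.swap_def)
qed

lemma pieces_correct:
  assumes "fst l \<in> verts I" "snd l \<in> verts I"
  shows "set (pieces ps SU SD l) = cut (\<lambda>d. if d then set SU else set SD) l"
proof -
  note P = path_list_correct[OF assms]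
  have "(\<exists>d. w \<in> (if d then set SU else set SD) \<inter> side d l) \<longleftrightarrow>
      (w \<in> set SU \<and> w \<in> side True l) \<or> (w \<in> set SD \<and> w \<in> side False l)" for w
    by (metis (full_types) IntD1 IntD2 IntI)
  then show ?thesis
    unfolding pieces_def set_steps_list P cut_def cut_keep_def by simp
qed

end

end

section \<open>Polynomial-time functions on encoded data\<close>

text \<open>Overloading the encoding lets the types determine it, so the closure rules for
  \<open>ptime\<close> can be selected by the shape of a function alone.\<close>

class encodable =
  fixes enc :: "'a \<Rightarrow> val"

instantiation nat :: encodable begin
definition enc_nat_class: "enc = enc_nat"
instance ..
end

instantiation rat :: encodable begin
definition enc_rat_class: "enc = Leaf"
instance ..
end

instantiation bool :: encodable begin
definition enc_bool_class: "enc = truth"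
instance ..
end

instantiation prod :: (encodable, encodable) encodable begin
definition enc_prod_class: "enc p = Node (enc (fst p)) (enc (snd p))"
instance ..
end

instantiation list :: (encodable) encodable begin
definition enc_list_class: "enc = enc_list enc"
instance ..
end

lemma enc_simps [simp]:
  "enc (a, b) = Node (enc a) (enc b)"
  "enc (q :: rat) = Leaf q"
  "enc (n :: nat) = Leaf (of_nat n)"
  "enc c = truth c"
  "enc [] = Leaf 0"
  "enc (x # xs) = Node (enc x) (enc xs)"
  by (simp_all add: enc_prod_class enc_rat_class enc_nat_class enc_nat_def enc_bool_class
      enc_list_class enc_list_def)

definition sz :: "'a::encodable \<Rightarrow> nat" where
  "sz a = val_size (enc a)"

lemma sz_simps [simp]:
  "sz (a, b) = Suc (sz a + sz b)"
  "sz (x # xs) = Suc (sz x + sz xs)"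
  by (simp_all add: sz_def)

lemma sz_pos: "1 \<le> sz a"
  unfolding sz_def by (cases "enc a") auto

lemma sz_Nil: "sz [] = 2"
  by (simp add: sz_def bits_def floorlog_def)

lemma sz_mem: "x \<in> set xs \<Longrightarrow> sz x < sz xs"
  by (induction xs) auto

lemma length_sz: "length xs \<le> sz xs"
  by (induction xs) auto

lemma sz_append: "sz (xs @ ys) \<le> sz xs + sz ys"
  by (induction xs) auto

subsection \<open>Polynomially bounded functions\<close>

text \<open>Bounds are arbitrary functions dominated by a polynomial, so that they can be written as
  ordinary arithmetic terms and composed freely.\<close>

definition poly_bounded :: "(nat \<Rightarrow> nat) \<Rightarrow> bool" where
  "poly_bounded b \<longleftrightarrow> (\<exists>q. \<forall>n. b n \<le> poly q n)"

lemma poly_nat_mono: "m \<le> n \<Longrightarrow> poly q m \<le> poly q n" for m n :: nat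
  by (induction q) (auto intro!: add_mono mult_mono)

lemma poly_bounded_poly: "poly_bounded b \<Longrightarrow> poly_bounded (\<lambda>n. poly q (b n))"
  unfolding poly_bounded_def by (metis poly_nat_mono poly_pcompose)

lemma poly_bounded_const: "poly_bounded (\<lambda>n. c)"
  unfolding poly_bounded_def by (rule exI[of _ "[:c:]"]) simp

lemma poly_bounded_id: "poly_bounded (\<lambda>n. n)"
  unfolding poly_bounded_def by (rule exI[of _ "[:0, 1:]"]) simp

lemma poly_bounded_add: "poly_bounded b \<Longrightarrow> poly_bounded c \<Longrightarrow> poly_bounded (\<lambda>n. b n + c n)"
  unfolding poly_bounded_def by (metis add_mono poly_add)

lemma poly_bounded_mult: "poly_bounded b \<Longrightarrow> poly_bounded c \<Longrightarrow> poly_bounded (\<lambda>n. b n * c n)"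
  unfolding poly_bounded_def by (metis mult_le_mono poly_mult)

lemmas poly_bounded_intros =
  poly_bounded_id poly_bounded_const poly_bounded_add poly_bounded_mult poly_bounded_poly

text \<open>\<open>P n\<close> takes its argument and returns its result in variable \<open>n\<close>, preserves the variables below \<open>n\<close>
  and assumes nothing about those above; this makes programs composable without renaming.\<close>

definition realizes :: "(nat \<Rightarrow> com) \<Rightarrow> nat poly \<Rightarrow> ('a::encodable \<Rightarrow> 'b::encodable) \<Rightarrow> bool" where
  "realizes P q f \<longleftrightarrow> (\<forall>n s a. s n = enc a \<longrightarrow>
     (\<exists>t s'. exec (P n) s t s' \<and> s' n = enc (f a) \<and> (\<forall>m<n. s' m = s m) \<and>
       t + sz (f a) \<le> poly q (sz a)))"

definition ptime :: "('a::encodable \<Rightarrow> 'b::encodable) \<Rightarrow> bool" where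
  "ptime f \<longleftrightarrow> (\<exists>P q. realizes P q f)"

lemma ptimeI:
  fixes f :: "'a::encodable \<Rightarrow> 'b::encodable"
  assumes "\<And>n s a. s n = enc a \<Longrightarrow>
      \<exists>t s'. exec (P n) s t s' \<and> s' n = enc (f a) \<and> (\<forall>m<n. s' m = s m) \<and> t + sz (f a) \<le> b (sz a)"
    and "poly_bounded b"
  shows "ptime f"
proof -
  obtain q where q: "\<And>n. b n \<le> poly q n" using assms(2) by (auto simp: poly_bounded_def)
  have "realizes P q f"
    unfolding realizes_def
  proof (intro allI impI)
    fix n :: nat and s :: state and a :: 'a assume "s n = enc a"
    from assms(1)[of s n a, OF this] q[of "sz a"]
    show "\<exists>t s'. exec (P n) s t s' \<and> s' n = enc (f a) \<and> (\<forall>m<n. s' m = s m) \<and> t + sz (f a) \<le> poly q (sz a)"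
      using le_trans by blast
  qed
  then show ?thesis by (auto simp: ptime_def)
qed

lemma realizesD:
  "realizes P q f \<Longrightarrow> s n = enc a \<Longrightarrow>
     \<exists>t s'. exec (P n) s t s' \<and> s' n = enc (f a) \<and> (\<forall>m<n. s' m = s m) \<and> t + sz (f a) \<le> poly q (sz a)"
  unfolding realizes_def by blast

lemma ptime_sz:
  assumes "ptime f"
  obtains q where "\<And>a. sz (f a) \<le> poly q (sz a)"
proof -
  obtain P q where "realizes P q f"
    using assms by (auto simp: ptime_def)
  note P = realizesD[OF this]
  have "sz (f a) \<le> poly q (sz a)" for a
    using P[of "\<lambda>_. enc a" 0 a] by auto
  then show ?thesis using that by blast
qed

lemma exp_cost_simps:
  "exp_cost (Var i) s = val_size (s i)"
  "exp_cost (Const r) s = val_size (Leaf r)"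
  "exp_cost (exp.Pair e e') s = val_size (eval (exp.Pair e e') s) + exp_cost e s + exp_cost e' s"
  "exp_cost (Left e) s = val_size (eval (Left e) s) + exp_cost e s"
  "exp_cost (Right e) s = val_size (eval (Right e) s) + exp_cost e s"
  "exp_cost (IsNode e) s = val_size (eval (IsNode e) s) + exp_cost e s"
  "exp_cost (Plus e e') s = val_size (eval (Plus e e') s) + exp_cost e s + exp_cost e' s"
  "exp_cost (Minus e e') s = val_size (eval (Minus e e') s) + exp_cost e s + exp_cost e' s"
  "exp_cost (Times e e') s = val_size (eval (Times e e') s) + exp_cost e s + exp_cost e' s"
  "exp_cost (Divide e e') s = val_size (eval (Divide e e') s) + exp_cost e s + exp_cost e' s"
  "exp_cost (Less e e') s = val_size (eval (Less e e') s) + exp_cost e s + exp_cost e' s"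
  by (simp_all add: exp_cost_def)

lemma eval_le_exp_cost: "val_size (eval e s) \<le> exp_cost e s"
  by (simp add: exp_cost_def)

text \<open>The cost of an expression already includes the size of its value, so one cost bound
  controls time and output size together.\<close>

lemma ptime_exp:
  fixes f :: "'a::encodable \<Rightarrow> 'b::encodable"
  assumes "\<And>n s a. s n = enc a \<Longrightarrow> eval (e n) s = enc (f a)"
    and "\<And>n s (a :: 'a). s n = enc a \<Longrightarrow> exp_cost (e n) s \<le> b (sz a)" and "poly_bounded b"
  shows "ptime f"
proof (rule ptimeI[where P = "\<lambda>n. Assign n (e n)"])
  fix n :: nat and s :: state and a :: 'a assume s: "s n = enc a"
  have "sz (f a) \<le> exp_cost (e n) s"
    using eval_le_exp_cost[of "e n" s] assms(1)[of s n a] s by (simp add: sz_def)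
  then have "exp_cost (e n) s + sz (f a) \<le> b (sz a) + b (sz a)"
    using assms(2)[of s n a] s by linarith
  then show "\<exists>t s'. exec (Assign n (e n)) s t s' \<and> s' n = enc (f a) \<and> (\<forall>m<n. s' m = s m) \<and>
     t + sz (f a) \<le> b (sz a) + b (sz a)"
    using assms(1)[of s n a] s exec.Assign[of n "e n" s]
    by (intro exI[of _ "exp_cost (e n) s"] exI[of _ "s(n := eval (e n) s)"]) simp
qed (intro poly_bounded_intros assms(3))

lemma ptime_id: "ptime (\<lambda>x. x)"
  by (rule ptime_exp[where e = Var and b = "\<lambda>n. n"])
    (auto simp: exp_cost_simps sz_def intro: poly_bounded_intros)

text \<open>The second program runs on the output of the first, and its bound is stated in the size
  of that output; this is why \<open>realizes\<close> limits \<open>t + sz (f a)\<close> and not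
  just the time.\<close>

lemma ptime_comp:
  fixes g :: "'c::encodable \<Rightarrow> 'a::encodable"
  assumes "ptime f" "ptime g"
  shows "ptime (\<lambda>x. f (g x))"
proof -
  obtain P p where "realizes P p g"
    using assms(2) by (auto simp: ptime_def)
  note P = realizesD[OF this]
  obtain Q q where "realizes Q q f"
    using assms(1) by (auto simp: ptime_def)
  note Q = realizesD[OF this]
  show ?thesis
  proof (rule ptimeI[where P = "\<lambda>n. Seq (P n) (Q n)" and b = "\<lambda>n. poly p n + poly q (poly p n)"])
    fix n :: nat and s :: state and a :: 'c assume "s n = enc a"
    from P[of s n a, OF this] obtain t s' where 1: "exec (P n) s t s'" "s' n = enc (g a)" "\<forall>m<n. s' m = s m"
      "t + sz (g a) \<le> poly p (sz a)" by blast
    from Q[of s' n "g a", OF 1(2)] obtain t' s'' where 2: "exec (Q n) s' t' s''" "s'' n = enc (f (g a))" "\<forall>m<n. s'' m = s' m"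
      "t' + sz (f (g a)) \<le> poly q (sz (g a))" by blast
    have "poly q (sz (g a)) \<le> poly q (poly p (sz a))" by (rule poly_nat_mono) (use 1(4) in simp)
    then show "\<exists>t s'. exec (Seq (P n) (Q n)) s t s' \<and> s' n = enc (f (g a)) \<and> (\<forall>m<n. s' m = s m) \<and>
      t + sz (f (g a)) \<le> poly p (sz a) + poly q (poly p (sz a))"
      using 1 2 by (intro exI[of _ "t + t'"] exI[of _ s'']) (auto intro: exec.Seq)
  qed (intro poly_bounded_intros)
qed

text \<open>The argument is copied upwards before each call. The call at \<open>n+1\<close> leaves
  the argument in \<open>n\<close> intact, and the call at \<open>n+2\<close> leaves the first
  result in \<open>n+1\<close> intact.\<close>

lemma ptime_pair:
  fixes f :: "'a::encodable \<Rightarrow> 'b::encodable"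
  assumes "ptime f" "ptime g"
  shows "ptime (\<lambda>x. (f x, g x))"
proof -
  obtain P p where "realizes P p f"
    using assms(1) by (auto simp: ptime_def)
  note P = realizesD[OF this]
  obtain Q q where "realizes Q q g"
    using assms(2) by (auto simp: ptime_def)
  note Q = realizesD[OF this]
  let ?C = "\<lambda>n. Seq (Assign (n+1) (Var n)) (Seq (P (n+1)) (Seq (Assign (n+2) (Var n)) (Seq (Q (n+2))
      (Assign n (exp.Pair (Var (n+1)) (Var (n+2)))))))"
  show ?thesis
  proof (rule ptimeI[where P = ?C and b = "\<lambda>n. 2 * n + 3 * poly p n + 3 * poly q n + 2"])
    fix n :: nat and s :: state and a :: 'a assume s: "s n = enc a"
    define s1 where "s1 = s(n+1 := eval (Var n) s)"
    have e1: "exec (Assign (n+1) (Var n)) s (exp_cost (Var n) s) s1" unfolding s1_def by (rule exec.Assign)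
    have "s1 (n+1) = enc a" using s by (simp add: s1_def)
    from P[of s1 "n+1" a, OF this] obtain t2 s2 where 2: "exec (P (n+1)) s1 t2 s2" "s2 (n+1) = enc (f a)" "\<forall>m<n+1. s2 m = s1 m"
      "t2 + sz (f a) \<le> poly p (sz a)" by blast
    define s3 where "s3 = s2(n+2 := eval (Var n) s2)"
    have e3: "exec (Assign (n+2) (Var n)) s2 (exp_cost (Var n) s2) s3" unfolding s3_def by (rule exec.Assign)
    have s2n: "s2 n = enc a" using 2(3) s by (simp add: s1_def)
    then have "s3 (n+2) = enc a" by (simp add: s3_def)
    from Q[of s3 "n+2" a, OF this] obtain t4 s4 where 4: "exec (Q (n+2)) s3 t4 s4" "s4 (n+2) = enc (g a)" "\<forall>m<n+2. s4 m = s3 m"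
      "t4 + sz (g a) \<le> poly q (sz a)" by blast
    have s4: "s4 (n+1) = enc (f a)" using 4(3) 2(2) by (simp add: s3_def)
    let ?e = "exp.Pair (Var (n+1)) (Var (n+2))"
    define s5 where "s5 = s4(n := eval ?e s4)"
    have e5: "exec (Assign n ?e) s4 (exp_cost ?e s4) s5" unfolding s5_def by (rule exec.Assign)
    have "exec (?C n) s (exp_cost (Var n) s + (t2 + (exp_cost (Var n) s2 + (t4 + exp_cost ?e s4)))) s5"
      by (rule exec.Seq[OF e1 exec.Seq[OF 2(1) exec.Seq[OF e3 exec.Seq[OF 4(1) e5]]]])
    moreover have "s5 n = enc (f a, g a)" using s4 4(2) by (simp add: s5_def)
    moreover have "\<forall>m<n. s5 m = s m" using 2(3) 4(3) by (simp add: s5_def s3_def s1_def)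
    moreover have "exp_cost (Var n) s + (t2 + (exp_cost (Var n) s2 + (t4 + exp_cost ?e s4))) + sz (f a, g a)
      \<le> 2 * sz a + 3 * poly p (sz a) + 3 * poly q (sz a) + 2"
      using 2(4) 4(4) s4 4(2) s s2n by (simp add: exp_cost_simps sz_def)
    ultimately show "\<exists>t s'. exec (?C n) s t s' \<and> s' n = enc (f a, g a) \<and> (\<forall>m<n. s' m = s m) \<and>
        t + sz (f a, g a) \<le> 2 * sz a + 3 * poly p (sz a) + 3 * poly q (sz a) + 2" by blast
  qed (intro poly_bounded_intros)
qed

lemma is_true_truth [simp]: "is_true (truth b) \<longleftrightarrow> b"
  by (simp add: is_true_def truth_def)

lemma ptime_if:
  fixes f :: "'a::encodable \<Rightarrow> 'b::encodable"
  assumes "ptime c" "ptime f" "ptime g"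
  shows "ptime (\<lambda>x. if c x then f x else g x)"
proof -
  obtain C r where "realizes C r c"
    using assms(1) by (auto simp: ptime_def)
  note C = realizesD[OF this]
  obtain P p where "realizes P p f"
    using assms(2) by (auto simp: ptime_def)
  note P = realizesD[OF this]
  obtain Q q where "realizes Q q g"
    using assms(3) by (auto simp: ptime_def)
  note Q = realizesD[OF this]
  let ?C = "\<lambda>n. Seq (Assign (n+1) (Var n)) (Seq (C (n+1)) (com.If (Var (n+1)) (P n) (Q n)))"
  show ?thesis
  proof (rule ptimeI[where P = ?C and b = "\<lambda>n. n + poly r n + poly p n + poly q n"])
    fix n :: nat and s :: state and a :: 'a assume s: "s n = enc a"
    define s1 where "s1 = s(n+1 := eval (Var n) s)"
    have e1: "exec (Assign (n+1) (Var n)) s (exp_cost (Var n) s) s1" unfolding s1_def by (rule exec.Assign)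
    have "s1 (n+1) = enc a" using s by (simp add: s1_def)
    from C[of s1 "n+1" a, OF this] obtain t2 s2 where 2: "exec (C (n+1)) s1 t2 s2" "s2 (n+1) = enc (c a)" "\<forall>m<n+1. s2 m = s1 m"
      "t2 + sz (c a) \<le> poly r (sz a)" by blast
    have s2n: "s2 n = enc a" using 2(3) s by (simp add: s1_def)
    have cost: "exp_cost (Var n) s = sz a" "exp_cost (Var (n+1)) s2 = sz (c a)"
      using s 2(2) by (simp_all add: exp_cost_simps sz_def)
    have fr: "\<forall>m<n. s2 m = s m" using 2(3) by (simp add: s1_def)
    show "\<exists>t s'. exec (?C n) s t s' \<and> s' n = enc (if c a then f a else g a) \<and> (\<forall>m<n. s' m = s m) \<and>
        t + sz (if c a then f a else g a) \<le> sz a + poly r (sz a) + poly p (sz a) + poly q (sz a)"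
    proof (cases "c a")
      case True
      from P[of s2 n a, OF s2n] obtain t4 s4 where 4: "exec (P n) s2 t4 s4" "s4 n = enc (f a)" "\<forall>m<n. s4 m = s2 m"
        "t4 + sz (f a) \<le> poly p (sz a)" by blast
      have "exec (com.If (Var (n+1)) (P n) (Q n)) s2 (exp_cost (Var (n+1)) s2 + t4) s4"
        by (rule exec.IfTrue[OF _ 4(1)]) (use 2(2) True in simp)
      then have "exec (?C n) s (exp_cost (Var n) s + (t2 + (exp_cost (Var (n+1)) s2 + t4))) s4"
        by (rule exec.Seq[OF e1 exec.Seq[OF 2(1)]])
      then show ?thesis using True 4 2(4) cost fr
        by (intro exI[of _ "exp_cost (Var n) s + (t2 + (exp_cost (Var (n+1)) s2 + t4))"] exI[of _ s4]) auto
    next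
      case False
      from Q[of s2 n a, OF s2n] obtain t4 s4 where 4: "exec (Q n) s2 t4 s4" "s4 n = enc (g a)" "\<forall>m<n. s4 m = s2 m"
        "t4 + sz (g a) \<le> poly q (sz a)" by blast
      have "exec (com.If (Var (n+1)) (P n) (Q n)) s2 (exp_cost (Var (n+1)) s2 + t4) s4"
        by (rule exec.IfFalse[OF _ 4(1)]) (use 2(2) False in simp)
      then have "exec (?C n) s (exp_cost (Var n) s + (t2 + (exp_cost (Var (n+1)) s2 + t4))) s4"
        by (rule exec.Seq[OF e1 exec.Seq[OF 2(1)]])
      then show ?thesis using False 4 2(4) cost fr
        by (intro exI[of _ "exp_cost (Var n) s + (t2 + (exp_cost (Var (n+1)) s2 + t4))"] exI[of _ s4]) auto
    qed
  qed (intro poly_bounded_intros)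
qed

subsection \<open>Loops over lists\<close>

text \<open>Variable \<open>n\<close> holds the fixed parameter, \<open>n+1\<close> the remaining
  list, \<open>n+2\<close> the accumulator and \<open>n+3\<close> the call of the step. A uniform
  size bound \<open>M\<close> for all intermediate accumulators gives every iteration the same cost
  bound.\<close>

lemma exec_fold_loop:
  fixes F :: "'e::encodable \<Rightarrow> 'i::encodable \<Rightarrow> 'a::encodable \<Rightarrow> 'a" and P :: "nat \<Rightarrow> com"
  defines "body \<equiv> \<lambda>(P :: nat \<Rightarrow> com) n. Seq (Assign (n+3) (exp.Pair (Left (Var (n+1))) (exp.Pair (Var n) (Var (n+2)))))
     (Seq (P (n+3)) (Seq (Assign (n+2) (Var (n+3))) (Assign (n+1) (Right (Var (n+1))))))"
  assumes P: "realizes P p (\<lambda>z. F (fst z) (fst (snd z)) (snd (snd z)))"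
  shows "s n = enc i \<Longrightarrow> s (n+1) = enc xs \<Longrightarrow> s (n+2) = enc a \<Longrightarrow> sz i \<le> M \<Longrightarrow> sz xs \<le> M \<Longrightarrow>
    (\<And>ys zs. xs = ys @ zs \<Longrightarrow> sz (fold (\<lambda>x. F x i) ys a) \<le> M) \<Longrightarrow>
    \<exists>t s'. exec (While (IsNode (Var (n+1))) (body P n)) s t s' \<and> s' (n+2) = enc (fold (\<lambda>x. F x i) xs a) \<and>
      (\<forall>m<n. s' m = s m) \<and> t \<le> (length xs + 1) * (poly p (3 * M + 2) + 30 * M + 30)"
proof (induction xs arbitrary: s a)
  case Nil
  have "\<not> is_true (eval (IsNode (Var (n+1))) s)" using Nil by simp
  then have "exec (While (IsNode (Var (n+1))) (body P n)) s (exp_cost (IsNode (Var (n+1))) s) s"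
    by (rule exec.WhileFalse)
  moreover have "exp_cost (IsNode (Var (n+1))) s \<le> 30"
    using Nil by (simp add: exp_cost_simps truth_def bits_def floorlog_def)
  ultimately show ?case using Nil
    by (intro exI[of _ "exp_cost (IsNode (Var (n+1))) s"] exI[of _ s]) auto
next
  case (Cons x xs)
  let ?T = "poly p (3 * M + 2) + 30 * M + 30"
  let ?e = "exp.Pair (Left (Var (n+1))) (exp.Pair (Var n) (Var (n+2)))"
  have le: "sz x \<le> M" "sz xs \<le> M" "sz a \<le> M" "sz (F x i a) \<le> M"
    using Cons.prems(5) Cons.prems(6)[of "[]" "x # xs"] Cons.prems(6)[of "[x]" xs] by simp_all
  have c: "is_true (eval (IsNode (Var (n+1))) s)" using Cons.prems by simp
  have c0: "exp_cost (IsNode (Var (n+1))) s \<le> M + 3"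
    using Cons.prems(2,5) by (simp add: exp_cost_simps truth_def bits_def floorlog_def sz_def)
  define s1 where "s1 = s(n+3 := eval ?e s)"
  have e1: "exec (Assign (n+3) ?e) s (exp_cost ?e s) s1" unfolding s1_def by (rule exec.Assign)
  have c1: "exp_cost ?e s \<le> 15 * M + 10"
  proof -
    have "exp_cost ?e s = Suc (sz x + Suc (sz i + sz a)) + (sz x + sz (x # xs)) + (Suc (sz i + sz a) + sz i + sz a)"
      using Cons.prems(1-3) by (simp add: exp_cost_simps sz_def)
    then show ?thesis using le Cons.prems(4,5) by simp
  qed
  have "s1 (n+3) = enc (x, i, a)" using Cons.prems(1-3) by (simp add: s1_def)
  from realizesD[OF P, of s1 "n+3" "(x, i, a)", OF this] obtain t2 s2 where 2: "exec (P (n+3)) s1 t2 s2" "s2 (n+3) = enc (F x i a)"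
    "\<forall>m<n+3. s2 m = s1 m" "t2 + sz (F x i a) \<le> poly p (sz (x, i, a))" by auto
  have "poly p (sz (x, i, a)) \<le> poly p (3 * M + 2)"
    by (rule poly_nat_mono) (use le Cons.prems(4) in simp)
  then have c2: "t2 \<le> poly p (3 * M + 2)" using 2(4) by linarith
  define s3 where "s3 = s2(n+2 := eval (Var (n+3)) s2)"
  have e3: "exec (Assign (n+2) (Var (n+3))) s2 (exp_cost (Var (n+3)) s2) s3" unfolding s3_def by (rule exec.Assign)
  have c3: "exp_cost (Var (n+3)) s2 \<le> M" using 2(2) le by (simp add: exp_cost_simps sz_def)
  define s4 where "s4 = s3(n+1 := eval (Right (Var (n+1))) s3)"
  have e4: "exec (Assign (n+1) (Right (Var (n+1)))) s3 (exp_cost (Right (Var (n+1))) s3) s4"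
    unfolding s4_def by (rule exec.Assign)
  have s3: "s3 (n+1) = enc (x # xs)" using 2(3) Cons.prems(2) by (simp add: s3_def s1_def)
  have c4: "exp_cost (Right (Var (n+1))) s3 \<le> 2 * M" 
    using s3 le Cons.prems(5) by (simp add: exp_cost_simps sz_def)
  have s4: "s4 n = enc i" "s4 (n+1) = enc xs" "s4 (n+2) = enc (F x i a)"
    using s3 2(2,3) Cons.prems(1) by (simp_all add: s4_def s3_def s1_def)
  have fr: "\<forall>m<n. s4 m = s m" using 2(3) by (simp add: s4_def s3_def s1_def)
  have b: "exec (body P n) s (exp_cost ?e s + (t2 + (exp_cost (Var (n+3)) s2 + exp_cost (Right (Var (n+1))) s3))) s4"
    unfolding body_def by (rule exec.Seq[OF e1 exec.Seq[OF 2(1) exec.Seq[OF e3 e4]]])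
  have pre: "sz (fold (\<lambda>x. F x i) ys (F x i a)) \<le> M" if "xs = ys @ zs" for ys zs
    using Cons.prems(6)[of "x # ys" zs] that by simp
  obtain t' s' where
    IH: "exec (While (IsNode (Var (n+1))) (body P n)) s4 t' s'" "s' (n+2) = enc (fold (\<lambda>x. F x i) xs (F x i a))"
      "\<forall>m<n. s' m = s4 m" "t' \<le> (length xs + 1) * ?T"
    using Cons.IH[OF s4 Cons.prems(4) le(2)] pre by blast
  let ?t = "exp_cost (IsNode (Var (n+1))) s + (exp_cost ?e s + (t2 + (exp_cost (Var (n+3)) s2 + exp_cost (Right (Var (n+1))) s3))) + t'"
  have "exec (While (IsNode (Var (n+1))) (body P n)) s ?t s'"
    by (rule exec.WhileTrue[OF c b IH(1)])
  moreover have "?t \<le> (length (x # xs) + 1) * ?T" using c0 c1 c2 c3 c4 IH(4) by simp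
  ultimately show ?case using IH fr by (intro exI[of _ ?t] exI[of _ s']) simp
qed

text \<open>A polynomial-time step is not enough, since iterating it may double the accumulator each
  time; hence the separate bound on the result for every prefix of the list.\<close>

lemma ptime_fold_bounded:
  fixes F :: "'e::encodable \<Rightarrow> 'i::encodable \<Rightarrow> 'a::encodable \<Rightarrow> 'a"
  assumes F: "ptime (\<lambda>p. F (fst p) (fst (snd p)) (snd (snd p)))"
    and bnd: "\<And>i xs ys zs a. xs = ys @ zs \<Longrightarrow> sz (fold (\<lambda>x. F x i) ys a) \<le> b (sz (i, xs, a))"
    and b: "poly_bounded b"
    and xs: "ptime xs" and a: "ptime a"
  shows "ptime (\<lambda>i. fold (\<lambda>x. F x i) (xs i) (a i))"
proof -
  obtain P p where P: "realizes P p (\<lambda>z. F (fst z) (fst (snd z)) (snd (snd z)))"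
    using F by (auto simp: ptime_def)
  let ?body = "\<lambda>n. Seq (Assign (n+3) (exp.Pair (Left (Var (n+1))) (exp.Pair (Var n) (Var (n+2)))))
     (Seq (P (n+3)) (Seq (Assign (n+2) (Var (n+3))) (Assign (n+1) (Right (Var (n+1))))))"
  let ?C = "\<lambda>n. Seq (Assign (n+1) (Left (Right (Var n)))) (Seq (Assign (n+2) (Right (Right (Var n))))
     (Seq (Assign n (Left (Var n))) (Seq (While (IsNode (Var (n+1))) (?body n)) (Assign n (Var (n+2))))))"
  let ?T = "\<lambda>k. poly p (3 * (k + b k) + 2) + 30 * (k + b k) + 30"
  obtain q where q: "\<And>n. b n \<le> poly q n" using b by (auto simp: poly_bounded_def)
  have "ptime (\<lambda>z. fold (\<lambda>x. F x (fst z)) (fst (snd z)) (snd (snd z)))"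
  proof (rule ptimeI[where P = ?C and
        b = "\<lambda>n. 10 * n + (n + 1) * (poly p (3 * (n + poly q n) + 2) + 30 * (n + poly q n) + 30) + 2 * poly q n"])
    fix n :: nat and s :: state and z :: "'i \<times> 'e list \<times> 'a" assume s: "s n = enc z"
    obtain i xs a where z: "z = (i, xs, a)" by (cases z)
    let ?k = "sz z" and ?r = "fold (\<lambda>x. F x i) xs a"
    have s: "s n = Node (enc i) (Node (enc xs) (enc a))" using s z by simp
    define s1 where "s1 = s(n+1 := eval (Left (Right (Var n))) s)"
    have e1: "exec (Assign (n+1) (Left (Right (Var n)))) s (exp_cost (Left (Right (Var n))) s) s1"
      unfolding s1_def by (rule exec.Assign)
    define s2 where "s2 = s1(n+2 := eval (Right (Right (Var n))) s1)"
    have e2: "exec (Assign (n+2) (Right (Right (Var n)))) s1 (exp_cost (Right (Right (Var n))) s1) s2"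
      unfolding s2_def by (rule exec.Assign)
    define s3 where "s3 = s2(n := eval (Left (Var n)) s2)"
    have e3: "exec (Assign n (Left (Var n))) s2 (exp_cost (Left (Var n)) s2) s3"
      unfolding s3_def by (rule exec.Assign)
    have s3: "s3 n = enc i" "s3 (n+1) = enc xs" "s3 (n+2) = enc a"
      using s by (simp_all add: s3_def s2_def s1_def)
    have c: "exp_cost (Left (Right (Var n))) s \<le> 3 * ?k" "exp_cost (Right (Right (Var n))) s1 \<le> 3 * ?k"
      "exp_cost (Left (Var n)) s2 \<le> 2 * ?k"
      using s z by (simp_all add: exp_cost_simps s1_def s2_def sz_def)
    have M: "sz i \<le> ?k + poly q ?k" "sz xs \<le> ?k + poly q ?k" using z by auto
    have B: "sz (fold (\<lambda>x. F x i) ys a) \<le> ?k + poly q ?k" if "xs = ys @ zs" for ys zs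
      using bnd[OF that, of i a] q[of ?k] z by simp
    obtain t4 s4 where 4: "exec (While (IsNode (Var (n+1))) (?body n)) s3 t4 s4" "s4 (n+2) = enc ?r"
      "\<forall>m<n. s4 m = s3 m" "t4 \<le> (length xs + 1) * (poly p (3 * (?k + poly q ?k) + 2) + 30 * (?k + poly q ?k) + 30)"
      using exec_fold_loop[OF P s3 M] B by blast
    define s5 where "s5 = s4(n := eval (Var (n+2)) s4)"
    have e5: "exec (Assign n (Var (n+2))) s4 (exp_cost (Var (n+2)) s4) s5"
      unfolding s5_def by (rule exec.Assign)
    have r: "sz ?r \<le> poly q ?k" using bnd[of xs xs "[]" i a] q[of ?k] z by simp
    have c5: "exp_cost (Var (n+2)) s4 = sz ?r" using 4(2) by (simp add: exp_cost_simps sz_def)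
    let ?t = "exp_cost (Left (Right (Var n))) s + (exp_cost (Right (Right (Var n))) s1 +
      (exp_cost (Left (Var n)) s2 + (t4 + exp_cost (Var (n+2)) s4)))"
    have "exec (?C n) s ?t s5" by (rule exec.Seq[OF e1 exec.Seq[OF e2 exec.Seq[OF e3 exec.Seq[OF 4(1) e5]]]])
    moreover have "s5 n = enc ?r" using 4(2) by (simp add: s5_def)
    moreover have "\<forall>m<n. s5 m = s m" using 4(3) by (simp add: s5_def s3_def s2_def s1_def)
    moreover have "t4 \<le> (?k + 1) * (poly p (3 * (?k + poly q ?k) + 2) + 30 * (?k + poly q ?k) + 30)"
      by (rule le_trans[OF 4(4)], rule mult_right_mono) (use length_sz[of xs] z in auto)
    then have "?t + sz ?r \<le> 10 * ?k + (?k + 1) * (poly p (3 * (?k + poly q ?k) + 2) + 30 * (?k + poly q ?k) + 30) + 2 * poly q ?k"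
      using c r unfolding c5 by linarith
    ultimately show "\<exists>t s'. exec (?C n) s t s' \<and> s' n = enc (fold (\<lambda>x. F x (fst z)) (fst (snd z)) (snd (snd z))) \<and>
        (\<forall>m<n. s' m = s m) \<and> t + sz (fold (\<lambda>x. F x (fst z)) (fst (snd z)) (snd (snd z)))
        \<le> 10 * ?k + (?k + 1) * (poly p (3 * (?k + poly q ?k) + 2) + 30 * (?k + poly q ?k) + 30) + 2 * poly q ?k"
      unfolding z by (intro exI[of _ ?t] exI[of _ s5]) (simp only: fst_conv snd_conv simp_thms)
  qed (intro poly_bounded_intros)
  from ptime_comp[OF this ptime_pair[OF ptime_id ptime_pair[OF xs a]]] show ?thesis by simp
qed

text \<open>The growth per step depends on the list element and the parameter but not on the
  accumulator, so over the whole list it adds up instead of compounding.\<close>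

lemma ptime_fold:
  fixes F :: "'e::encodable \<Rightarrow> 'i::encodable \<Rightarrow> 'a::encodable \<Rightarrow> 'a"
  assumes F: "ptime (\<lambda>p. F (fst p) (fst (snd p)) (snd (snd p)))"
    and g: "\<And>x i a. sz (F x i a) \<le> sz a + poly g (sz x + sz i)"
    and xs: "ptime xs" and a: "ptime a"
  shows "ptime (\<lambda>i. fold (\<lambda>x. F x i) (xs i) (a i))"
proof (rule ptime_fold_bounded[OF F _ _ xs a])
  fix i :: 'i and xs ys zs :: "'e list" and a :: 'a assume xs: "xs = ys @ zs"
  have "sz (fold (\<lambda>x. F x i) ys a) \<le> sz a + length ys * poly g (sz xs + sz i)" if "set ys \<subseteq> set xs" for ys a
    using that
  proof (induction ys arbitrary: a)
    case (Cons y ys)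
    have "sz (F y i a) \<le> sz a + poly g (sz y + sz i)" by (rule g)
    also have "poly g (sz y + sz i) \<le> poly g (sz xs + sz i)"
      by (rule poly_nat_mono) (use sz_mem[of y xs] Cons.prems in auto)
    finally show ?case using Cons.IH[of "F y i a"] Cons.prems by (simp add: algebra_simps)
  qed simp
  then have "sz (fold (\<lambda>x. F x i) ys a) \<le> sz a + length ys * poly g (sz xs + sz i)" using xs by simp
  also have "\<dots> \<le> sz (i, xs, a) + sz (i, xs, a) * poly g (sz (i, xs, a))"
    by (intro add_mono mult_mono poly_nat_mono) (use length_sz[of xs] xs in auto)
  finally show "sz (fold (\<lambda>x. F x i) ys a) \<le> sz (i, xs, a) + sz (i, xs, a) * poly g (sz (i, xs, a))" .
qed (intro poly_bounded_intros)

subsection \<open>Basic functions\<close>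

named_theorems ptime_intros

declare ptime_id [ptime_intros] ptime_pair [ptime_intros] ptime_if [ptime_intros]

lemma ptime_comp2:
  assumes "ptime (\<lambda>p. h (fst p) (snd p))" "ptime f" "ptime g"
  shows "ptime (\<lambda>x. h (f x) (g x))"
  using ptime_comp[OF assms(1) ptime_pair[OF assms(2,3)]] by simp

primrec val_exp :: "val \<Rightarrow> exp" where
  "val_exp (Leaf q) = Const q"
| "val_exp (Node v w) = exp.Pair (val_exp v) (val_exp w)"

lemma eval_val_exp [simp]: "eval (val_exp v) s = v"
  by (induction v) auto

lemma exp_cost_val_exp: "exp_cost (val_exp v) s = exp_cost (val_exp v) s'"
  by (induction v) (auto simp: exp_cost_simps)

lemma ptime_const [ptime_intros]: "ptime (\<lambda>x. c)"
  by (rule ptime_exp[where e = "\<lambda>n. val_exp (enc c)" and b = "\<lambda>n. exp_cost (val_exp (enc c)) (\<lambda>_. Leaf 0)"])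
    (auto intro: poly_bounded_intros eq_refl[OF exp_cost_val_exp])

lemma ptime_fst [ptime_intros]:
  fixes f :: "'a::encodable \<Rightarrow> 'b::encodable \<times> 'c::encodable"
  assumes "ptime f" shows "ptime (\<lambda>x. fst (f x))"
proof -
  have "ptime (fst :: 'b \<times> 'c \<Rightarrow> 'b)"
    by (rule ptime_exp[where e = "\<lambda>n. Left (Var n)" and b = "\<lambda>n. n + n"])
      (auto simp: exp_cost_simps sz_def enc_prod_class, intro poly_bounded_intros)
  from ptime_comp[OF this assms] show ?thesis .
qed

lemma ptime_snd [ptime_intros]:
  fixes f :: "'a::encodable \<Rightarrow> 'b::encodable \<times> 'c::encodable"
  assumes "ptime f" shows "ptime (\<lambda>x. snd (f x))"
proof -
  have "ptime (snd :: 'b \<times> 'c \<Rightarrow> 'c)"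
    by (rule ptime_exp[where e = "\<lambda>n. Right (Var n)" and b = "\<lambda>n. n + n"])
      (auto simp: exp_cost_simps sz_def enc_prod_class, intro poly_bounded_intros)
  from ptime_comp[OF this assms] show ?thesis .
qed

text \<open>A nonempty list is encoded exactly like the pair of its head and tail, so the program is
  the identity.\<close>

lemma ptime_Cons [ptime_intros]:
  fixes f :: "'a::encodable \<Rightarrow> 'b::encodable"
  assumes "ptime f" "ptime g" shows "ptime (\<lambda>x. f x # g x)"
proof -
  have "ptime (\<lambda>p :: 'b \<times> 'b list. fst p # snd p)"
    by (rule ptime_exp[where e = Var and b = "\<lambda>n. n"])
      (auto simp: exp_cost_simps sz_def enc_prod_class, intro poly_bounded_intros)
  from ptime_comp2[OF this assms] show ?thesis .
qed

text \<open>Truth values are the numbers 0 and 1, so negation is a difference and, in the lemma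
  after this one, conjunction a product.\<close>

lemma ptime_not [ptime_intros]:
  assumes "ptime f" shows "ptime (\<lambda>x. \<not> f x)"
proof -
  have "ptime Not"
    by (rule ptime_exp[where e = "\<lambda>n. Minus (Const 1) (Var n)" and b = "\<lambda>n. 20"])
      (auto simp: exp_cost_simps sz_def truth_def bits_def floorlog_def, intro poly_bounded_intros)
  from ptime_comp[OF this assms] show ?thesis .
qed

lemma ptime_conj [ptime_intros]:
  assumes "ptime f" "ptime g" shows "ptime (\<lambda>x. f x \<and> g x)"
proof -
  have "ptime (\<lambda>p. fst p \<and> snd p)"
    by (rule ptime_exp[where e = "\<lambda>n. Times (Left (Var n)) (Right (Var n))" and b = "\<lambda>n. 2 * n + 20"])
      (auto simp: exp_cost_simps sz_def enc_prod_class truth_def bits_def floorlog_def, intro poly_bounded_intros)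
  from ptime_comp2[OF this assms] show ?thesis .
qed

lemma ptime_disj [ptime_intros]:
  assumes "ptime f" "ptime g" shows "ptime (\<lambda>x. f x \<or> g x)"
proof -
  have "ptime (\<lambda>x. \<not> (\<not> f x \<and> \<not> g x))" by (intro ptime_intros assms)
  then show ?thesis by simp
qed

lemma ptime_less [ptime_intros]:
  fixes f :: "'a::encodable \<Rightarrow> rat"
  assumes "ptime f" "ptime g" shows "ptime (\<lambda>x. f x < g x)"
proof -
  have "ptime (\<lambda>p :: rat \<times> rat. fst p < snd p)"
    by (rule ptime_exp[where e = "\<lambda>n. Less (Left (Var n)) (Right (Var n))" and b = "\<lambda>n. 3 * n + 20"])
      (auto simp: exp_cost_simps sz_def enc_prod_class truth_def bits_def floorlog_def, intro poly_bounded_intros)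
  from ptime_comp2[OF this assms] show ?thesis .
qed

lemma ptime_of_nat [ptime_intros]:
  assumes "ptime f" shows "ptime (\<lambda>x. rat_of_nat (f x))"
proof -
  have "ptime (\<lambda>n. rat_of_nat n)"
    by (rule ptime_exp[where e = Var and b = "\<lambda>n. n"])
      (auto simp: exp_cost_simps sz_def, intro poly_bounded_intros)
  from ptime_comp[OF this assms] show ?thesis .
qed

lemma ptime_eq_nat [ptime_intros]:
  fixes f :: "'a::encodable \<Rightarrow> nat"
  assumes "ptime f" "ptime g" shows "ptime (\<lambda>x. f x = g x)"
proof -
  have "ptime (\<lambda>x. \<not> rat_of_nat (f x) < rat_of_nat (g x) \<and> \<not> rat_of_nat (g x) < rat_of_nat (f x))"
    by (intro ptime_intros assms)
  then show ?thesis by (simp add: not_less eq_iff conj_commute)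
qed

lemma ptime_eq_pair [ptime_intros]:
  fixes f :: "'a::encodable \<Rightarrow> nat \<times> nat"
  assumes "ptime f" "ptime g" shows "ptime (\<lambda>x. f x = g x)"
  unfolding prod_eq_iff by (intro ptime_intros assms)

lemma ptime_null [ptime_intros]:
  fixes f :: "'a::encodable \<Rightarrow> 'b::encodable list"
  assumes "ptime f" shows "ptime (\<lambda>x. f x = [])"
proof -
  have e: "(case enc (a :: 'b list) of Node u v \<Rightarrow> True | Leaf q \<Rightarrow> False) \<longleftrightarrow> a \<noteq> []" for a
    by (cases a) auto
  have "ptime (\<lambda>a :: 'b list. a = [])"
    by (rule ptime_exp[where e = "\<lambda>n. Minus (Const 1) (IsNode (Var n))" and b = "\<lambda>n. n + 20"])
      (auto simp: exp_cost_simps sz_def e truth_def bits_def floorlog_def, intro poly_bounded_intros)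
  from ptime_comp[OF this assms] show ?thesis .
qed

subsection \<open>Rational arithmetic\<close>

text \<open>Turns estimates of bit lengths into comparisons with powers of two.\<close>

lemma bits_le_iff: "bits z \<le> e \<longleftrightarrow> \<bar>z\<bar> < 2 ^ e"
  by (simp add: bits_def floorlog_le_iff nat_less_iff)

lemma abs_less_bits: "\<bar>z\<bar> < 2 ^ bits z"
  using bits_le_iff[of z "bits z"] by simp

lemma bits_mono: "\<bar>a\<bar> \<le> \<bar>b\<bar> \<Longrightarrow> bits a \<le> bits b"
  unfolding bits_le_iff using abs_less_bits[of b] by linarith

lemma bits_mult: "bits (a * b) \<le> bits a + bits b"
  unfolding bits_le_iff power_add abs_mult by (intro mult_strict_mono' abs_less_bits) auto

lemma bits_add: "\<lbrakk>bits a \<le> e; bits b \<le> e\<rbrakk> \<Longrightarrow> bits (a + b) \<le> e + 1"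
  unfolding bits_le_iff by (auto simp: abs_if split: if_splits)

lemma bits_uminus [simp]: "bits (- a) = bits a"
  by (simp add: bits_def)

text \<open>Reducing a fraction does not increase the bit lengths: by coprimality the reduced
  numerator and denominator divide the given ones.\<close>

lemma bits_quotient:
  assumes "d \<noteq> 0" "r = of_int n / of_int d"
  shows "bits (fst (quotient_of r)) \<le> bits n" "bits (snd (quotient_of r)) \<le> bits d"
proof -
  obtain a b where ab: "quotient_of r = (a, b)" by (cases "quotient_of r")
  have b: "b > 0" and co: "coprime a b" and r: "r = of_int a / of_int b"
    using quotient_of_denom_pos[OF ab] quotient_of_coprime[OF ab] quotient_of_div[OF ab] by auto
  have "rat_of_int (a * d) = rat_of_int (n * b)" using r assms b by (simp add: field_simps)
  then have e: "a * d = n * b" by (simp only: of_int_eq_iff)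
  have "b dvd d" using e co by (metis coprime_commute coprime_dvd_mult_right_iff dvd_triv_right)
  then have "\<bar>b\<bar> \<le> \<bar>d\<bar>" using assms(1) by (simp add: dvd_imp_le_int)
  have "\<bar>a\<bar> \<le> \<bar>n\<bar>"
  proof (cases "n = 0")
    case True
    then show ?thesis using e assms(1) by simp
  next
    case False
    have "a dvd n" using e co by (metis coprime_dvd_mult_left_iff dvd_triv_left)
    then show ?thesis using False by (simp add: dvd_imp_le_int)
  qed
  then show "bits (fst (quotient_of r)) \<le> bits n" "bits (snd (quotient_of r)) \<le> bits d"
    using \<open>\<bar>b\<bar> \<le> \<bar>d\<bar>\<close> ab by (simp_all add: bits_mono)
qed

text \<open>The maximum rather than the sum used in \<open>sz\<close>: adding \<open>q\<close> may
  enlarge numerator and denominator alike, which counts once in the maximum but twice in the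
  sum.\<close>

definition qbits :: "rat \<Rightarrow> nat" where
  "qbits q = max (bits (fst (quotient_of q))) (bits (snd (quotient_of q)))"

lemma sz_rat: "sz q = 1 + bits (fst (quotient_of q)) + bits (snd (quotient_of q))"
  by (simp add: sz_def)

lemma qbits_sz: "qbits q \<le> sz q" "sz q \<le> 1 + 2 * qbits q"
  by (auto simp: sz_rat qbits_def)

text \<open>The additive bound in the second operand keeps iterated sums polynomially small.\<close>

lemma qbits_add: "qbits (p + q) \<le> qbits p + sz q"
proof -
  obtain a b where ab: "quotient_of p = (a, b)" by (cases "quotient_of p")
  obtain c d where cd: "quotient_of q = (c, d)" by (cases "quotient_of q")
  have pos: "b > 0" "d > 0" using quotient_of_denom_pos ab cd by auto
  have "p + q = of_int (a * d + c * b) / of_int (b * d)"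
    using pos quotient_of_div[OF ab] quotient_of_div[OF cd] by (simp add: field_simps)
  note B = bits_quotient[OF _ this]
  have 1: "bits (a * d) \<le> qbits p + (bits c + bits d)" "bits (c * b) \<le> qbits p + (bits c + bits d)"
    "bits (b * d) \<le> qbits p + (bits c + bits d)"
    using bits_mult[of a d] bits_mult[of c b] bits_mult[of b d] ab by (auto simp: qbits_def)
  have "bits (a * d + c * b) \<le> qbits p + (bits c + bits d) + 1" by (rule bits_add[OF 1(1,2)])
  then show ?thesis using B pos 1(3) cd by (auto simp: qbits_def[of "p + q"] sz_rat)
qed

lemma sz_uminus: "sz (- q :: rat) = sz q"
  by (simp add: sz_rat rat_uminus_code Let_def split_beta)

lemma sz_mult: "sz (p * q :: rat) \<le> sz p + sz q"
proof -
  obtain a b where ab: "quotient_of p = (a, b)" by (cases "quotient_of p")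
  obtain c d where cd: "quotient_of q = (c, d)" by (cases "quotient_of q")
  have pos: "b > 0" "d > 0" using quotient_of_denom_pos ab cd by auto
  have "p * q = of_int (a * c) / of_int (b * d)"
    using pos quotient_of_div[OF ab] quotient_of_div[OF cd] by (simp add: field_simps)
  from bits_quotient[OF _ this] show ?thesis
    using bits_mult[of a c] bits_mult[of b d] pos ab cd by (simp add: sz_rat)
qed

lemma sz_add: "sz (p + q :: rat) \<le> 1 + 2 * (sz p + sz q)"
proof -
  have "sz (p + q) \<le> 1 + 2 * qbits (p + q)" by (rule qbits_sz(2))
  also have "\<dots> \<le> 1 + 2 * (qbits p + sz q)" using qbits_add[of p q] by simp
  also have "\<dots> \<le> 1 + 2 * (sz p + sz q)" using qbits_sz(1)[of p] by simp
  finally show ?thesis .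
qed

lemma sz_inverse: "sz (inverse q :: rat) \<le> sz q + 1"
proof (cases "q = 0")
  case False
  obtain c d where cd: "quotient_of q = (c, d)" by (cases "quotient_of q")
  have pos: "d > 0" "c \<noteq> 0" using quotient_of_denom_pos[OF cd] quotient_of_div[OF cd] False by auto
  have "inverse q = of_int d / of_int c"
    unfolding quotient_of_div[OF cd] by simp
  from bits_quotient[OF pos(2) this] show ?thesis using cd by (simp add: sz_rat)
qed simp

lemma sz_divide: "sz (p / q :: rat) \<le> sz p + sz q + 1"
  unfolding divide_inverse using sz_mult[of p "inverse q"] sz_inverse[of q] by simp

lemma ptime_rat_op:
  fixes h :: "rat \<Rightarrow> rat \<Rightarrow> rat"
  assumes "\<And>p q. sz (h p q) \<le> 1 + 2 * (sz p + sz q)"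
    and "\<And>n s p q. s n = Node (Leaf p) (Leaf q) \<Longrightarrow> eval (E (Left (Var n)) (Right (Var n))) s = Leaf (h p q)"
    and "\<And>e e' s. exp_cost (E e e') s = val_size (eval (E e e') s) + exp_cost e s + exp_cost e' s"
    and "ptime f" "ptime g"
  shows "ptime (\<lambda>x. h (f x) (g x))"
proof -
  have "ptime (\<lambda>p. h (fst p) (snd p))"
  proof (rule ptime_exp[where e = "\<lambda>n. E (Left (Var n)) (Right (Var n))" and b = "\<lambda>n. 6 * n + 1"])
    fix n :: nat and s :: state and a :: "rat \<times> rat" assume "s n = enc a"
    then have s: "s n = Node (Leaf (fst a)) (Leaf (snd a))" by (cases a) simp
    show e: "eval (E (Left (Var n)) (Right (Var n))) s = enc (h (fst a) (snd a))"
      using assms(2)[of s n, OF s] by simp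
    have "exp_cost (E (Left (Var n)) (Right (Var n))) s = sz (h (fst a) (snd a)) + (sz (fst a) + sz a) + (sz (snd a) + sz a)"
      unfolding assms(3) e using s by (cases a) (simp add: exp_cost_simps sz_def)
    then show "exp_cost (E (Left (Var n)) (Right (Var n))) s \<le> 6 * sz a + 1"
      using assms(1)[of "fst a" "snd a"] by (cases a) simp
  qed (intro poly_bounded_intros)
  from ptime_comp2[OF this assms(4,5)] show ?thesis .
qed

lemma ptime_plus [ptime_intros]: "ptime f \<Longrightarrow> ptime g \<Longrightarrow> ptime (\<lambda>x. f x + g x :: rat)"
proof (rule ptime_rat_op[where E = Plus and h = "(+)"])
  show "sz (p + q) \<le> 1 + 2 * (sz p + sz q)" for p q :: rat
    by (rule sz_add)
qed (auto simp: exp_cost_simps)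

lemma ptime_minus [ptime_intros]: "ptime f \<Longrightarrow> ptime g \<Longrightarrow> ptime (\<lambda>x. f x - g x :: rat)"
proof (rule ptime_rat_op[where E = Minus and h = "(-)"])
  show "sz (p - q) \<le> 1 + 2 * (sz p + sz q)" for p q :: rat
    using sz_add[of p "- q"] by (simp add: sz_uminus)
qed (auto simp: exp_cost_simps)

lemma ptime_times [ptime_intros]: "ptime f \<Longrightarrow> ptime g \<Longrightarrow> ptime (\<lambda>x. f x * g x :: rat)"
proof (rule ptime_rat_op[where E = Times and h = "(*)"])
  show "sz (p * q) \<le> 1 + 2 * (sz p + sz q)" for p q :: rat
    using sz_mult[of p q] by simp
qed (auto simp: exp_cost_simps)

lemma ptime_divide [ptime_intros]: "ptime f \<Longrightarrow> ptime g \<Longrightarrow> ptime (\<lambda>x. f x / g x :: rat)"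
proof (rule ptime_rat_op[where E = Divide and h = "(/)"])
  show "sz (p / q) \<le> 1 + 2 * (sz p + sz q)" for p q :: rat
    using sz_divide[of p q] by simp
qed (auto simp: exp_cost_simps)

subsection \<open>List functions\<close>

lemma ptime_fold_linear:
  assumes "ptime (\<lambda>p. F (fst p) (fst (snd p)) (snd (snd p)))"
    and "\<And>x i a. sz (F x i a) \<le> sz a + (c + sz x + sz i)"
    and "ptime xs" "ptime a"
  shows "ptime (\<lambda>i. fold (\<lambda>x. F x i) (xs i) (a i))"
  by (rule ptime_fold[where g = "[:c, 1:]"]) (use assms in \<open>auto simp: add.assoc\<close>)

lemma ptime_rev [ptime_intros]:
  assumes "ptime f" shows "ptime (\<lambda>x. rev (f x))"
proof -
  have "ptime (\<lambda>i. fold (\<lambda>x. (#) x) (f i) [])"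
    by (rule ptime_fold_linear[where F = "\<lambda>x i. (#) x" and c = 1]) (auto intro!: ptime_intros assms)
  then show ?thesis by (simp add: fold_Cons_rev)
qed

lemma ptime_append [ptime_intros]:
  assumes "ptime f" "ptime g" shows "ptime (\<lambda>x. f x @ g x)"
proof -
  have "ptime (\<lambda>i. fold (\<lambda>x. (#) x) (rev (f i)) (g i))"
    by (rule ptime_fold_linear[where F = "\<lambda>x i. (#) x" and c = 1]) (auto intro!: ptime_intros assms)
  then show ?thesis by (simp add: fold_Cons_rev)
qed

lemma ptime_concat [ptime_intros]:
  assumes "ptime f" shows "ptime (\<lambda>x. concat (f x))"
proof -
  have "ptime (\<lambda>i. fold (\<lambda>x a. x @ a) (rev (f i)) [])"
  proof (rule ptime_fold_linear[where F = "\<lambda>x i a. x @ a" and c = 0])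
    show "sz (x @ a) \<le> sz a + (0 + sz x + sz i)" for x a :: "'b list" and i :: 'a
      using sz_append[of x a] by simp
  qed (intro ptime_intros assms)+
  moreover have "fold (\<lambda>x a. x @ a) (rev xs) [] = concat xs" for xs :: "'b list list"
    by (induction xs) auto
  ultimately show ?thesis by simp
qed

text \<open>Folding over the reversed list keeps the order; the size of each new element is bounded
  by the polynomial for \<open>f\<close>, independently of the accumulator.\<close>

lemma ptime_map [ptime_intros]:
  assumes "ptime (\<lambda>p. f (fst p) (snd p))" "ptime xs"
  shows "ptime (\<lambda>i. map (\<lambda>x. f x i) (xs i))"
proof -
  obtain q where q: "\<And>a. sz (f (fst a) (snd a)) \<le> poly q (sz a)" using ptime_sz[OF assms(1)] by blast
  have "ptime (\<lambda>p. f (fst p) (fst (snd p)))"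
    using ptime_comp[OF assms(1), of "\<lambda>p. (fst p, fst (snd p))"] by (simp add: ptime_intros)
  then have "ptime (\<lambda>i. fold (\<lambda>x a. f x i # a) (rev (xs i)) [])"
  proof (intro ptime_fold[where F = "\<lambda>x i a. f x i # a" and g = "[:1:] + pcompose q [:1, 1:]"] ptime_intros assms)
    show "sz (f x i # a) \<le> sz a + poly ([:1:] + pcompose q [:1, 1:]) (sz x + sz i)" for x i a
      using q[of "(x, i)"] by (simp add: poly_pcompose)
  qed
  moreover have "fold (\<lambda>x a. f x i # a) (rev xs) [] = map (\<lambda>x. f x i) xs" for i xs
    by (induction xs) auto
  ultimately show ?thesis by simp
qed

lemma ptime_filter [ptime_intros]:
  assumes "ptime (\<lambda>p. f (fst p) (snd p))" "ptime xs"
  shows "ptime (\<lambda>i. filter (\<lambda>x. f x i) (xs i))"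
proof -
  have "ptime (\<lambda>p. f (fst p) (fst (snd p)))"
    using ptime_comp[OF assms(1), of "\<lambda>p. (fst p, fst (snd p))"] by (simp add: ptime_intros)
  then have "ptime (\<lambda>i. fold (\<lambda>x a. if f x i then x # a else a) (rev (xs i)) [])"
    by (intro ptime_fold_linear[where F = "\<lambda>x i a. if f x i then x # a else a" and c = 1] ptime_intros assms) auto
  moreover have "fold (\<lambda>x a. if f x i then x # a else a) (rev xs) [] = filter (\<lambda>x. f x i) xs" for i xs
    by (induction xs) auto
  ultimately show ?thesis by simp
qed

lemma ptime_ball [ptime_intros]:
  assumes "ptime (\<lambda>p. f (fst p) (snd p))" "ptime xs"
  shows "ptime (\<lambda>i. \<forall>x\<in>set (xs i). f x i)"
proof -
  have "ptime (\<lambda>i. filter (\<lambda>x. \<not> f x i) (xs i) = [])" by (intro ptime_intros assms)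
  then show ?thesis by (simp add: filter_empty_conv)
qed

lemma ptime_bex [ptime_intros]:
  assumes "ptime (\<lambda>p. f (fst p) (snd p))" "ptime xs"
  shows "ptime (\<lambda>i. \<exists>x\<in>set (xs i). f x i)"
proof -
  have "ptime (\<lambda>i. \<not> (\<forall>x\<in>set (xs i). \<not> f x i))" by (intro ptime_intros assms)
  then show ?thesis by simp
qed

lemma ptime_member [ptime_intros]:
  fixes f :: "'a::encodable \<Rightarrow> nat"
  assumes "ptime f" "ptime xs" shows "ptime (\<lambda>i. f i \<in> set (xs i))"
proof -
  have "ptime (\<lambda>i. \<exists>x\<in>set (xs i). x = f i)"
    by (intro ptime_intros assms ptime_comp[OF assms(1)])
  then show ?thesis by simp
qed

lemma ptime_member_pair [ptime_intros]:
  fixes f :: "'a::encodable \<Rightarrow> nat \<times> nat"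
  assumes "ptime f" "ptime xs" shows "ptime (\<lambda>i. f i \<in> set (xs i))"
proof -
  have "ptime (\<lambda>i. \<exists>x\<in>set (xs i). x = f i)"
    by (intro ptime_intros assms ptime_comp[OF assms(1)])
  then show ?thesis by simp
qed

text \<open>\<open>sz_add\<close> allows the size to double with each addition, so partial sums are
  measured by \<open>qbits\<close> instead, which grows by at most the size of the summand.\<close>

lemma ptime_sum_list [ptime_intros]:
  fixes f :: "'a::encodable \<Rightarrow> rat list"
  assumes "ptime f" shows "ptime (\<lambda>x. sum_list (f x))"
proof -
  have "ptime (\<lambda>i. fold (\<lambda>x a. a + x) (f i) 0)"
  proof (rule ptime_fold_bounded[where F = "\<lambda>x i a. a + x" and b = "\<lambda>n. 1 + 2 * n"])
    fix i :: 'a and xs ys zs :: "rat list" and a :: rat assume xs: "xs = ys @ zs"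
    have "qbits (fold (\<lambda>x a. a + x) ys a) \<le> qbits a + sz ys"
    proof (induction ys arbitrary: a)
      case (Cons y ys)
      show ?case using Cons.IH[of "a + y"] qbits_add[of a y] by simp
    qed simp
    moreover have "sz ys \<le> sz xs"
    proof -
      have "2 \<le> sz zs" using sz_pos[of "hd zs"] by (cases zs) (auto simp: sz_Nil)
      then show ?thesis unfolding xs by (induction ys) (auto simp: sz_Nil)
    qed
    ultimately show "sz (fold (\<lambda>x a. a + x) ys a) \<le> 1 + 2 * sz (i, xs, a)"
      using qbits_sz[of "fold (\<lambda>x a. a + x) ys a"] qbits_sz[of a] by simp
  qed (intro ptime_intros poly_bounded_intros assms)+
  moreover have "fold (\<lambda>x a. a + x) xs a = a + sum_list xs" for xs and a :: rat
    by (induction xs arbitrary: a) (auto simp: algebra_simps)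
  ultimately show ?thesis by simp
qed

lemma ptime_length [ptime_intros]:
  assumes "ptime f" shows "ptime (\<lambda>x. rat_of_nat (length (f x)))"
proof -
  have "ptime (\<lambda>i. sum_list (map (\<lambda>x. 1 :: rat) (f i)))" by (intro ptime_intros assms)
  then show ?thesis by (simp add: sum_list_triv)
qed

lemma ptime_take_1 [ptime_intros]:
  assumes "ptime f" shows "ptime (\<lambda>x. take (Suc 0) (f x))"
proof -
  have "ptime (\<lambda>i. fold (\<lambda>x a. if a = [] then [x] else a) (f i) [])"
    by (intro ptime_fold_linear[where F = "\<lambda>x i a. if a = [] then [x] else a" and c = 3] ptime_intros assms)
      (auto simp: sz_Nil)
  moreover have "fold (\<lambda>x a. if a = [] then [x] else a) xs [y] = [y]" for xs :: "'b list" and y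
    by (induction xs) auto
  then have "fold (\<lambda>x a. if a = [] then [x] else a) xs [] = take (Suc 0) xs" for xs :: "'b list"
    by (cases xs) auto
  ultimately show ?thesis by simp
qed

section \<open>Running time of the algorithm\<close>

text \<open>Lifts a statement about one tuple argument to an introduction rule for curried functions
  with arbitrary arguments; the variants with more arguments serve the same purpose.\<close>

lemma ptime_comp3:
  assumes "ptime (\<lambda>p. h (fst p) (fst (snd p)) (snd (snd p)))" "ptime f" "ptime g" "ptime k"
  shows "ptime (\<lambda>x. h (f x) (g x) (k x))"
  using ptime_comp[OF assms(1) ptime_pair[OF assms(2) ptime_pair[OF assms(3,4)]]] by simp

lemma ptime_comp4:
  assumes "ptime (\<lambda>p. h (fst p) (fst (snd p)) (fst (snd (snd p))) (snd (snd (snd p))))"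
    "ptime f" "ptime g" "ptime k" "ptime m"
  shows "ptime (\<lambda>x. h (f x) (g x) (k x) (m x))"
  using ptime_comp[OF assms(1) ptime_pair[OF assms(2) ptime_pair[OF assms(3) ptime_pair[OF assms(4,5)]]]] by simp

lemma ptime_comp5:
  assumes "ptime (\<lambda>p. h (fst p) (fst (snd p)) (fst (snd (snd p))) (fst (snd (snd (snd p)))) (snd (snd (snd (snd p)))))"
    "ptime f" "ptime g" "ptime k" "ptime m" "ptime n"
  shows "ptime (\<lambda>x. h (f x) (g x) (k x) (m x) (n x))"
  using ptime_comp[OF assms(1) ptime_pair[OF assms(2) ptime_pair[OF assms(3) ptime_pair[OF assms(4) ptime_pair[OF assms(5,6)]]]]] by simp

lemma ptime_scan:
  "ptime (\<lambda>p :: (nat \<times> nat) \<times> (nat list \<times> (nat \<times> nat) list \<times> nat) \<times> (nat \<times> nat) list.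
     scan (snd (snd (fst (snd p)))) (fst p) (snd (snd p)))"
  unfolding scan_def known_def by (intro ptime_intros)

lemma ptime_parent_list [ptime_intros]:
  fixes r :: "'a::encodable \<Rightarrow> nat"
  assumes "ptime vl" "ptime al" "ptime r"
  shows "ptime (\<lambda>x. parent_list (vl x) (al x) (r x))"
proof (rule ptime_comp3[OF _ assms])
  show "ptime (\<lambda>p :: nat list \<times> (nat \<times> nat) list \<times> nat. parent_list (fst p) (fst (snd p)) (snd (snd p)))"
    unfolding parent_list_def
  proof (intro ptime_fold_linear[where F = "\<lambda>e i. scan (snd (snd i)) e" and c = 1] ptime_scan ptime_intros)
    show "sz (scan (snd (snd i)) e a) \<le> sz a + (1 + sz e + sz i)" for e a and i :: "nat list \<times> (nat \<times> nat) list \<times> nat"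
      by (cases e) (simp add: scan_def)
  qed
qed

lemma ptime_rpath [ptime_intros]:
  fixes v :: "'a::encodable \<Rightarrow> nat"
  assumes "ptime ps" "ptime v"
  shows "ptime (\<lambda>x. rpath (ps x) (v x))"
proof (rule ptime_comp2[OF _ assms])
  have 1: "ptime (\<lambda>p :: (nat \<times> nat) \<times> ((nat \<times> nat) list \<times> nat) \<times> nat \<times> nat list. rpath_step (fst p) (snd (snd p)))"
    unfolding rpath_step_def by (intro ptime_intros)
  have 2: "sz (rpath_step e a) \<le> sz a + poly [:2, 2:] (sz e + sz i)" for e :: "nat \<times> nat" and a and i :: "(nat \<times> nat) list \<times> nat"
    by (cases e; cases a) (simp add: rpath_step_def)
  show "ptime (\<lambda>p :: (nat \<times> nat) list \<times> nat. rpath (fst p) (snd p))"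
    unfolding rpath_def by (intro ptime_fold[where F = "\<lambda>e i. rpath_step e" and g = "[:2, 2:]"] 1 2 ptime_intros)
qed

lemma ptime_asc_list [ptime_intros]:
  fixes a :: "'a::encodable \<Rightarrow> nat"
  assumes "ptime ps" "ptime a" "ptime b"
  shows "ptime (\<lambda>x. asc_list (ps x) (a x) (b x))"
  by (rule ptime_comp3[where h = asc_list, OF _ assms]) (unfold asc_list_def, intro ptime_intros)

lemma ptime_path_list [ptime_intros]:
  fixes l :: "'a::encodable \<Rightarrow> nat \<times> nat"
  assumes "ptime ps" "ptime l"
  shows "ptime (\<lambda>x. path_list (ps x) (l x))"
  by (rule ptime_comp2[where h = path_list, OF _ assms]) (unfold path_list_def, intro ptime_intros)

lemma ptime_steps_list [ptime_intros]:
  fixes p :: "'a::encodable \<Rightarrow> nat list"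
  assumes "ptime p"
  shows "ptime (\<lambda>x. steps_list (p x))"
proof (rule ptime_comp[OF _ assms])
  have 1: "ptime (\<lambda>p :: nat \<times> nat list \<times> nat list \<times> (nat \<times> nat) list. steps_step (fst p) (snd (snd p)))"
    unfolding steps_step_def by (intro ptime_intros)
  have 2: "sz (steps_step b acc) \<le> sz acc + poly [:6, 2:] (sz b + sz i)" for b :: nat and acc and i :: "nat list"
    by (cases acc; cases "fst acc") (simp_all add: steps_step_def sz_Nil)
  show "ptime (\<lambda>p :: nat list. steps_list p)"
    unfolding steps_list_def by (intro ptime_fold[where F = "\<lambda>e i. steps_step e" and g = "[:6, 2:]"] 1 2 ptime_intros)
qed

lemma ptime_pieces [ptime_intros]:
  fixes l :: "'a::encodable \<Rightarrow> nat \<times> nat"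
  assumes "ptime ps" "ptime SU" "ptime SD" "ptime l"
  shows "ptime (\<lambda>x. pieces (ps x) (SU x) (SD x) (l x))"
  by (rule ptime_comp4[where h = pieces, OF _ assms]) (unfold pieces_def, intro ptime_intros)

lemma ptime_reach_list [ptime_intros]:
  fixes v :: "'a::encodable \<Rightarrow> nat"
  assumes "ptime ps" "ptime al" "ptime S" "ptime v"
  shows "ptime (\<lambda>x. reach_list (ps x) (al x) (S x) (v x))"
  by (rule ptime_comp4[where h = reach_list, OF _ assms]) (unfold reach_list_def, intro ptime_intros)

lemma ptime_front_list [ptime_intros]:
  fixes v :: "'a::encodable \<Rightarrow> nat"
  assumes "ptime ps" "ptime al" "ptime S" "ptime v"
  shows "ptime (\<lambda>x. front_list (ps x) (al x) (S x) (v x))"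
  by (rule ptime_comp4[where h = front_list, OF _ assms]) (unfold front_list_def, intro ptime_intros)

lemma ptime_mass_list [ptime_intros]:
  fixes v :: "'a::encodable \<Rightarrow> nat"
  assumes "ptime ps" "ptime xs" "ptime v"
  shows "ptime (\<lambda>x. mass_list (ps x) (xs x) (v x))"
  by (rule ptime_comp3[where h = mass_list, OF _ assms]) (unfold mass_list_def, intro ptime_intros)

text \<open>The data that stay fixed during the loop form the parameter tuple. However costly the
  test at a vertex is, the accumulator grows by at most that one vertex.\<close>

lemma ptime_cut_list [ptime_intros]:
  fixes ps :: "'a::encodable \<Rightarrow> (nat \<times> nat) list"
  assumes "ptime ps" "ptime al" "ptime xs" "ptime z" "ptime k"
  shows "ptime (\<lambda>x. cut_list (ps x) (al x) (xs x) (z x) (k x))"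
proof (rule ptime_comp5[OF _ assms])
  let ?F = "\<lambda>(e :: nat \<times> nat) (i :: (nat \<times> nat) list \<times> (nat \<times> nat) list \<times> ((nat \<times> nat) \<times> rat) list \<times> rat \<times> rat) S.
     if mass_list (fst i) (fst (snd (snd i))) (fst e) < fst (snd (snd (snd i))) \<and>
       snd (snd (snd (snd i))) < of_nat (length (front_list (fst i) (fst (snd i)) S (fst e)))
     then fst e # S else S"
  have 1: "ptime (\<lambda>p. ?F (fst p) (fst (snd p)) (snd (snd p)))"
    by (intro ptime_intros)
  have 2: "sz (?F e i S) \<le> sz S + (1 + sz e + sz i)" for e i S
    by (cases e) simp
  show "ptime (\<lambda>p :: (nat \<times> nat) list \<times> (nat \<times> nat) list \<times> ((nat \<times> nat) \<times> rat) list \<times> rat \<times> rat.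
      cut_list (fst p) (fst (snd p)) (fst (snd (snd p))) (fst (snd (snd (snd p)))) (snd (snd (snd (snd p)))))"
    unfolding cut_list_def cut_fold_def
    by (rule ptime_fold_linear[where F = ?F and c = 1, OF 1 2]) (intro ptime_intros)+
qed

section \<open>Rational parameters and the assembled program\<close>

definition zeta2_rat :: "rat \<Rightarrow> rat \<Rightarrow> rat" where
  "zeta2_rat \<epsilon> \<Delta> = 6 * (2 / \<epsilon>) * \<Delta> / (\<epsilon> * (1 - \<epsilon>))"

definition kpar_rat :: "rat \<Rightarrow> rat \<Rightarrow> rat" where
  "kpar_rat \<epsilon> \<Delta> = (1 + 1 / (\<epsilon> / (2 * \<Delta>))) * zeta2_rat \<epsilon> \<Delta>"

lemma of_rat_zeta2: "of_rat (zeta2_rat \<epsilon> \<Delta>) = zeta2 (of_rat \<epsilon>) (of_rat \<Delta>)"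
  by (simp add: zeta2_rat_def zeta2_def zeta1_def of_rat_mult of_rat_divide of_rat_diff)

lemma of_rat_kpar: "of_rat (kpar_rat \<epsilon> \<Delta>) = kpar (of_rat \<epsilon>) (of_rat \<Delta>)"
  by (simp add: kpar_rat_def kpar_def gamma_def of_rat_zeta2 of_rat_mult of_rat_divide of_rat_add inverse_eq_divide)

text \<open>Direction \<open>False\<close> is reduced to direction \<open>True\<close> by reversing
  all arcs and all links.\<close>

definition cuts :: "bool \<Rightarrow> (nat \<times> nat) list \<Rightarrow> (nat \<times> nat) list \<Rightarrow> ((nat \<times> nat) \<times> rat) list \<Rightarrow> rat \<Rightarrow> rat \<Rightarrow> nat list" where
  "cuts d ps al xs \<epsilon> \<Delta> =
    cut_list ps (if d then al else map (\<lambda>a. (snd a, fst a)) al)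
      (if d then xs else map (\<lambda>y. ((snd (fst y), fst (fst y)), snd y)) xs) (zeta2_rat \<epsilon> \<Delta>) (kpar_rat \<epsilon> \<Delta>)"

lemma ptime_cuts [ptime_intros]:
  fixes ps :: "'a::encodable \<Rightarrow> (nat \<times> nat) list"
  assumes "ptime ps" "ptime al" "ptime xs" "ptime \<epsilon>" "ptime \<Delta>"
  shows "ptime (\<lambda>x. cuts d (ps x) (al x) (xs x) (\<epsilon> x) (\<Delta> x))"
proof (rule ptime_comp5[OF _ assms])
  show "ptime (\<lambda>p :: (nat \<times> nat) list \<times> (nat \<times> nat) list \<times> ((nat \<times> nat) \<times> rat) list \<times> rat \<times> rat.
      cuts d (fst p) (fst (snd p)) (fst (snd (snd p))) (fst (snd (snd (snd p)))) (snd (snd (snd (snd p)))))"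
    unfolding cuts_def zeta2_rat_def kpar_rat_def by (intro ptime_intros)
qed

type_synonym input = "rat \<times> rat \<times> nat list \<times> (nat \<times> nat) list \<times> nat \<times> ((nat \<times> nat) \<times> rat \<times> rat) list"

definition cuts_of :: "bool \<Rightarrow> input \<Rightarrow> nat list" where
  "cuts_of d = (\<lambda>(\<epsilon>, \<Delta>, vl, al, r, L). cuts d (parent_list vl al r) al (map (\<lambda>e. (fst e, snd (snd e))) L) \<epsilon> \<Delta>)"

definition algorithm :: "input \<Rightarrow> ((nat \<times> nat) \<times> (nat \<times> nat) list) list \<times> nat list" where
  "algorithm = (\<lambda>i. case i of (\<epsilon>, \<Delta>, vl, al, r, L) \<Rightarrow>
     (map (\<lambda>e. (fst e, pieces (parent_list vl al r) (cuts_of True i) (cuts_of False i) (fst e))) L,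
      r # cuts_of True i @ cuts_of False i))"

lemma ptime_cuts_of [ptime_intros]:
  assumes "ptime f" shows "ptime (\<lambda>x. cuts_of d (f x))"
proof (rule ptime_comp[OF _ assms])
  show "ptime (\<lambda>i. cuts_of d i)"
    unfolding cuts_of_def case_prod_beta by (intro ptime_intros)
qed

lemma ptime_algorithm: "ptime algorithm"
  unfolding algorithm_def case_prod_beta by (intro ptime_intros)

section \<open>The theorem\<close>

text \<open>The lists computed by the program are known to agree with \<open>cut\<close> only on
  links, which is all that the guarantee inspects.\<close>

lemma guarantee_cong:
  assumes "\<And>l. l \<in> links I \<Longrightarrow> \<sigma> l = \<sigma>' l"
  shows "guarantee \<epsilon> \<Delta> I x \<sigma> W = guarantee \<epsilon> \<Delta> I x \<sigma>' W"
proof -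
  have "splitting I \<sigma> = splitting I \<sigma>'" using assms by (auto simp: splitting_def)
  moreover have "{l \<in> links I. l' \<in> \<sigma> l} = {l \<in> links I. l' \<in> \<sigma>' l}" for l' using assms by auto
  then have "split I x \<sigma> = split I x \<sigma>'" by (intro ext) (simp add: split_def)
  ultimately show ?thesis by (simp add: guarantee_def)
qed

text \<open>Rational comparisons carry over exactly to the reals, so the computed lists solve the
  fixed-point equation with the real thresholds.\<close>

lemma algorithm_correct:
  fixes \<epsilon> \<Delta> :: rat and vl :: "nat list" and al :: "nat arc list" and r :: nat and ll :: "nat link list"
    and c x :: "nat link \<Rightarrow> rat"
  defines "i \<equiv> (\<epsilon>, \<Delta>, vl, al, r, map (\<lambda>l. (l, c l, x l)) ll)"
  assumes d: "distinct ll"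
    and adm: "admissible (of_rat \<epsilon>) (of_rat \<Delta>) (rat_wdtap vl al r ll c) (\<lambda>l. of_rat (x l))"
  shows "guarantee (of_rat \<epsilon>) (of_rat \<Delta>) (rat_wdtap vl al r ll c) (\<lambda>l. of_rat (x l))
    (\<lambda>l. set (pieces (parent_list vl al r) (cuts_of True i) (cuts_of False i) l))
    (set (r # cuts_of True i @ cuts_of False i))"
proof -
  let ?I = "rat_wdtap vl al r ll c" and ?x = "\<lambda>l. real_of_rat (x l)"
  let ?ps = "parent_list vl al r"
  interpret wdtap_tree ?I using adm by unfold_locales (simp add: admissible_def)
  have I [simp]: "verts ?I = set vl" "arcs ?I = set al" "wdtap.root ?I = r" "links ?I = set ll"
    by (simp_all add: rat_wdtap_def)
  have ps: "parent_chain ?ps" "set (map fst ?ps) = verts ?I - {wdtap.root ?I}"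
    using parent_list_correct[of vl al] by auto
  define S where "S = (\<lambda>d. if d then set (cuts_of True i) else set (cuts_of False i))"
  have S: "S d = set (cut_list ?ps (if d then al else map (\<lambda>a. (snd a, fst a)) al)
      (if d then map (\<lambda>l. (l, x l)) ll else map (\<lambda>y. (prod.swap (fst y), snd y)) (map (\<lambda>l. (l, x l)) ll))
      (zeta2_rat \<epsilon> \<Delta>) (kpar_rat \<epsilon> \<Delta>))" for d
    by (simp add: S_def cuts_of_def cuts_def i_def o_def prod.swap_def)
  have "cut_system (zeta2 (of_rat \<epsilon>) (of_rat \<Delta>)) (kpar (of_rat \<epsilon>) (of_rat \<Delta>)) ?x S"
    unfolding cut_system_def
  proof (intro allI)
    fix d v
    have al: "set (if d then al else map (\<lambda>a. (snd a, fst a)) al) = (if d then arcs ?I else prod.swap ` arcs ?I)"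
      by (simp add: prod.swap_def)
    show "v \<in> S d \<longleftrightarrow> v \<in> verts ?I - {wdtap.root ?I} \<and>
      mass ?x d v < zeta2 (of_rat \<epsilon>) (of_rat \<Delta>) \<and> kpar (of_rat \<epsilon>) (of_rat \<Delta>) < card (front (S d) d v)"
      unfolding S of_rat_zeta2[symmetric] of_rat_kpar[symmetric]
      by (rule cut_list_correct[OF ps al, where L = "map (\<lambda>l. (l, x l)) ll"])
        (use d in \<open>auto simp: o_def\<close>)
  qed
  then have g: "guarantee (of_rat \<epsilon>) (of_rat \<Delta>) ?I ?x (cut S) (cut_points S)"
    by (rule guarantee_cut[OF adm])
  have "cut_points S = set (r # cuts_of True i @ cuts_of False i)"
    by (auto simp: cut_points_def S_def)
  moreover have "cut S l = set (pieces ?ps (cuts_of True i) (cuts_of False i) l)" if "l \<in> links ?I" for l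
    unfolding S_def by (rule pieces_correct[OF ps, symmetric]) (use that links_verts in auto)
  ultimately show ?thesis using g guarantee_cong[of ?I "cut S"] by metis
qed

lemma enc_list_eq: "(\<And>a. f a = enc (g a)) \<Longrightarrow> enc_list f xs = enc (map g xs)"
  by (induction xs) (simp_all add: enc_list_def)

lemma enc_pair_eq: "enc_pair p = enc p"
  by (simp add: enc_pair_def enc_nat_def enc_prod_class)

theorem theorem8p3:
  shows "(\<forall>(\<epsilon>::real) (\<Delta>::real) (I :: 'v wdtap) (x :: 'v link \<Rightarrow> real).
            admissible \<epsilon> \<Delta> I x \<longrightarrow>
            (\<exists>(\<sigma>s :: 'v link \<Rightarrow> 'v link set) (Ws :: 'v set). guarantee \<epsilon> \<Delta> I x \<sigma>s Ws)) \<and>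
         (\<exists>(P :: com) (q :: nat poly).
            \<forall>(\<epsilon>::rat) (\<Delta>::rat) (vl :: nat list) (al :: nat arc list) (r :: nat)
              (ll :: nat link list) (c :: nat link \<Rightarrow> rat) (x :: nat link \<Rightarrow> rat).
              distinct vl \<and> distinct al \<and> distinct ll \<and>
              admissible (of_rat \<epsilon>) (of_rat \<Delta>) (rat_wdtap vl al r ll c) (\<lambda>l. of_rat (x l)) \<longrightarrow>
              (\<exists>(S :: nat link \<Rightarrow> nat link list) (wl :: nat list).
                 computes_within P q (enc_input \<epsilon> \<Delta> vl al r ll c x) (enc_output ll S wl) \<and>
                 guarantee (of_rat \<epsilon>) (of_rat \<Delta>) (rat_wdtap vl al r ll c) (\<lambda>l. of_rat (x l))
                   (\<lambda>l. set (S l)) (set wl)))"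
proof -
  have 1: "\<exists>\<sigma>s Ws. guarantee \<epsilon> \<Delta> I x \<sigma>s Ws"
    if adm: "admissible \<epsilon> \<Delta> I x" for \<epsilon> \<Delta> and I :: "'v wdtap" and x
  proof -
    interpret wdtap_tree I using adm by unfold_locales (simp add: admissible_def)
    show ?thesis using cut_system_exists guarantee_cut[OF adm] by blast
  qed
  obtain P q where P: "realizes P q algorithm" using ptime_algorithm by (auto simp: ptime_def)
  have 2: "\<exists>S wl. computes_within (P 0) q (enc_input \<epsilon> \<Delta> vl al r ll c x) (enc_output ll S wl) \<and>
      guarantee (of_rat \<epsilon>) (of_rat \<Delta>) (rat_wdtap vl al r ll c) (\<lambda>l. of_rat (x l)) (\<lambda>l. set (S l)) (set wl)"
    if d: "distinct ll" and adm: "admissible (of_rat \<epsilon>) (of_rat \<Delta>) (rat_wdtap vl al r ll c) (\<lambda>l. of_rat (x l))"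
    for \<epsilon> \<Delta> :: rat and vl al r ll and c x :: "nat link \<Rightarrow> rat"
  proof -
    define i where "i = (\<epsilon>, \<Delta>, vl, al, r, map (\<lambda>l. (l, c l, x l)) ll)"
    define S where "S = pieces (parent_list vl al r) (cuts_of True i) (cuts_of False i)"
    define wl where "wl = r # cuts_of True i @ cuts_of False i"
    have "enc_list (\<lambda>l. Node (enc_pair l) (Node (Leaf (c l)) (Leaf (x l)))) ll = enc (map (\<lambda>l. (l, c l, x l)) ll)"
      by (rule enc_list_eq) (simp add: enc_pair_eq)
    then have inp: "enc_input \<epsilon> \<Delta> vl al r ll c x = enc i"
      using enc_list_eq[of enc_nat "\<lambda>n. n" vl] enc_list_eq[of enc_pair "\<lambda>p. p" al]
      by (simp add: enc_input_def i_def enc_pair_eq enc_nat_def)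
    have "enc_list (\<lambda>l. Node (enc_pair l) (enc_list enc_pair (S l))) ll = enc (map (\<lambda>l. (l, S l)) ll)"
      by (rule enc_list_eq) (use enc_list_eq[of enc_pair "\<lambda>p. p"] in \<open>simp add: enc_pair_eq\<close>)
    moreover have "algorithm i = (map (\<lambda>l. (l, S l)) ll, wl)"
      by (simp add: algorithm_def i_def S_def wl_def o_def)
    ultimately have out: "enc_output ll S wl = enc (algorithm i)"
      using enc_list_eq[of enc_nat "\<lambda>n. n" wl] by (simp add: enc_output_def enc_nat_def)
    \<comment> \<open>The program is used at variable 0, where the input is placed and the output
      expected; whatever lies above may hold any initial value.\<close>
    obtain t s' where "exec (P 0) ((\<lambda>_. Leaf 0)(0 := enc i)) t s'" "s' 0 = enc (algorithm i)"
      "t + sz (algorithm i) \<le> poly q (sz i)"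
      using realizesD[OF P, of "(\<lambda>_. Leaf 0)(0 := enc i)" 0 i] by auto
    then have "computes_within (P 0) q (enc i) (enc (algorithm i))"
      unfolding computes_within_def sz_def by (meson add_leD1)
    then have "computes_within (P 0) q (enc_input \<epsilon> \<Delta> vl al r ll c x) (enc_output ll S wl)"
      by (simp only: inp out)
    moreover have "guarantee (of_rat \<epsilon>) (of_rat \<Delta>) (rat_wdtap vl al r ll c) (\<lambda>l. of_rat (x l)) (\<lambda>l. set (S l)) (set wl)"
      using algorithm_correct[OF d adm] by (simp only: S_def wl_def i_def)
    ultimately show ?thesis by blast
  qed
  show ?thesis
  proof (rule conjI)
    show "\<forall>\<epsilon> \<Delta> I x. admissible \<epsilon> \<Delta> (I :: 'v wdtap) x \<longrightarrow> (\<exists>\<sigma>s Ws. guarantee \<epsilon> \<Delta> I x \<sigma>s Ws)"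
      using 1 by blast
  qed (rule exI[of _ "P 0"], rule exI[of _ q], use 2 in blast)
qed

end
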